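(* Assume (H1), (H3), (H4) with $\alpha=p^*-1$, and let $\Lambda_{**}>0$ and $\lambda\in(0,\Lambda_{**})$ be such that the conclusion of Proposition strong-con holds: for a sequence $(u_k)\subset M_\lambda^+$ with $u_k\ge0$ a.e., $m_\lambda^+\le I_\lambda(u_k)\le m_\lambda^++\frac1k$ and $I_\lambda(v)\ge I_\lambda(u_k)-\frac{\|v-u_k\|}{k}$ for all $v\in M_\lambda^+\cup\{0\}$, one has $u_k\to u_0$ strongly in $W_0^{1,\mathcal H}(\Omega)$ (up to a subsequence) with $u_0\ge0$ a.e., $u_0\in M_\lambda^+$ and $I_\lambda(u_0)=m_\lambda^+:=\inf_{M_\lambda^+}I_\lambda$. Then $u_0>0$ a.e. in $\Omega$ and $u_0$ is a weak solution of (P) with $\alpha=p^*-1$.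
   Context: Let $\Omega\subset\mathbb R^N$, $N\ge2$, be a bounded Lipschitz domain; $H$ is a Finsler–Minkowski norm on $\mathbb R^N$ ($H(\xi)=0$ iff $\xi=0$, $H\in C^\infty(\mathbb R^N\setminus\{0\})$, $H(t\xi)=|t|H(\xi)$, Hessian of $H^2/2$ positive definite off $0$); $\nabla_\eta H$ is its gradient. (H1): $\lambda>0$, $0<\delta<1$, $2\le p<q<N$, $q<\alpha+1\le p^*:=\frac{Np}{N-p}$, $\frac qp<1+\frac1N$, $0\le\mu\in C^{0,1}(\overline\Omega)$. (H3): $a>0$ a.e., $a\in L^{p^*/(p^*-1+\delta)}(\Omega)$. (H4): $b\in L^\infty(\Omega)$, possibly sign-changing, $b^+\not\equiv0$. $W_0^{1,\mathcal H}(\Omega)$ is the completion of $C_c^\infty(\Omega)$ in $\{u\in L^{\mathcal H}:H(\nabla u)\in L^{\mathcal H}\}$, $\mathcal H(x,t)=t^p+\mu(x)t^q$, with norm $\|u\|=\|H(\nabla u)\|_{\mathcal H}$ (Luxemburg norm). Problem (P): $-\mathrm{div}\big((H(\nabla u)^{p-1}+\mu H(\nabla u)^{q-1})\nabla_\eta H(\nabla u)\big)=a u^{-\delta}+\lambda b u^\alpha$, $u>0$ in $\Omega$, $u=0$ on $\partial\Omega$; a weak solution is $u\in W_0^{1,\mathcal H}(\Omega)$, $u>0$ a.e., with $\int_\Omega(H(\nabla u)^{p-1}+\mu H(\nabla u)^{q-1})\nabla_\eta H(\nabla u)\cdot\nabla\phi\,dx=\int_\Omega(au^{-\delta}+\lambda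 bu^\alpha)\phi\,dx$ for all $\phi\in C_c^1(\Omega)$. $I_\lambda(u)=\int_\Omega\big(\frac{H(\nabla u)^p}{p}+\mu\frac{H(\nabla u)^q}{q}\big)dx-\frac1{1-\delta}\int_\Omega a|u|^{1-\delta}dx-\frac{\lambda}{p^*}\int_\Omega b|u|^{p^*}dx$; $\phi_u(t)=I_\lambda(tu)$. $M_\lambda=\{u\ne0:\phi_u'(1)=0\}$, $M_\lambda^+=\{u\in M_\lambda:\phi_u''(1)>0\}$, where $\phi_u'(1)=\int_\Omega(H(\nabla u)^p+\mu H(\nabla u)^q)-\int_\Omega a|u|^{1-\delta}-\lambda\int_\Omega b|u|^{p^*}$ and $\phi_u''(1)=\int_\Omega((p-1)H(\nabla u)^p+(q-1)\mu H(\nabla u)^q)+\delta\int_\Omega a|u|^{1-\delta}-\lambda(p^*-1)\int_\Omega b|u|^{p^*}$. *)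

theory Defs
  imports "HOL-Analysis.Analysis"
begin

text \<open>Ck k S f: f is k times continuously (Frechet) differentiable at every point of S
  (intended for open S). Higher derivatives are taken via directional derivatives.\<close>
fun Ck :: "nat \<Rightarrow> 'a::real_normed_vector set \<Rightarrow> ('a \<Rightarrow> 'b::real_normed_vector) \<Rightarrow> bool" where
  "Ck 0 S f = continuous_on S f"
| "Ck (Suc k) S f = (continuous_on S f \<and> (\<forall>x\<in>S. f differentiable (at x)) \<and>
      (\<forall>v. Ck k S (\<lambda>x. frechet_derivative f (at x) v)))"

definition smooth_on :: "'a::real_normed_vector set \<Rightarrow> ('a \<Rightarrow> 'b::real_normed_vector) \<Rightarrow> bool" where
  "smooth_on S f = (\<forall>k. Ck k S f)"

definition cgrad :: "(real^'n \<Rightarrow> real) \<Rightarrow> real^'n \<Rightarrow> real^'n" where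
  "cgrad f x = (\<chi> i. frechet_derivative f (at x) (axis i 1))"

definition compact_supp_in :: "(real^'n) set \<Rightarrow> (real^'n \<Rightarrow> real) \<Rightarrow> bool" where
  "compact_supp_in \<Omega> \<phi> = (\<exists>K. compact K \<and> K \<subseteq> \<Omega> \<and> (\<forall>x. x \<notin> K \<longrightarrow> \<phi> x = 0))"

definition Cc_inf :: "(real^'n) set \<Rightarrow> (real^'n \<Rightarrow> real) set" where
  "Cc_inf \<Omega> = {\<phi>. smooth_on UNIV \<phi> \<and> compact_supp_in \<Omega> \<phi>}"

definition Cc_1 :: "(real^'n) set \<Rightarrow> (real^'n \<Rightarrow> real) set" where
  "Cc_1 \<Omega> = {\<phi>. Ck 1 UNIV \<phi> \<and> compact_supp_in \<Omega> \<phi>}"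

definition lipschitz_domain :: "(real^'n) set \<Rightarrow> bool" where
  "lipschitz_domain \<Omega> = (bounded \<Omega> \<and> open \<Omega> \<and> connected \<Omega> \<and> \<Omega> \<noteq> {} \<and>
     (\<forall>x\<in>frontier \<Omega>. \<exists>r>0. \<exists>e::real^'n. \<exists>\<gamma> L. norm e = 1 \<and>
        L-lipschitz_on {z. z \<bullet> e = 0} \<gamma> \<and>
        \<Omega> \<inter> ball x r = {y \<in> ball x r. \<gamma> (y - (y \<bullet> e) *\<^sub>R e) < y \<bullet> e}))"

definition finsler_minkowski :: "(real^'n \<Rightarrow> real) \<Rightarrow> bool" where
  "finsler_minkowski H = ((\<forall>\<xi>. 0 \<le> H \<xi>) \<and> (\<forall>\<xi>. H \<xi> = 0 \<longleftrightarrow> \<xi> = 0) \<and>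
     (\<forall>t \<xi>. H (t *\<^sub>R \<xi>) = \<bar>t\<bar> * H \<xi>) \<and>
     smooth_on (- {0}) H \<and>
     (\<forall>\<xi>. \<xi> \<noteq> 0 \<longrightarrow> (\<forall>v. v \<noteq> 0 \<longrightarrow>
        frechet_derivative (\<lambda>\<eta>. frechet_derivative (\<lambda>\<zeta>. (H \<zeta>)\<^sup>2 / 2) (at \<eta>) v) (at \<xi>) v > 0)))"

definition modH :: "real \<Rightarrow> real \<Rightarrow> (real^'n \<Rightarrow> real) \<Rightarrow> real^'n \<Rightarrow> real \<Rightarrow> real" where
  "modH p q \<mu> x t = t powr p + \<mu> x * t powr q"

definition modular :: "real \<Rightarrow> real \<Rightarrow> (real^'n \<Rightarrow> real) \<Rightarrow> (real^'n) set \<Rightarrow> (real^'n \<Rightarrow> real) \<Rightarrow> ennreal" where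
  "modular p q \<mu> \<Omega> f = (\<integral>\<^sup>+ x. ennreal (modH p q \<mu> x \<bar>f x\<bar>) \<partial>lebesgue_on \<Omega>)"

definition in_LH :: "real \<Rightarrow> real \<Rightarrow> (real^'n \<Rightarrow> real) \<Rightarrow> (real^'n) set \<Rightarrow> (real^'n \<Rightarrow> real) \<Rightarrow> bool" where
  "in_LH p q \<mu> \<Omega> f = (f \<in> borel_measurable (lebesgue_on \<Omega>) \<and> modular p q \<mu> \<Omega> f < \<infinity>)"

definition lux :: "real \<Rightarrow> real \<Rightarrow> (real^'n \<Rightarrow> real) \<Rightarrow> (real^'n) set \<Rightarrow> (real^'n \<Rightarrow> real) \<Rightarrow> real" where
  "lux p q \<mu> \<Omega> f = Inf {\<tau>. 0 < \<tau> \<and> modular p q \<mu> \<Omega> (\<lambda>x. f x / \<tau>) \<le> 1}"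

definition weak_grad :: "(real^'n) set \<Rightarrow> (real^'n \<Rightarrow> real) \<Rightarrow> (real^'n \<Rightarrow> real^'n) \<Rightarrow> bool" where
  "weak_grad \<Omega> u g = ((\<forall>K. compact K \<and> K \<subseteq> \<Omega> \<longrightarrow>
        set_integrable lebesgue K u \<and> (\<forall>i. set_integrable lebesgue K (\<lambda>x. g x $ i))) \<and>
     (\<forall>\<phi>\<in>Cc_inf \<Omega>. \<forall>i.
        (LINT x:\<Omega>|lebesgue. u x * cgrad \<phi> x $ i) = - (LINT x:\<Omega>|lebesgue. g x $ i * \<phi> x)))"

definition wgrad :: "(real^'n) set \<Rightarrow> (real^'n \<Rightarrow> real) \<Rightarrow> real^'n \<Rightarrow> real^'n" where
  "wgrad \<Omega> u = (SOME g. weak_grad \<Omega> u g)"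

text \<open>W_0^{1,H}: functions u in L^H with weak gradient in L^H that are limits of
  C_c^infinity functions in the norm  |u|_H + |H(grad u)|_H  (concrete realisation of the completion).\<close>
definition W0 :: "(real^'n \<Rightarrow> real) \<Rightarrow> real \<Rightarrow> real \<Rightarrow> (real^'n \<Rightarrow> real) \<Rightarrow> (real^'n) set \<Rightarrow> (real^'n \<Rightarrow> real) set" where
  "W0 H p q \<mu> \<Omega> = {u. \<exists>g. weak_grad \<Omega> u g \<and> in_LH p q \<mu> \<Omega> u \<and> in_LH p q \<mu> \<Omega> (\<lambda>x. H (g x)) \<and>
      (\<exists>\<phi>s. (\<forall>n. \<phi>s n \<in> Cc_inf \<Omega>) \<and>
         (\<lambda>n. lux p q \<mu> \<Omega> (\<lambda>x. \<phi>s n x - u x) + lux p q \<mu> \<Omega> (\<lambda>x. H (cgrad (\<phi>s n) x - g x)))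
           \<longlonglongrightarrow> 0)}"

definition wnorm :: "(real^'n \<Rightarrow> real) \<Rightarrow> real \<Rightarrow> real \<Rightarrow> (real^'n \<Rightarrow> real) \<Rightarrow> (real^'n) set \<Rightarrow> (real^'n \<Rightarrow> real) \<Rightarrow> real" where
  "wnorm H p q \<mu> \<Omega> u = lux p q \<mu> \<Omega> (\<lambda>x. H (wgrad \<Omega> u x))"

definition pstar :: "real \<Rightarrow> real \<Rightarrow> real" where
  "pstar N p = N * p / (N - p)"

definition Ifun :: "(real^'n \<Rightarrow> real) \<Rightarrow> real \<Rightarrow> real \<Rightarrow> (real^'n \<Rightarrow> real) \<Rightarrow> (real^'n) set \<Rightarrow>
    (real^'n \<Rightarrow> real) \<Rightarrow> (real^'n \<Rightarrow> real) \<Rightarrow> real \<Rightarrow> real \<Rightarrow> (real^'n \<Rightarrow> real) \<Rightarrow> real" where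
  "Ifun H p q \<mu> \<Omega> a b \<delta> lam u =
     (LINT x:\<Omega>|lebesgue. H (wgrad \<Omega> u x) powr p / p + \<mu> x * H (wgrad \<Omega> u x) powr q / q)
     - 1 / (1 - \<delta>) * (LINT x:\<Omega>|lebesgue. a x * \<bar>u x\<bar> powr (1 - \<delta>))
     - lam / pstar (real CARD('n)) p * (LINT x:\<Omega>|lebesgue. b x * \<bar>u x\<bar> powr pstar (real CARD('n)) p)"

text \<open>phi_u'(1) and phi_u''(1).\<close>
definition dphi1 :: "(real^'n \<Rightarrow> real) \<Rightarrow> real \<Rightarrow> real \<Rightarrow> (real^'n \<Rightarrow> real) \<Rightarrow> (real^'n) set \<Rightarrow>
    (real^'n \<Rightarrow> real) \<Rightarrow> (real^'n \<Rightarrow> real) \<Rightarrow> real \<Rightarrow> real \<Rightarrow> (real^'n \<Rightarrow> real) \<Rightarrow> real" where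
  "dphi1 H p q \<mu> \<Omega> a b \<delta> lam u =
     (LINT x:\<Omega>|lebesgue. H (wgrad \<Omega> u x) powr p + \<mu> x * H (wgrad \<Omega> u x) powr q)
     - (LINT x:\<Omega>|lebesgue. a x * \<bar>u x\<bar> powr (1 - \<delta>))
     - lam * (LINT x:\<Omega>|lebesgue. b x * \<bar>u x\<bar> powr pstar (real CARD('n)) p)"

definition dphi2 :: "(real^'n \<Rightarrow> real) \<Rightarrow> real \<Rightarrow> real \<Rightarrow> (real^'n \<Rightarrow> real) \<Rightarrow> (real^'n) set \<Rightarrow>
    (real^'n \<Rightarrow> real) \<Rightarrow> (real^'n \<Rightarrow> real) \<Rightarrow> real \<Rightarrow> real \<Rightarrow> (real^'n \<Rightarrow> real) \<Rightarrow> real" where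
  "dphi2 H p q \<mu> \<Omega> a b \<delta> lam u =
     (LINT x:\<Omega>|lebesgue. (p - 1) * H (wgrad \<Omega> u x) powr p + (q - 1) * \<mu> x * H (wgrad \<Omega> u x) powr q)
     + \<delta> * (LINT x:\<Omega>|lebesgue. a x * \<bar>u x\<bar> powr (1 - \<delta>))
     - lam * (pstar (real CARD('n)) p - 1) * (LINT x:\<Omega>|lebesgue. b x * \<bar>u x\<bar> powr pstar (real CARD('n)) p)"

text \<open>Nehari manifold part M_lambda^+ (u nonzero as an element of the space, i.e. not a.e. zero).\<close>
definition Mplus :: "(real^'n \<Rightarrow> real) \<Rightarrow> real \<Rightarrow> real \<Rightarrow> (real^'n \<Rightarrow> real) \<Rightarrow> (real^'n) set \<Rightarrow>
    (real^'n \<Rightarrow> real) \<Rightarrow> (real^'n \<Rightarrow> real) \<Rightarrow> real \<Rightarrow> real \<Rightarrow> (real^'n \<Rightarrow> real) set" where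
  "Mplus H p q \<mu> \<Omega> a b \<delta> lam = {u \<in> W0 H p q \<mu> \<Omega>.
      \<not> (AE x in lebesgue_on \<Omega>. u x = 0) \<and>
      dphi1 H p q \<mu> \<Omega> a b \<delta> lam u = 0 \<and> dphi2 H p q \<mu> \<Omega> a b \<delta> lam u > 0}"

definition mplus :: "(real^'n \<Rightarrow> real) \<Rightarrow> real \<Rightarrow> real \<Rightarrow> (real^'n \<Rightarrow> real) \<Rightarrow> (real^'n) set \<Rightarrow>
    (real^'n \<Rightarrow> real) \<Rightarrow> (real^'n \<Rightarrow> real) \<Rightarrow> real \<Rightarrow> real \<Rightarrow> real" where
  "mplus H p q \<mu> \<Omega> a b \<delta> lam = Inf (Ifun H p q \<mu> \<Omega> a b \<delta> lam ` Mplus H p q \<mu> \<Omega> a b \<delta> lam)"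

text \<open>The (Ekeland-type) minimizing sequences of Proposition strong-con (indices k >= 1).\<close>
definition min_seq :: "(real^'n \<Rightarrow> real) \<Rightarrow> real \<Rightarrow> real \<Rightarrow> (real^'n \<Rightarrow> real) \<Rightarrow> (real^'n) set \<Rightarrow>
    (real^'n \<Rightarrow> real) \<Rightarrow> (real^'n \<Rightarrow> real) \<Rightarrow> real \<Rightarrow> real \<Rightarrow> (nat \<Rightarrow> real^'n \<Rightarrow> real) \<Rightarrow> bool" where
  "min_seq H p q \<mu> \<Omega> a b \<delta> lam w = (\<forall>k\<ge>1.
      w k \<in> Mplus H p q \<mu> \<Omega> a b \<delta> lam \<and> (AE x in lebesgue_on \<Omega>. 0 \<le> w k x) \<and>
      mplus H p q \<mu> \<Omega> a b \<delta> lam \<le> Ifun H p q \<mu> \<Omega> a b \<delta> lam (w k) \<and>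
      Ifun H p q \<mu> \<Omega> a b \<delta> lam (w k) \<le> mplus H p q \<mu> \<Omega> a b \<delta> lam + 1 / real k \<and>
      (\<forall>v \<in> Mplus H p q \<mu> \<Omega> a b \<delta> lam \<union> {(\<lambda>x. 0)}.
         Ifun H p q \<mu> \<Omega> a b \<delta> lam v \<ge> Ifun H p q \<mu> \<Omega> a b \<delta> lam (w k)
            - wnorm H p q \<mu> \<Omega> (\<lambda>x. v x - w k x) / real k))"

definition strong_con :: "(real^'n \<Rightarrow> real) \<Rightarrow> real \<Rightarrow> real \<Rightarrow> (real^'n \<Rightarrow> real) \<Rightarrow> (real^'n) set \<Rightarrow>
    (real^'n \<Rightarrow> real) \<Rightarrow> (real^'n \<Rightarrow> real) \<Rightarrow> real \<Rightarrow> real \<Rightarrow> bool" where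
  "strong_con H p q \<mu> \<Omega> a b \<delta> lam = (\<forall>w. min_seq H p q \<mu> \<Omega> a b \<delta> lam w \<longrightarrow>
      (\<exists>r v. strict_mono r \<and> v \<in> W0 H p q \<mu> \<Omega> \<and>
         (\<lambda>j. wnorm H p q \<mu> \<Omega> (\<lambda>x. w (r j) x - v x)) \<longlonglongrightarrow> 0 \<and>
         (AE x in lebesgue_on \<Omega>. 0 \<le> v x) \<and> v \<in> Mplus H p q \<mu> \<Omega> a b \<delta> lam \<and>
         Ifun H p q \<mu> \<Omega> a b \<delta> lam v = mplus H p q \<mu> \<Omega> a b \<delta> lam))"

definition fgrad :: "(real^'n \<Rightarrow> real) \<Rightarrow> real^'n \<Rightarrow> real^'n" where
  "fgrad H \<xi> = (\<chi> i. frechet_derivative H (at \<xi>) (axis i 1))"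

definition weak_solution :: "(real^'n \<Rightarrow> real) \<Rightarrow> real \<Rightarrow> real \<Rightarrow> (real^'n \<Rightarrow> real) \<Rightarrow> (real^'n) set \<Rightarrow>
    (real^'n \<Rightarrow> real) \<Rightarrow> (real^'n \<Rightarrow> real) \<Rightarrow> real \<Rightarrow> real \<Rightarrow> real \<Rightarrow> (real^'n \<Rightarrow> real) \<Rightarrow> bool" where
  "weak_solution H p q \<mu> \<Omega> a b \<delta> lam \<alpha> u = (u \<in> W0 H p q \<mu> \<Omega> \<and>
     (AE x in lebesgue_on \<Omega>. 0 < u x) \<and>
     (\<forall>\<phi>\<in>Cc_1 \<Omega>.
        let L = (\<lambda>x. (H (wgrad \<Omega> u x) powr (p - 1) + \<mu> x * H (wgrad \<Omega> u x) powr (q - 1))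
                   * (fgrad H (wgrad \<Omega> u x) \<bullet> cgrad \<phi> x));
            R = (\<lambda>x. (a x * u x powr (- \<delta>) + lam * b x * u x powr \<alpha>) * \<phi> x)
        in set_integrable lebesgue \<Omega> L \<and> set_integrable lebesgue \<Omega> R \<and>
           (LINT x:\<Omega>|lebesgue. L x) = (LINT x:\<Omega>|lebesgue. R x)))"

end

(*
  Since u0 minimises the energy I on M^+, and near t = 1 the fibre map t -> I(t (u0 + eps phi)) is strictly
  convex with a critical point t_eps whose point t_eps (u0 + eps phi) lies on M^+, one gets
  I(u0 + eps phi) >= I(t_eps (u0 + eps phi)) >= I(u0): the function u0 is a two-sided local minimiser along
  every direction phi in C_c^infinity, although I is not differentiable there.

  For phi >= 0 the difference quotients of the singular term are therefore bounded above, and Fatou's lemma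
  gives that a u0^(-delta) phi is integrable with u0 > 0 wherever phi > 0. The elementary bound
  | |x + h|^(1-delta) - x^(1-delta) | <= 2^delta |h| x^(-delta), valid for all h and x > 0, then dominates the
  quotients for phi of either sign, so that eps -> I(u0 + eps phi) is differentiable at 0 with derivative 0.
  Mollification extends the resulting equation from C_c^infinity to C_c^1. The critical Sobolev embedding
  comes from Gagliardo's argument, by induction on the number of variables.
*)
theory Submission
  imports Defs
begin

section \<open>Smooth functions and bumps\<close>

text \<open>As long as u0 may vanish, the singular term obstructs differentiating the energy, so no
  Lagrange multiplier rule applies. The fibre map avoids this: strict convexity near t = 1 is an
  open condition, and finding t_eps takes only continuity in epsilon of the four integrals in the
  energy. Directions of either sign are admissible because the energy contains |u|, so u0 + epsilon
  phi may change sign.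

  A Bochner integral of a non-integrable function is 0, hence each manipulation of the energy rests
  on integrability. This is where r = \<open>pstar\<close> enters: u in L^r makes b |u|^r integrable
  and, as r/(r - 1 + delta) and r/(1 - delta) are conjugate, also a |u|^(1 - delta).

  The directions phi are smooth because \<open>W0\<close> is a closure of \<open>Cc_inf\<close>, so
  that u0 + epsilon phi lies in it at once; C^1 functions enter only in the finished equation.

  The real \<open>Inf\<close> in \<open>mplus\<close> bounds the energy from below only if the
  energy is bounded below on M^+; the Ekeland inequality secures this.\<close>

lemma frechet_derivative_apply:
  "(f has_derivative f') (at x) \<Longrightarrow> frechet_derivative f (at x) v = f' v"
  using frechet_derivative_at by metis

section \<open>Closure properties of C^k functions\<close>

lemma Ck_SucD: "Ck (Suc k) S f \<Longrightarrow> Ck k S f"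
  by (induction k arbitrary: f) auto

lemma Ck_const: "Ck k UNIV (\<lambda>x. c)"
  by (induction k arbitrary: c) (auto simp: frechet_derivative_const)

lemma Ck_add: "Ck k UNIV f \<Longrightarrow> Ck k UNIV g \<Longrightarrow> Ck k UNIV (\<lambda>x. f x + g x)"
proof (induction k arbitrary: f g)
  case (Suc k)
  have "frechet_derivative (\<lambda>x. f x + g x) (at x) v
      = frechet_derivative f (at x) v + frechet_derivative g (at x) v" for x v
    using Suc.prems by (intro frechet_derivative_apply)
      (auto intro!: derivative_eq_intros simp: frechet_derivative_works[symmetric])
  then show ?case using Suc by (auto intro!: continuous_intros)
qed (auto intro!: continuous_intros)

lemma Ck_mult:
  fixes f g :: "'a::real_normed_vector \<Rightarrow> real"
  shows "Ck k UNIV f \<Longrightarrow> Ck k UNIV g \<Longrightarrow> Ck k UNIV (\<lambda>x. f x * g x)"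
proof (induction k arbitrary: f g)
  case (Suc k)
  have *: "frechet_derivative (\<lambda>x. f x * g x) (at x) v
      = f x * frechet_derivative g (at x) v + frechet_derivative f (at x) v * g x" for x v
    using Suc.prems by (intro frechet_derivative_apply)
      (auto intro!: derivative_eq_intros simp: frechet_derivative_works[symmetric])
  have "Ck k UNIV f" "Ck k UNIV g" using Suc.prems Ck_SucD by blast+
  then show ?case using Suc by (auto simp: * intro!: continuous_intros Ck_add)
qed (auto intro!: continuous_intros)

lemma Ck_prod:
  fixes f :: "'i \<Rightarrow> 'a::real_normed_vector \<Rightarrow> real"
  assumes "\<And>i. i \<in> I \<Longrightarrow> Ck k UNIV (f i)"
  shows "Ck k UNIV (\<lambda>x. \<Prod>i\<in>I. f i x)"
  using assms by (induction I rule: infinite_finite_induct) (auto intro!: Ck_const Ck_mult)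

text \<open>The polynomial makes the family of functions P(1/t) exp(-1/t), extended by 0, closed
  under differentiation. Smoothness of exp(-1/t) then follows by one induction on the order, for all
  P at once.\<close>

definition flat :: "real poly \<Rightarrow> real \<Rightarrow> real" where
  "flat P t = (if t \<le> 0 then 0 else poly P (1 / t) * exp (- (1 / t)))"

lemma tendsto_poly_exp_0: "((\<lambda>s. poly P s * exp (- s)) \<longlongrightarrow> (0::real)) at_top"
proof -
  have "((\<lambda>s. \<Sum>i\<le>degree P. coeff P i * (s ^ i / exp s)) \<longlongrightarrow> (\<Sum>i\<le>degree P. coeff P i * 0)) at_top"
    by (intro tendsto_intros tendsto_power_div_exp_0)
  moreover have "(\<Sum>i\<le>degree P. coeff P i * (s ^ i / exp s)) = poly P s * exp (- s)" for s
    unfolding poly_altdef sum_distrib_right by (intro sum.cong) (simp_all add: exp_minus divide_inverse)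
  ultimately show ?thesis by simp
qed

lemma flat_tendsto_0: "(flat P \<longlongrightarrow> 0) (at 0)"
proof -
  have "((\<lambda>t. poly P (1/t) * exp (- (1/t))) \<longlongrightarrow> 0) (at_right (0::real))"
    by (rule filterlim_compose[OF tendsto_poly_exp_0])
       (simp add: filterlim_inverse_at_top_right flip: inverse_eq_divide)
  then have "(flat P \<longlongrightarrow> 0) (at_right 0)"
    by (rule Lim_transform_eventually) (auto simp: flat_def eventually_at_right_less intro: eventually_mono[OF eventually_at_right_less])
  moreover have "(flat P \<longlongrightarrow> 0) (at_left 0)"
    by (rule Lim_transform_eventually[OF tendsto_const])
      (auto simp: flat_def eventually_at_left_field intro!: exI[of _ "-1"])
  ultimately show ?thesis by (simp add: filterlim_at_split)
qed

text \<open>With s = 1/t, differentiating P(s) exp(-s) in t gives s^2 (P(s) - P'(s)) exp(-s), again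
  a member of the family. The gluing point t = 0 is settled by the decay of exp(-s) against any
  polynomial.\<close>

lemma flat_has_derivative:
  "(flat P has_field_derivative flat ([:0,0,1:] * (P - pderiv P)) t) (at t)"
proof -
  consider "t < 0" | "t = 0" | "t > 0" by linarith
  then show ?thesis
  proof cases
    case 1
    have "((\<lambda>_. 0) has_field_derivative 0) (at t)" by simp
    then show ?thesis
      by (rule DERIV_cong[OF has_field_derivative_transform_within_open[of _ _ _ "{..<0}"]])
        (use 1 in \<open>auto simp: flat_def\<close>)
  next
    case 2
    \<comment> \<open>The difference quotient of \<open>flat P\<close> at 0 is the flat function of
      the polynomial s P(s), hence tends to 0.\<close>
    have "((\<lambda>h. flat ([:0,1:] * P) h) \<longlongrightarrow> 0) (at 0)" by (rule flat_tendsto_0)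
    then have "((\<lambda>h. (flat P (0 + h) - flat P 0) / h) \<longlongrightarrow> 0) (at 0)"
      by (rule Lim_transform_eventually) (auto simp: flat_def eventually_at_filter)
    then show ?thesis using 2 by (simp add: DERIV_def flat_def)
  next
    case 3
    have "((\<lambda>t. poly P (1/t) * exp (- (1/t))) has_field_derivative
       poly ([:0,0,1:] * (P - pderiv P)) (1/t) * exp (- (1/t))) (at t)"
      using 3 by (auto intro!: derivative_eq_intros simp: field_simps power2_eq_square)
    then have "((\<lambda>t. poly P (1/t) * exp (- (1/t))) has_field_derivative
       flat ([:0,0,1:] * (P - pderiv P)) t) (at t)" using 3 by (simp add: flat_def)
    then show ?thesis
      by (rule has_field_derivative_transform_within_open[of _ _ _ "{0<..}"])
        (use 3 in \<open>auto simp: flat_def\<close>)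
  qed
qed

text \<open>A directional derivative of this ridge function is a constant times a ridge function of
  the same kind, so the induction on \<open>k\<close> must keep \<open>P\<close> arbitrary.\<close>

lemma Ck_flat: "Ck k UNIV (\<lambda>x::'a::real_inner. flat P (w \<bullet> x + c))"
proof -
  have d: "((\<lambda>x. flat P (w \<bullet> x + c)) has_derivative
      (\<lambda>v. (w \<bullet> v) * flat ([:0,0,1:] * (P - pderiv P)) (w \<bullet> x + c))) (at x)" for x P
  proof -
    have "((\<lambda>x. w \<bullet> x + c) has_derivative (\<lambda>v. w \<bullet> v)) (at x)"
      by (auto intro!: derivative_eq_intros)
    from has_derivative_compose[OF this flat_has_derivative[unfolded has_field_derivative_def]]
    show ?thesis by (simp add: mult.commute)
  qed
  show ?thesis
  proof (induction k arbitrary: P)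
    case 0
    show ?case using has_derivative_continuous[OF d] by (auto simp: continuous_on_eq_continuous_at)
  next
    case (Suc k)
    have "continuous_on UNIV (\<lambda>x. flat P (w \<bullet> x + c))"
      using has_derivative_continuous[OF d] by (auto simp: continuous_on_eq_continuous_at)
    moreover have "(\<lambda>x. flat P (w \<bullet> x + c)) differentiable at x" for x
      using d differentiable_def by blast
    ultimately show ?case using Suc.IH
      by (auto simp: frechet_derivative_apply[OF d] intro!: Ck_mult Ck_const)
  qed
qed

lemma flat_1: "flat 1 t = (if t \<le> 0 then 0 else exp (- (1 / t)))"
  by (simp add: flat_def)

text \<open>The factor \<open>m\<close> is a sharpness: exp(-1/(m s)) tends to 1 for every s > 0, so
  for large \<open>m\<close> the bumps approximate the indicator of the open box while their support
  never leaves the closed box.\<close>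

definition box_bump :: "real \<Rightarrow> real^'n \<Rightarrow> real^'n \<Rightarrow> real^'n \<Rightarrow> real" where
  "box_bump m a b x = (\<Prod>i\<in>UNIV. flat 1 (m * (x $ i - a $ i)) * flat 1 (m * (b $ i - x $ i)))"

lemma smooth_box_bump:
  fixes a b :: "real^'n"
  shows "smooth_on UNIV (box_bump m a b)"
proof -
  have ax: "(t *\<^sub>R axis i 1) \<bullet> x = t * x $ i" for t i and x :: "real^'n"
    by (simp add: inner_axis')
  have 1: "Ck k UNIV (\<lambda>x::real^'n. flat 1 (m * (x $ i - a $ i)))" for k i
    using Ck_flat[of k 1 "m *\<^sub>R axis i 1 :: real^'n" "- m * a $ i"]
    unfolding ax by (simp add: right_diff_distrib)
  have 2: "Ck k UNIV (\<lambda>x::real^'n. flat 1 (m * (b $ i - x $ i)))" for k i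
    using Ck_flat[of k 1 "(- m) *\<^sub>R axis i 1 :: real^'n" "m * b $ i"]
    unfolding ax by (simp add: right_diff_distrib)
  show ?thesis unfolding smooth_on_def box_bump_def
    by (intro allI Ck_prod Ck_mult 1 2)
qed

lemma box_bump_nonneg: "0 \<le> box_bump m a b x"
  unfolding box_bump_def by (intro prod_nonneg) (auto simp: flat_1)

lemma box_bump_le_1: "box_bump m a b x \<le> 1"
  unfolding box_bump_def by (intro prod_le_1) (auto simp: flat_1 intro!: mult_le_one)

lemma box_bump_pos: "m > 0 \<Longrightarrow> x \<in> box a b \<Longrightarrow> 0 < box_bump m a b x"
  unfolding box_bump_def by (intro prod_pos) (auto simp: flat_1 mem_box_cart not_le)

lemma box_bump_zero:
  assumes "m > 0" "x \<notin> box a b" shows "box_bump m a b x = 0"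
proof -
  obtain i where "x $ i \<le> a $ i \<or> b $ i \<le> x $ i"
    using assms(2) by (auto simp: mem_box_cart not_less)
  then have "flat 1 (m * (x $ i - a $ i)) * flat 1 (m * (b $ i - x $ i)) = 0"
    using assms(1) by (auto simp: flat_1 mult_le_0_iff)
  then show ?thesis unfolding box_bump_def by (meson UNIV_I finite_class.finite prod_zero)
qed

lemma box_bump_in_Cc_inf:
  assumes "m > 0" "cbox a b \<subseteq> \<Omega>" shows "box_bump m a b \<in> Cc_inf \<Omega>"
  unfolding Cc_inf_def compact_supp_in_def
  using assms box_bump_zero[of m _ a b] box_subset_cbox[of a b] smooth_box_bump
  by (auto intro!: exI[of _ "cbox a b"])

lemma box_bump_tendsto:
  "(\<lambda>k. box_bump (real (Suc k)) a b x) \<longlonglongrightarrow> indicator (box a b) x"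
proof (cases "x \<in> box a b")
  case True
  have e: "(\<lambda>k. flat 1 (real (Suc k) * s)) \<longlonglongrightarrow> 1" if "s > 0" for s
  proof -
    have "(\<lambda>k. exp (- (inverse (real (Suc k)) * (1/s)))) \<longlonglongrightarrow> exp (- (0 * (1/s)))"
      by (intro tendsto_intros LIMSEQ_inverse_real_of_nat)
    moreover have "flat 1 (real (Suc k) * s) = exp (- (inverse (real (Suc k)) * (1/s)))" for k
      using that by (simp add: flat_1 mult_le_0_iff inverse_eq_divide not_le)
    ultimately show ?thesis by simp
  qed
  have "(\<lambda>k. box_bump (real (Suc k)) a b x) \<longlonglongrightarrow> (\<Prod>i::'a\<in>UNIV. 1 * 1)"
    unfolding box_bump_def using True by (intro tendsto_intros e) (auto simp: mem_box_cart)
  then show ?thesis using True by simp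
qed (simp add: box_bump_zero)

section \<open>Weak gradients\<close>

lemma AE_lebesgue_on_negligible:
  fixes \<Omega> :: "'a::euclidean_space set"
  assumes "\<Omega> \<in> sets lebesgue"
  shows "(AE x in lebesgue_on \<Omega>. P x) \<longleftrightarrow> negligible {x\<in>\<Omega>. \<not> P x}"
proof -
  have "(AE x in lebesgue. Q x) \<longleftrightarrow> negligible {x. \<not> Q x}" for Q :: "'a \<Rightarrow> bool"
  proof
    assume "AE x in lebesgue. Q x"
    then obtain N where "N \<in> null_sets lebesgue" "{x. \<not> Q x} \<subseteq> N"
      by (auto simp: eventually_ae_filter)
    then show "negligible {x. \<not> Q x}"
      by (metis negligible_iff_null_sets negligible_subset)
  next
    assume "negligible {x. \<not> Q x}"
    then show "AE x in lebesgue. Q x"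
      by (auto simp: eventually_ae_filter negligible_iff_null_sets)
  qed
  then show ?thesis using assms by (simp add: AE_restrict_space_iff)
qed

lemma continuous_imp_borel_measurable_lebesgue:
  fixes f :: "'a::euclidean_space \<Rightarrow> 'b::topological_space"
  shows "continuous_on UNIV f \<Longrightarrow> f \<in> borel_measurable lebesgue"
  by (rule measurable_completion) (simp add: borel_measurable_continuous_onI)

text \<open>Testing with ever sharper bumps shows that h has integral 0 over every sub-box.
  Lebesgue's differentiation theorem recovers h from such integrals almost everywhere.\<close>

lemma fundamental_lemma_cbox:
  fixes h :: "real^'n \<Rightarrow> real"
  assumes h: "set_integrable lebesgue (cbox c d) h"
    and sub: "cbox c d \<subseteq> \<Omega>" and \<Omega>: "\<Omega> \<in> sets lebesgue"
    and 0: "\<And>\<phi>. \<phi> \<in> Cc_inf \<Omega> \<Longrightarrow> (LINT x:\<Omega>|lebesgue. h x * \<phi> x) = 0"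
  shows "negligible {x\<in>box c d. h x \<noteq> 0}"
proof -
  define f where "f x = indicator (cbox c d) x * h x" for x
  have f: "integrable lebesgue f"
    using h by (simp add: set_integrable_def f_def[abs_def])
  have box0: "integral (cbox a b) f = 0" if ab: "cbox a b \<subseteq> cbox c d" for a b
  proof -
    have "(\<lambda>k. LINT x|lebesgue. f x * box_bump (real (Suc k)) a b x)
        \<longlonglongrightarrow> (LINT x|lebesgue. f x * indicator (box a b) x)"
    proof (rule integral_dominated_convergence)
      show "integrable lebesgue (\<lambda>x. norm (f x))" using f by simp
      show "AE x in lebesgue. norm (f x * box_bump (real (Suc k)) a b x) \<le> norm (f x)" for k
        by (intro AE_I2) (simp add: abs_mult box_bump_nonneg box_bump_le_1 mult_left_le)
      show "AE x in lebesgue. (\<lambda>k. f x * box_bump (real (Suc k)) a b x) \<longlonglongrightarrow> f x * indicator (box a b) x"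
        by (intro AE_I2 tendsto_intros box_bump_tendsto)
      have "box_bump m a b \<in> borel_measurable lebesgue" for m
      proof -
        have "continuous_on UNIV (box_bump m a b)"
          using smooth_box_bump[of m a b] Ck.simps(1) unfolding smooth_on_def by blast
        then show ?thesis by (rule continuous_imp_borel_measurable_lebesgue)
      qed
      then show "(\<lambda>x. f x * box_bump (real (Suc k)) a b x) \<in> borel_measurable lebesgue" for k
        using f by measurable
      show "(\<lambda>x. f x * indicator (box a b) x) \<in> borel_measurable lebesgue"
        using f by (intro borel_measurable_times borel_measurable_indicator) auto
    qed
    moreover have "(LINT x|lebesgue. f x * box_bump (real (Suc k)) a b x) = 0" for k
    proof -
      have "(LINT x|lebesgue. f x * box_bump (real (Suc k)) a b x)
          = (LINT x:\<Omega>|lebesgue. h x * box_bump (real (Suc k)) a b x)"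
        unfolding set_lebesgue_integral_def
        using ab sub box_subset_cbox[of a b] box_bump_zero[of "real (Suc k)" _ a b]
        by (intro Bochner_Integration.integral_cong) (auto simp: f_def indicator_def)
      also have "\<dots> = 0"
        using ab sub by (intro 0 box_bump_in_Cc_inf) auto
      finally show ?thesis .
    qed
    ultimately have "(LINT x:box a b|lebesgue. f x) = 0"
      by (simp add: set_lebesgue_integral_def LIMSEQ_const_iff mult.commute)
    moreover have "set_integrable lebesgue (box a b) f"
      using f unfolding set_integrable_def by (intro integrable_mult_indicator) auto
    ultimately have "integral (box a b) f = 0"
      by (simp add: set_lebesgue_integral_eq_integral)
    then show ?thesis by (simp add: integral_open_interval)
  qed
  have "f integrable_on cbox a b" for a b
  proof -
    have "set_integrable lebesgue (cbox a b) f"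
      using f unfolding set_integrable_def by (intro integrable_mult_indicator) auto
    then show ?thesis by (rule set_lebesgue_integral_eq_integral)
  qed
  \<comment> \<open>The differentiation theorem is used in its one-sided form: averages over cubes
    having x as their lower corner.\<close>
  then obtain N where N: "negligible N"
    "\<And>x e. \<lbrakk>x \<notin> N; 0 < e\<rbrakk> \<Longrightarrow> \<exists>d>0. \<forall>h. 0 < h \<and> h < d \<longrightarrow>
      norm (integral (cbox x (x + h *\<^sub>R One)) f /\<^sub>R h ^ DIM(real^'n) - f x) < e"
    using integrable_ccontinuous_explicit by blast
  have "h x = 0" if x: "x \<in> box c d" "x \<notin> N" for x
  proof (rule ccontr)
    assume "h x \<noteq> 0"
    then have "0 < \<bar>h x\<bar>" by simp
    from N(2)[OF x(2) this] obtain \<epsilon> where \<epsilon>: "\<epsilon> > 0" "\<And>h'. 0 < h' \<Longrightarrow> h' < \<epsilon> \<Longrightarrow>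
      norm (integral (cbox x (x + h' *\<^sub>R One)) f /\<^sub>R h' ^ DIM(real^'n) - f x) < \<bar>h x\<bar>" by blast
    \<comment> \<open>As x is interior, a small cube with lower corner x stays in the box. Its
      average is 0, which forces |h x| < |h x|.\<close>
    have "((\<lambda>t. x + t *\<^sub>R One) \<longlongrightarrow> x + 0 *\<^sub>R One) (at_right 0)"
      by (intro tendsto_intros)
    then have "((\<lambda>t. x + t *\<^sub>R One) \<longlongrightarrow> x) (at_right 0)" by simp
    from topological_tendstoD[OF this open_box x(1)]
    have "\<forall>\<^sub>F t in at_right 0. x + t *\<^sub>R One \<in> box c d" .
    moreover have "\<forall>\<^sub>F t in at_right (0::real). 0 < t \<and> t < \<epsilon>"
      using \<epsilon>(1) by (auto simp: eventually_at_right_field)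
    ultimately have "\<forall>\<^sub>F t in at_right 0. x + t *\<^sub>R One \<in> box c d \<and> 0 < t \<and> t < \<epsilon>"
      by eventually_elim auto
    then obtain t where t: "x + t *\<^sub>R One \<in> box c d" "0 < t" "t < \<epsilon>"
      using eventually_happens'[OF trivial_limit_at_right_real] by blast
    have "cbox x (x + t *\<^sub>R One) \<subseteq> cbox c d"
    proof
      fix z assume "z \<in> cbox x (x + t *\<^sub>R One)"
      then show "z \<in> cbox c d"
        using t(1) x(1) unfolding mem_box_cart by (meson less_imp_le order_trans)
    qed
    with box0 \<epsilon>(2)[OF t(2,3)] have "\<bar>f x\<bar> < \<bar>h x\<bar>" by simp
    moreover have "f x = h x" using x(1) box_subset_cbox[of c d] by (auto simp: f_def)
    ultimately show False by simp
  qed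
  then show ?thesis by (intro negligible_subset[OF N(1)]) auto
qed

text \<open>An open set is a countable union of closed boxes, and the faces lost by passing to open
  boxes are null sets.\<close>

lemma fundamental_lemma:
  fixes h :: "real^'n \<Rightarrow> real"
  assumes \<Omega>: "open \<Omega>"
    and h: "\<And>K. compact K \<Longrightarrow> K \<subseteq> \<Omega> \<Longrightarrow> set_integrable lebesgue K h"
    and 0: "\<And>\<phi>. \<phi> \<in> Cc_inf \<Omega> \<Longrightarrow> (LINT x:\<Omega>|lebesgue. h x * \<phi> x) = 0"
  shows "AE x in lebesgue_on \<Omega>. h x = 0"
proof -
  obtain \<D> where D: "countable \<D>" "\<D> \<subseteq> Pow \<Omega>" "\<And>X. X \<in> \<D> \<Longrightarrow> \<exists>a b. X = cbox a b" "\<Union>\<D> = \<Omega>"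
    using open_countable_Union_open_cbox[OF \<Omega>] by metis
  have N: "negligible {x\<in>X. h x \<noteq> 0}" if X: "X \<in> \<D>" for X
  proof -
    obtain a b where ab: "X = cbox a b" "cbox a b \<subseteq> \<Omega>" using D(2,3) X by blast
    have "negligible {x\<in>box a b. h x \<noteq> 0}"
      using \<Omega> ab(2) by (intro fundamental_lemma_cbox[of _ _ _ \<Omega>] h 0) auto
    moreover have "negligible (cbox a b - box a b)" by (rule negligible_frontier_interval)
    ultimately show ?thesis
      unfolding ab(1) by (rule negligible_subset[OF negligible_Un]) auto
  qed
  have "{x\<in>\<Omega>. h x \<noteq> 0} = (\<Union>X\<in>\<D>. {x\<in>X. h x \<noteq> 0})" using D(4) by auto
  moreover have "negligible (\<Union>X\<in>\<D>. {x\<in>X. h x \<noteq> 0})"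
    using N D(1) by (intro negligible_countable_Union) auto
  ultimately show ?thesis using \<Omega>
    by (simp add: AE_lebesgue_on_negligible)
qed

lemma Cc_1_D:
  assumes "\<phi> \<in> Cc_1 \<Omega>"
  shows "continuous_on UNIV \<phi>" "\<phi> differentiable (at x)"
    "continuous_on UNIV (\<lambda>x. frechet_derivative \<phi> (at x) v)"
    "\<exists>K. compact K \<and> K \<subseteq> \<Omega> \<and> (\<forall>x. x \<notin> K \<longrightarrow> \<phi> x = 0)"
  using assms by (auto simp: Cc_1_def compact_supp_in_def numeral_eq_Suc)

lemma Cc_inf_subset_Cc_1: "\<phi> \<in> Cc_inf \<Omega> \<Longrightarrow> \<phi> \<in> Cc_1 \<Omega>"
  unfolding Cc_inf_def Cc_1_def smooth_on_def by blast

lemma set_integrable_mult_continuous: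
  fixes f \<phi> :: "'a::euclidean_space \<Rightarrow> real"
  assumes f: "set_integrable lebesgue K f" and K: "compact K" "K \<subseteq> \<Omega>" "\<And>x. x \<notin> K \<Longrightarrow> \<phi> x = 0"
    and \<phi>: "continuous_on UNIV \<phi>"
  shows "set_integrable lebesgue \<Omega> (\<lambda>x. f x * \<phi> x)"
proof -
  have cont: "continuous_on K \<phi>" using \<phi> continuous_on_subset by blast
  obtain B where B: "\<And>x. x \<in> K \<Longrightarrow> norm (\<phi> x) \<le> B"
    using compact_imp_bounded[OF compact_continuous_image[OF cont K(1)]]
    by (auto simp: bounded_iff)
  have fK: "integrable lebesgue (\<lambda>x. indicator K x * f x)"
    using f by (simp add: set_integrable_def)
  have "integrable lebesgue (\<lambda>x. (indicator K x * f x) * \<phi> x)"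
  proof (rule Bochner_Integration.integrable_bound)
    show "integrable lebesgue (\<lambda>x. B * (indicator K x * f x))" using fK by simp
    show "(\<lambda>x. indicator K x * f x * \<phi> x) \<in> borel_measurable lebesgue"
      using fK continuous_imp_borel_measurable_lebesgue[OF \<phi>] by measurable
    show "AE x in lebesgue. norm (indicator K x * f x * \<phi> x) \<le> norm (B * (indicator K x * f x))"
    proof (rule AE_I2)
      fix x show "norm (indicator K x * f x * \<phi> x) \<le> norm (B * (indicator K x * f x))"
        using B[of x] by (cases "x \<in> K")
          (auto simp: abs_mult mult.commute[of "\<bar>f x\<bar>"] intro!: mult_right_mono)
    qed
  qed
  moreover have "(indicator K x * f x) * \<phi> x = indicat_real \<Omega> x *\<^sub>R (f x * \<phi> x)" for x
    using K(3)[of x] K(2) by (auto simp: indicator_def)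
  ultimately show ?thesis by (simp add: set_integrable_def)
qed

lemma weak_gradD:
  assumes "weak_grad \<Omega> u g" "\<phi> \<in> Cc_inf \<Omega>"
  shows "(LINT x:\<Omega>|lebesgue. u x * cgrad \<phi> x $ i) = - (LINT x:\<Omega>|lebesgue. g x $ i * \<phi> x)"
  using assms(1)[unfolded weak_grad_def, THEN conjunct2, THEN bspec, OF assms(2), THEN spec] .

text \<open>The difference of two weak gradients integrates to 0 against every test function. This
  makes the choice by \<open>SOME\<close> in \<open>wgrad\<close> harmless: any weak gradient at
  hand agrees with it almost everywhere.\<close>

lemma weak_grad_unique:
  fixes u :: "real^'n \<Rightarrow> real"
  assumes \<Omega>: "open \<Omega>" and g: "weak_grad \<Omega> u g" and h: "weak_grad \<Omega> u h"
  shows "AE x in lebesgue_on \<Omega>. g x = h x"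
proof -
  have int: "set_integrable lebesgue \<Omega> (\<lambda>x. g x $ i * \<phi> x)"
    if g: "weak_grad \<Omega> u g" and \<phi>: "\<phi> \<in> Cc_inf \<Omega>" for g i \<phi>
  proof -
    note \<phi>' = Cc_1_D[OF Cc_inf_subset_Cc_1[OF \<phi>]]
    obtain K where K: "compact K" "K \<subseteq> \<Omega>" "\<And>x. x \<notin> K \<Longrightarrow> \<phi> x = 0" using \<phi>'(4) by blast
    then show ?thesis
      using g \<phi>'(1) by (intro set_integrable_mult_continuous[of K]) (auto simp: weak_grad_def)
  qed
  have "AE x in lebesgue_on \<Omega>. g x $ i - h x $ i = 0" for i
  proof (rule fundamental_lemma[OF \<Omega>])
    show "set_integrable lebesgue K (\<lambda>x. g x $ i - h x $ i)" if "compact K" "K \<subseteq> \<Omega>" for K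
      using g h that by (auto simp: weak_grad_def)
    show "(LINT x:\<Omega>|lebesgue. (g x $ i - h x $ i) * \<phi> x) = 0" if \<phi>: "\<phi> \<in> Cc_inf \<Omega>" for \<phi>
    proof -
      have "(LINT x:\<Omega>|lebesgue. (g x $ i - h x $ i) * \<phi> x)
          = (LINT x:\<Omega>|lebesgue. g x $ i * \<phi> x) - (LINT x:\<Omega>|lebesgue. h x $ i * \<phi> x)"
        unfolding left_diff_distrib using int[OF g \<phi>] int[OF h \<phi>]
        by (intro set_integral_diff)
      also have "\<dots> = 0" using weak_gradD[OF g \<phi>, of i] weak_gradD[OF h \<phi>, of i] by linarith
      finally show ?thesis .
    qed
  qed
  then have "AE x in lebesgue_on \<Omega>. \<forall>i\<in>UNIV. g x $ i - h x $ i = 0"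
    by (intro AE_finite_allI) auto
  then show ?thesis by eventually_elim (auto simp: vec_eq_iff)
qed

section \<open>Compactly supported functions and integration by parts\<close>

lemma frechet_derivative_zero_off_support:
  fixes f :: "'a::real_normed_vector \<Rightarrow> 'b::real_normed_vector"
  assumes K: "closed K" "\<And>x. x \<notin> K \<Longrightarrow> f x = 0" and x: "x \<notin> K"
  shows "frechet_derivative f (at x) v = 0"
proof -
  have "((\<lambda>_. 0) has_derivative (\<lambda>_. 0)) (at x)" by simp
  moreover have "open (- K)" "x \<in> - K" using K x by auto
  ultimately have "(f has_derivative (\<lambda>_. 0)) (at x)"
    by (rule has_derivative_transform_within_open) (use K in auto)
  then show ?thesis by (rule frechet_derivative_apply)
qed

lemma continuous_compact_support_bounded:
  fixes f :: "'a::topological_space \<Rightarrow> 'b::real_normed_vector"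
  assumes "continuous_on UNIV f" "compact K" "\<And>x. x \<notin> K \<Longrightarrow> f x = 0"
  obtains B where "B > 0" "\<And>x. norm (f x) \<le> B"
proof -
  have "continuous_on K f" using assms(1) continuous_on_subset by blast
  from compact_imp_bounded[OF compact_continuous_image[OF this assms(2)]]
  obtain B where B: "\<And>x. x \<in> K \<Longrightarrow> norm (f x) \<le> B"
    by (auto simp: bounded_iff)
  have "norm (f x) \<le> max B 1" for x
    using B[of x] assms(3)[of x] by (cases "x \<in> K") auto
  then show ?thesis by (intro that[of "max B 1"]) auto
qed

lemma integrable_continuous_compact_support:
  fixes f :: "'a::euclidean_space \<Rightarrow> 'b::{banach, second_countable_topology}"
  assumes "continuous_on UNIV f" "compact K" "\<And>x. x \<notin> K \<Longrightarrow> f x = 0"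
  shows "integrable lborel f" "integrable lebesgue f"
proof -
  have "integrable lborel (\<lambda>x. indicator K x *\<^sub>R f x)"
    using assms continuous_on_subset by (intro borel_integrable_compact) blast+
  moreover have "(\<lambda>x. indicator K x *\<^sub>R f x) = f"
    using assms(3) by (intro ext) (auto simp: indicator_def)
  ultimately show "integrable lborel f" by simp
  then show "integrable lebesgue f" by (simp add: integrable_completion)
qed

text \<open>The case c = 1 gives the translations behind integration by parts, the case c = -1 the
  reflection that makes convolution commutative.\<close>

lemma integral_lborel_affine_isometry:
  fixes f :: "'a::euclidean_space \<Rightarrow> real"
  assumes [measurable]: "f \<in> borel_measurable borel" and c: "\<bar>c\<bar> = 1"
  shows "(LINT x|lborel. f (t + c *\<^sub>R x)) = (LINT x|lborel. f x)"
proof -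
  have "density (distr lborel borel (\<lambda>x. t + c *\<^sub>R x)) (\<lambda>_. 1)
      = (lborel :: 'a measure)"
    using lborel_affine[of c t] c by simp
  then have "distr lborel borel (\<lambda>x. t + c *\<^sub>R x) = (lborel :: 'a measure)"
    by (simp add: density_1)
  then have "(LINT x|lborel. f x) = (LINT x|distr lborel borel (\<lambda>x. t + c *\<^sub>R x). f x)"
    by simp
  also have "\<dots> = (LINT x|lborel. f (t + c *\<^sub>R x))"
    by (subst integral_distr) auto
  finally show ?thesis by simp
qed

lemma Cc_1_support:
  fixes \<phi> :: "real^'n \<Rightarrow> real"
  assumes "\<phi> \<in> Cc_1 \<Omega>"
  shows "\<exists>K. compact K \<and> K \<subseteq> \<Omega> \<and> (\<forall>x. x \<notin> K \<longrightarrow> \<phi> x = 0) \<and> (\<forall>x. x \<notin> K \<longrightarrow> cgrad \<phi> x = 0)"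
proof -
  obtain K where K: "compact K" "K \<subseteq> \<Omega>" "\<And>x. x \<notin> K \<Longrightarrow> \<phi> x = 0" using Cc_1_D(4)[OF assms] by blast
  have "cgrad \<phi> x = 0" if "x \<notin> K" for x
    using frechet_derivative_zero_off_support[OF compact_imp_closed[OF K(1)] K(3) that]
    by (simp add: cgrad_def vec_eq_iff)
  with K show ?thesis by blast
qed

lemma Cc_1_continuous_cgrad:
  assumes "\<phi> \<in> Cc_1 \<Omega>" shows "continuous_on UNIV (cgrad \<phi>)"
  unfolding cgrad_def by (intro continuous_on_vec_lambda Cc_1_D(3)[OF assms])

lemma Cc_1_bounds:
  fixes \<phi> :: "real^'n \<Rightarrow> real"
  assumes "\<phi> \<in> Cc_1 \<Omega>"
  obtains B where "0 < B" "\<And>x. \<bar>\<phi> x\<bar> \<le> B" "\<And>x. norm (cgrad \<phi> x) \<le> B"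
proof -
  obtain K where K: "compact K" "\<And>x. x \<notin> K \<Longrightarrow> \<phi> x = 0" "\<And>x. x \<notin> K \<Longrightarrow> cgrad \<phi> x = 0"
    using Cc_1_support[OF assms] by blast
  obtain B1 where B1: "B1 > 0" "\<And>x. norm (\<phi> x) \<le> B1"
    using continuous_compact_support_bounded[OF Cc_1_D(1)[OF assms] K(1,2)] by blast
  obtain B2 where B2: "B2 > 0" "\<And>x. norm (cgrad \<phi> x) \<le> B2"
    using continuous_compact_support_bounded[OF Cc_1_continuous_cgrad[OF assms] K(1,3)] by blast
  have "\<bar>\<phi> x\<bar> \<le> B1 + B2" "norm (cgrad \<phi> x) \<le> B1 + B2" for x
    using B1(1) B1(2)[of x] B2(1) B2(2)[of x] by auto
  then show ?thesis using B1(1) B2(1) by (intro that[of "B1 + B2"]) auto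
qed

lemma has_real_derivative_along_line:
  fixes f :: "'a::real_normed_vector \<Rightarrow> real"
  assumes "(f has_derivative f') (at (x + t *\<^sub>R v))"
  shows "((\<lambda>s. f (x + s *\<^sub>R v)) has_real_derivative f' v) (at t)"
proof -
  have "((\<lambda>s. x + s *\<^sub>R v) has_derivative (\<lambda>h. h *\<^sub>R v)) (at t)"
    by (auto intro!: derivative_eq_intros)
  from has_derivative_compose[OF this assms]
  have "((\<lambda>s. f (x + s *\<^sub>R v)) has_derivative (\<lambda>h. f' (h *\<^sub>R v))) (at t)" .
  moreover have "(\<lambda>h. f' (h *\<^sub>R v)) = (*) (f' v)"
    using linear_cmul[OF has_derivative_linear[OF assms]] by (auto simp: fun_eq_iff)
  ultimately show ?thesis by (simp add: has_field_derivative_def)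
qed

lemma directional_MVT_bound:
  fixes f :: "'a::real_normed_vector \<Rightarrow> real"
  assumes f: "\<And>x. f differentiable (at x)" and B: "\<And>x. \<bar>frechet_derivative f (at x) v\<bar> \<le> B"
  shows "\<bar>f (x + t *\<^sub>R v) - f x\<bar> \<le> B * \<bar>t\<bar>"
proof -
  have "norm (f (x + t *\<^sub>R v) - f (x + 0 *\<^sub>R v)) \<le> B * norm (t - 0)"
  proof (rule field_differentiable_bound[of UNIV "\<lambda>s. f (x + s *\<^sub>R v)" "\<lambda>s. frechet_derivative f (at (x + s *\<^sub>R v)) v"])
    show "((\<lambda>s. f (x + s *\<^sub>R v)) has_field_derivative frechet_derivative f (at (x + s *\<^sub>R v)) v) (at s within UNIV)" for s
      by (rule has_real_derivative_along_line[OF f[THEN frechet_derivative_works[THEN iffD1]]])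
  qed (use B in auto)
  then show ?thesis by simp
qed

text \<open>By translation invariance every difference quotient of f has integral 0; dominated
  convergence carries this over to the derivative.\<close>

lemma integral_directional_derivative_zero:
  fixes f :: "real^'n \<Rightarrow> real"
  assumes f: "f \<in> Cc_1 UNIV"
  shows "(LINT x|lborel. frechet_derivative f (at x) v) = 0"
proof -
  obtain K where K: "compact K" "\<And>x. x \<notin> K \<Longrightarrow> f x = 0" using Cc_1_D(4)[OF f] by blast
  have D0: "frechet_derivative f (at x) v = 0" if "x \<notin> K" for x
    using frechet_derivative_zero_off_support[OF compact_imp_closed[OF K(1)] K(2) that] .
  obtain B where B: "B > 0" "\<And>x. norm (frechet_derivative f (at x) v) \<le> B"
    using continuous_compact_support_bounded[OF Cc_1_D(3)[OF f, of v] K(1) D0] by blast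
  \<comment> \<open>All difference quotients with steps 1/(k + 1), which are at most 1, vanish
    outside this compact neighbourhood of the support, so B times its indicator dominates
    them.\<close>
  define K' where "K' = {x - y | x y. x \<in> K \<and> y \<in> cball 0 (norm v)}"
  have K': "compact K'" unfolding K'_def by (intro compact_differences K(1) compact_cball)
  have fm [measurable]: "f \<in> borel_measurable borel"
    by (intro borel_measurable_continuous_onI Cc_1_D(1)[OF f])
  have dm [measurable]: "(\<lambda>x. frechet_derivative f (at x) v) \<in> borel_measurable borel"
    by (intro borel_measurable_continuous_onI Cc_1_D(3)[OF f])
  define D where "D k x = (f (x + (1 / real (Suc k)) *\<^sub>R v) - f x) * real (Suc k)" for k x
  have "(\<lambda>k. LINT x|lborel. D k x) \<longlonglongrightarrow> (LINT x|lborel. frechet_derivative f (at x) v)"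
  proof (rule integral_dominated_convergence)
    show "integrable lborel (\<lambda>x. B * indicator K' x)"
      using K' by (intro integrable_mult_right integrable_real_indicator emeasure_compact_finite) (auto intro: borel_compact)
    show "AE x in lborel. norm (D k x) \<le> B * indicator K' x" for k
    proof (rule AE_I2)
      fix x
      show "norm (D k x) \<le> B * indicator K' x"
      proof (cases "x \<in> K'")
        case True
        have "\<bar>f (x + (1 / real (Suc k)) *\<^sub>R v) - f x\<bar> \<le> B * \<bar>1 / real (Suc k)\<bar>"
          using B(2) by (intro directional_MVT_bound Cc_1_D(2)[OF f]) auto
        then have "\<bar>f (x + (1 / real (Suc k)) *\<^sub>R v) - f x\<bar> * real (Suc k) \<le> B"
          by (simp add: pos_le_divide_eq del: of_nat_Suc)
        then show ?thesis using True by (simp add: D_def abs_mult del: of_nat_Suc)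
      next
        case False
        have "x \<notin> K" using False unfolding K'_def by force
        moreover have "x + (1 / real (Suc k)) *\<^sub>R v \<notin> K"
        proof
          assume a: "x + (1 / real (Suc k)) *\<^sub>R v \<in> K"
          have "norm v * 1 \<le> norm v * (1 + real k)" by (intro mult_left_mono) auto
          then have "(1 / real (Suc k)) *\<^sub>R v \<in> cball 0 (norm v)"
            by (simp add: divide_le_eq mult.commute)
          with a have "x \<in> K'" unfolding K'_def by (force intro: exI[of _ "x + (1 / real (Suc k)) *\<^sub>R v"])
          with False show False by simp
        qed
        ultimately show ?thesis using False K(2) by (simp add: D_def)
      qed
    qed
    show "AE x in lborel. (\<lambda>k. D k x) \<longlonglongrightarrow> frechet_derivative f (at x) v"
    proof (rule AE_I2)
      fix x
      have "(f has_derivative frechet_derivative f (at x)) (at (x + 0 *\<^sub>R v))"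
        using Cc_1_D(2)[OF f] by (simp add: frechet_derivative_works)
      from has_real_derivative_along_line[OF this] have "((\<lambda>h. (f (x + h *\<^sub>R v) - f x) / h) \<longlongrightarrow> frechet_derivative f (at x) v) (at 0)"
        by (simp add: DERIV_def)
      moreover have "filterlim (\<lambda>k. 1 / real (Suc k)) (at 0) sequentially"
        using LIMSEQ_inverse_real_of_nat by (auto simp: filterlim_at inverse_eq_divide)
      ultimately have "(\<lambda>k. (f (x + (1 / real (Suc k)) *\<^sub>R v) - f x) / (1 / real (Suc k)))
          \<longlonglongrightarrow> frechet_derivative f (at x) v"
        by (rule filterlim_compose)
      then show "(\<lambda>k. D k x) \<longlonglongrightarrow> frechet_derivative f (at x) v"
        by (simp add: D_def)
    qed
  qed (auto simp: D_def)
  moreover have "(LINT x|lborel. D k x) = 0" for k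
  proof -
    have i: "integrable lborel f" by (rule integrable_continuous_compact_support[OF Cc_1_D(1)[OF f] K])
    have eq: "(LINT x|lborel. f (x + s *\<^sub>R v)) = (LINT x|lborel. f x)" for s
      using integral_lborel_affine_isometry[of f 1 "s *\<^sub>R v"] by (simp add: add.commute)
    have "integrable lborel (\<lambda>x. f (x + s *\<^sub>R v))" for s
    proof (rule integrable_continuous_compact_support(1))
      show "continuous_on UNIV (\<lambda>x. f (x + s *\<^sub>R v))"
        by (intro continuous_on_compose2[OF Cc_1_D(1)[OF f]] continuous_intros) auto
      show "compact ((\<lambda>x. (- (s *\<^sub>R v)) + x) ` K)" using K(1) by (rule compact_translation)
      show "f (x + s *\<^sub>R v) = 0" if "x \<notin> (\<lambda>x. (- (s *\<^sub>R v)) + x) ` K" for x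
      proof (rule K(2))
        show "x + s *\<^sub>R v \<notin> K" using that by (force simp: image_iff)
      qed
    qed
    then show ?thesis using i by (simp add: D_def eq)
  qed
  ultimately show ?thesis by (simp add: LIMSEQ_const_iff)
qed

lemma Cc_1_mult:
  assumes f: "f \<in> Cc_1 \<Omega>" and g: "g \<in> Cc_1 \<Omega>"
  shows "(\<lambda>x. f x * g x) \<in> Cc_1 \<Omega>"
proof -
  obtain K where "compact K" "K \<subseteq> \<Omega>" "\<And>x. x \<notin> K \<Longrightarrow> f x = 0" using Cc_1_D(4)[OF f] by blast
  then have "compact_supp_in \<Omega> (\<lambda>x. f x * g x)" by (auto simp: compact_supp_in_def)
  then show ?thesis using f g Ck_mult[of 1 f g] by (auto simp: Cc_1_def)
qed

lemma Cc_1_subset: "\<Omega> \<subseteq> \<Omega>' \<Longrightarrow> f \<in> Cc_1 \<Omega> \<Longrightarrow> f \<in> Cc_1 \<Omega>'"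
  by (force simp: Cc_1_def compact_supp_in_def)

text \<open>Integration by parts: the directional derivative of the compactly supported product of
  the two functions has integral 0, and the product rule splits it.\<close>

lemma weak_grad_Cc_1:
  fixes \<phi> :: "real^'n \<Rightarrow> real"
  assumes \<phi>: "\<phi> \<in> Cc_1 \<Omega>"
  shows "weak_grad \<Omega> \<phi> (cgrad \<phi>)"
  unfolding weak_grad_def
proof (intro conjI allI impI ballI)
  have *: "set_integrable lebesgue K f" if "compact K" "continuous_on UNIV f" for K and f :: "real^'n \<Rightarrow> real"
  proof -
    have "integrable lborel (\<lambda>x. indicator K x *\<^sub>R f x)"
      using that continuous_on_subset by (intro borel_integrable_compact) blast+
    then show ?thesis by (simp add: set_integrable_def integrable_completion)
  qed
  show "set_integrable lebesgue K \<phi>" "set_integrable lebesgue K (\<lambda>x. cgrad \<phi> x $ i)"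
    if "compact K \<and> K \<subseteq> \<Omega>" for K i
    using that Cc_1_D(1,3)[OF \<phi>] by (auto simp: cgrad_def intro!: *)
  fix \<psi> :: "real^'n \<Rightarrow> real" and i assume "\<psi> \<in> Cc_inf \<Omega>"
  then have \<psi>: "\<psi> \<in> Cc_1 \<Omega>" by (rule Cc_inf_subset_Cc_1)
  obtain K where K: "compact K" "K \<subseteq> \<Omega>" "\<And>x. x \<notin> K \<Longrightarrow> \<phi> x = 0"
    and \<phi>'0: "\<And>x. x \<notin> K \<Longrightarrow> cgrad \<phi> x = 0" using Cc_1_support[OF \<phi>] by blast
  have c1: "continuous_on UNIV (\<lambda>x. \<phi> x * cgrad \<psi> x $ i)" "continuous_on UNIV (\<lambda>x. cgrad \<phi> x $ i * \<psi> x)"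
    using Cc_1_D(1,3)[OF \<phi>] Cc_1_D(1,3)[OF \<psi>] by (auto simp: cgrad_def intro!: continuous_intros)
  have i: "integrable lborel (\<lambda>x. \<phi> x * cgrad \<psi> x $ i)" "integrable lborel (\<lambda>x. cgrad \<phi> x $ i * \<psi> x)"
    using K \<phi>'0 c1 by (auto intro!: integrable_continuous_compact_support(1)[of _ K])
  have "0 = (LINT x|lborel. frechet_derivative (\<lambda>x. \<phi> x * \<psi> x) (at x) (axis i 1))"
    using integral_directional_derivative_zero[OF Cc_1_subset[OF _ Cc_1_mult[OF \<phi> \<psi>]]] by simp
  also have "\<dots> = (LINT x|lborel. \<phi> x * cgrad \<psi> x $ i + cgrad \<phi> x $ i * \<psi> x)"
  proof (intro Bochner_Integration.integral_cong refl)
    fix x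
    have "((\<lambda>x. \<phi> x * \<psi> x) has_derivative
        (\<lambda>v. \<phi> x * frechet_derivative \<psi> (at x) v + frechet_derivative \<phi> (at x) v * \<psi> x)) (at x)"
      using Cc_1_D(2)[OF \<phi>] Cc_1_D(2)[OF \<psi>]
      by (intro has_derivative_mult) (auto simp: frechet_derivative_works[symmetric])
    then show "frechet_derivative (\<lambda>x. \<phi> x * \<psi> x) (at x) (axis i 1) = \<phi> x * cgrad \<psi> x $ i + cgrad \<phi> x $ i * \<psi> x"
      by (subst frechet_derivative_apply) (auto simp: cgrad_def)
  qed
  also have "\<dots> = (LINT x|lborel. \<phi> x * cgrad \<psi> x $ i) + (LINT x|lborel. cgrad \<phi> x $ i * \<psi> x)"
    using i by (rule Bochner_Integration.integral_add)
  also have "(LINT x|lborel. \<phi> x * cgrad \<psi> x $ i) = (LINT x:\<Omega>|lebesgue. \<phi> x * cgrad \<psi> x $ i)"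
    unfolding set_lebesgue_integral_def using i(1) K(2,3)
    by (subst integral_completion[symmetric]) (fastforce intro!: Bochner_Integration.integral_cong simp: indicator_def)+
  also have "(LINT x|lborel. cgrad \<phi> x $ i * \<psi> x) = (LINT x:\<Omega>|lebesgue. cgrad \<phi> x $ i * \<psi> x)"
    unfolding set_lebesgue_integral_def using i(2) K(2) \<phi>'0
    by (subst integral_completion[symmetric]) (fastforce intro!: Bochner_Integration.integral_cong simp: indicator_def)+
  finally show "(LINT x:\<Omega>|lebesgue. \<phi> x * cgrad \<psi> x $ i) = - (LINT x:\<Omega>|lebesgue. cgrad \<phi> x $ i * \<psi> x)"
    by simp
qed

lemma weak_grad_lincomb:
  fixes u v :: "real^'n \<Rightarrow> real"
  assumes u: "weak_grad \<Omega> u g" and v: "weak_grad \<Omega> v h"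
  shows "weak_grad \<Omega> (\<lambda>x. c * u x + d * v x) (\<lambda>x. c *\<^sub>R g x + d *\<^sub>R h x)"
  unfolding weak_grad_def
proof (intro conjI allI impI ballI)
  fix K assume K: "compact K \<and> K \<subseteq> \<Omega>"
  have "set_integrable lebesgue K u" "set_integrable lebesgue K v" 
    "\<And>i. set_integrable lebesgue K (\<lambda>x. g x $ i)" "\<And>i. set_integrable lebesgue K (\<lambda>x. h x $ i)"
    using u v K by (auto simp: weak_grad_def)
  then show "set_integrable lebesgue K (\<lambda>x. c * u x + d * v x)"
    "set_integrable lebesgue K (\<lambda>x. (c *\<^sub>R g x + d *\<^sub>R h x) $ i)" for i
    by (auto intro!: set_integral_add)
next
  fix \<phi> :: "real^'n \<Rightarrow> real" and i assume \<phi>: "\<phi> \<in> Cc_inf \<Omega>"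
  note \<phi>1 = Cc_1_D[OF Cc_inf_subset_Cc_1[OF \<phi>]]
  obtain K where K: "compact K" "K \<subseteq> \<Omega>" "\<And>x. x \<notin> K \<Longrightarrow> \<phi> x = 0"
    and \<phi>'0: "\<And>x. x \<notin> K \<Longrightarrow> cgrad \<phi> x = 0" using Cc_1_support[OF Cc_inf_subset_Cc_1[OF \<phi>]] by blast
  have cc: "continuous_on UNIV (\<lambda>x. cgrad \<phi> x $ i)" using \<phi>1(3) by (simp add: cgrad_def)
  have I: "set_integrable lebesgue \<Omega> (\<lambda>x. u x * cgrad \<phi> x $ i)" "set_integrable lebesgue \<Omega> (\<lambda>x. v x * cgrad \<phi> x $ i)"
      "set_integrable lebesgue \<Omega> (\<lambda>x. g x $ i * \<phi> x)" "set_integrable lebesgue \<Omega> (\<lambda>x. h x $ i * \<phi> x)"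
    using u v K \<phi>'0 cc \<phi>1(1) by (auto intro!: set_integrable_mult_continuous[of K] simp: weak_grad_def)
  have E: "(LINT x:\<Omega>|lebesgue. u x * cgrad \<phi> x $ i) = - (LINT x:\<Omega>|lebesgue. g x $ i * \<phi> x)"
    "(LINT x:\<Omega>|lebesgue. v x * cgrad \<phi> x $ i) = - (LINT x:\<Omega>|lebesgue. h x $ i * \<phi> x)"
    by (rule weak_gradD[OF u \<phi>], rule weak_gradD[OF v \<phi>])
  have "(LINT x:\<Omega>|lebesgue. (c * u x + d * v x) * cgrad \<phi> x $ i)
      = (LINT x:\<Omega>|lebesgue. c * (u x * cgrad \<phi> x $ i) + d * (v x * cgrad \<phi> x $ i))"
    by (simp add: algebra_simps)
  also have "\<dots> = c * (LINT x:\<Omega>|lebesgue. u x * cgrad \<phi> x $ i) + d * (LINT x:\<Omega>|lebesgue. v x * cgrad \<phi> x $ i)"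
    using I by (subst set_integral_add) auto
  also have "\<dots> = - (c * (LINT x:\<Omega>|lebesgue. g x $ i * \<phi> x) + d * (LINT x:\<Omega>|lebesgue. h x $ i * \<phi> x))"
    by (simp add: E)
  also have "c * (LINT x:\<Omega>|lebesgue. g x $ i * \<phi> x) + d * (LINT x:\<Omega>|lebesgue. h x $ i * \<phi> x)
      = (LINT x:\<Omega>|lebesgue. c * (g x $ i * \<phi> x) + d * (h x $ i * \<phi> x))"
    using I by (subst set_integral_add) auto
  also have "\<dots> = (LINT x:\<Omega>|lebesgue. (c *\<^sub>R g x + d *\<^sub>R h x) $ i * \<phi> x)"
    by (simp add: algebra_simps)
  finally show "(LINT x:\<Omega>|lebesgue. (c * u x + d * v x) * cgrad \<phi> x $ i)
      = - (LINT x:\<Omega>|lebesgue. (c *\<^sub>R g x + d *\<^sub>R h x) $ i * \<phi> x)" .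
qed

section \<open>The Gagliardo--Nirenberg--Sobolev inequality\<close>

text \<open>The case \<open>s = 0\<close> is singled out because \<open>0 powr 0 = 0\<close> in HOL, whereas the endpoint of Gagliardo's
  argument needs \<open>f\<^sup>0 = 1\<close> also where \<open>f\<close> vanishes.\<close>
definition epow :: "ennreal \<Rightarrow> real \<Rightarrow> ennreal" where
  "epow x s = (if s = 0 then 1 else if x = top then top else ennreal (enn2real x powr s))"

lemma epow_ennreal: "0 \<le> r \<Longrightarrow> s \<noteq> 0 \<Longrightarrow> epow (ennreal r) s = ennreal (r powr s)"
  by (simp add: epow_def)

lemma epow_0 [simp]: "epow x 0 = 1"
  by (simp add: epow_def)

lemma epow_top: "s \<noteq> 0 \<Longrightarrow> epow top s = top"
  by (simp add: epow_def)


lemma epow_add: "0 \<le> s \<Longrightarrow> 0 \<le> t \<Longrightarrow> epow x (s + t) = epow x s * epow x t"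
  by (cases x) (auto simp: epow_def powr_add ennreal_mult' ennreal_top_mult)

lemma epow_mono: "0 \<le> s \<Longrightarrow> x \<le> y \<Longrightarrow> epow x s \<le> epow y s"
  by (cases x; cases y) (auto simp: epow_def top_unique intro!: ennreal_leI powr_mono2)

lemma epow_eq_0_iff: "epow x s = 0 \<longleftrightarrow> s \<noteq> 0 \<and> x = 0"
  by (cases x) (auto simp: epow_def)

lemma borel_measurable_epow [measurable]:
  assumes [measurable]: "f \<in> borel_measurable M"
  shows "(\<lambda>x. epow (f x) s) \<in> borel_measurable M"
  unfolding epow_def by measurable

section \<open>Hoelder's inequality for finitely many factors\<close>

lemma weighted_AM_GM:
  fixes x \<theta> :: "'k \<Rightarrow> real"
  assumes "finite J" and \<theta>: "\<And>i. i \<in> J \<Longrightarrow> 0 < \<theta> i" "sum \<theta> J = 1" and x: "\<And>i. i \<in> J \<Longrightarrow> 0 \<le> x i"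
  shows "(\<Prod>i\<in>J. x i powr \<theta> i) \<le> (\<Sum>i\<in>J. \<theta> i * x i)"
proof (cases "\<exists>i\<in>J. x i = 0")
  case True
  then have "(\<Prod>i\<in>J. x i powr \<theta> i) = 0" using \<open>finite J\<close> by auto
  then show ?thesis using \<theta>(1) x by (simp add: sum_nonneg less_imp_le)
next
  case False
  then have pos: "\<And>i. i \<in> J \<Longrightarrow> 0 < x i" using x by force
  have ne: "J \<noteq> {}" using \<theta>(2) by auto
  have S: "0 < (\<Sum>i\<in>J. \<theta> i * x i)"
    using \<open>finite J\<close> ne \<theta>(1) pos by (intro sum_pos) auto
  have "(\<Sum>i\<in>J. \<theta> i * ln (x i)) \<le> ln (\<Sum>i\<in>J. \<theta> i *\<^sub>R x i)"
    using \<open>finite J\<close> ne \<theta> pos by (intro concave_on_sum[OF _ _ ln_concave]) (auto intro: less_imp_le)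
  then have "exp (\<Sum>i\<in>J. \<theta> i * ln (x i)) \<le> (\<Sum>i\<in>J. \<theta> i * x i)"
    using S by (simp add: ln_ge_iff)
  moreover have "exp (\<Sum>i\<in>J. \<theta> i * ln (x i)) = (\<Prod>i\<in>J. x i powr \<theta> i)"
    using \<open>finite J\<close> pos by (simp add: exp_sum) (intro prod.cong, auto simp: powr_def dest: pos)
  ultimately show ?thesis by simp
qed

lemma ennreal_prod_eq_top:
  fixes f :: "'k \<Rightarrow> ennreal"
  assumes "finite J" "i \<in> J" "f i = top" "\<And>j. j \<in> J \<Longrightarrow> f j \<noteq> 0"
  shows "prod f J = top"
proof -
  have "prod f J = f i * prod f (J - {i})" using assms by (meson prod.remove)
  moreover have "prod f (J - {i}) \<noteq> 0" using assms by simp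
  ultimately show ?thesis using assms by (simp add: ennreal_top_mult)
qed

text \<open>Dividing each g_i by its integral r_i reduces the claim to the weighted AM-GM
  inequality, integrated pointwise: the right side then integrates to the sum of the weights, which
  is 1. The degenerate integrals 0 and infinity have to be removed first.\<close>

lemma nn_integral_Holder_pos:
  fixes g :: "'k \<Rightarrow> 'a \<Rightarrow> ennreal"
  assumes J: "finite J" and \<theta>: "\<And>i. i \<in> J \<Longrightarrow> 0 < \<theta> i" "sum \<theta> J = 1"
    and g [measurable]: "\<And>i. i \<in> J \<Longrightarrow> g i \<in> borel_measurable M"
  shows "(\<integral>\<^sup>+x. (\<Prod>i\<in>J. epow (g i x) (\<theta> i)) \<partial>M) \<le> (\<Prod>i\<in>J. epow (\<integral>\<^sup>+x. g i x \<partial>M) (\<theta> i))"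
proof -
  define G where "G i = (\<integral>\<^sup>+x. g i x \<partial>M)" for i
  \<comment> \<open>A zero integral must be treated before an infinite one: since 0 * top = 0, the
    right-hand side may vanish although another factor is infinite.\<close>
  consider i where "i \<in> J" "G i = 0" | i where "i \<in> J" "G i = top" "\<forall>j\<in>J. G j \<noteq> 0"
    | "\<forall>j\<in>J. G j \<noteq> 0 \<and> G j \<noteq> top" by blast
  then show ?thesis
  proof cases
    case (1 i)
    then have "AE x in M. g i x = 0"
      using nn_integral_0_iff_AE[OF g] by (simp add: G_def)
    then have "AE x in M. (\<Prod>i\<in>J. epow (g i x) (\<theta> i)) = 0"
    proof eventually_elim
      case (elim x)
      then have "epow (g i x) (\<theta> i) = 0" using 1 \<theta>(1)[of i] by (simp add: epow_eq_0_iff)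
      then show ?case using J 1 by (intro prod_zero) auto
    qed
    then have "(\<integral>\<^sup>+x. (\<Prod>i\<in>J. epow (g i x) (\<theta> i)) \<partial>M) = (\<integral>\<^sup>+x. 0 \<partial>M)"
      by (intro nn_integral_cong_AE)
    then show ?thesis by simp
  next
    case (2 i)
    have "(\<Prod>i\<in>J. epow (G i) (\<theta> i)) = top"
      using 2 \<theta>(1) J by (intro ennreal_prod_eq_top[of _ i]) (auto simp: epow_eq_0_iff epow_top less_imp_neq[symmetric])
    then show ?thesis by (simp add: G_def)
  next
    case 3
    define r where "r i = enn2real (G i)" for i
    have r: "G i = ennreal (r i)" "0 < r i" if "i \<in> J" for i
      using 3 that by (auto simp: r_def enn2real_positive_iff top.not_eq_extremum zero_less_iff_neq_zero)
    define A where "A = (\<Prod>i\<in>J. r i powr \<theta> i)"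
    have A: "0 < A" unfolding A_def using r(2) by (intro prod_pos) force
    have AG: "(\<Prod>i\<in>J. epow (G i) (\<theta> i)) = ennreal A"
    proof -
      have "(\<Prod>i\<in>J. epow (G i) (\<theta> i)) = (\<Prod>i\<in>J. ennreal (r i powr \<theta> i))"
        using r \<theta>(1) by (intro prod.cong refl) (auto simp: epow_ennreal less_imp_le less_imp_neq[symmetric])
      then show ?thesis by (simp add: A_def prod_ennreal)
    qed
    have pw: "(\<Prod>i\<in>J. epow (g i x) (\<theta> i)) \<le> ennreal A * (\<Sum>i\<in>J. ennreal (\<theta> i / r i) * g i x)" for x
    proof (cases "\<exists>i\<in>J. g i x = top")
      case True
      then obtain i where i: "i \<in> J" "g i x = top" by blast
      have "ennreal (\<theta> i / r i) * g i x \<le> (\<Sum>i\<in>J. ennreal (\<theta> i / r i) * g i x)"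
        using J i by (intro member_le_sum) auto
      moreover have "ennreal (\<theta> i / r i) * g i x = top"
        using i r(2)[OF i(1)] \<theta>(1)[OF i(1)] by (subst i(2), subst ennreal_mult_top) (auto simp: ennreal_eq_0_iff not_le)
      ultimately have "(\<Sum>i\<in>J. ennreal (\<theta> i / r i) * g i x) = top" by (simp add: top_unique)
      then show ?thesis using A by (simp add: ennreal_mult_top)
    next
      case False
      define y where "y i = enn2real (g i x)" for i
      have y: "g i x = ennreal (y i)" "0 \<le> y i" if "i \<in> J" for i
        using False that by (auto simp: y_def top.not_eq_extremum)
      have "(\<Prod>i\<in>J. epow (g i x) (\<theta> i)) = (\<Prod>i\<in>J. ennreal (y i powr \<theta> i))"
        using y \<theta>(1) by (intro prod.cong refl) (auto simp: epow_ennreal less_imp_neq[symmetric])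
      also have "\<dots> = ennreal (\<Prod>i\<in>J. y i powr \<theta> i)" by (simp add: prod_ennreal)
      also have "(\<Prod>i\<in>J. y i powr \<theta> i) = A * (\<Prod>i\<in>J. (y i / r i) powr \<theta> i)"
        unfolding A_def prod.distrib[symmetric]
      proof (intro prod.cong refl)
        fix i assume "i \<in> J"
        with y[OF this] r(2)[OF this] show "y i powr \<theta> i = r i powr \<theta> i * (y i / r i) powr \<theta> i"
          by (simp add: powr_divide)
      qed
      also have "ennreal \<dots> \<le> ennreal (A * (\<Sum>i\<in>J. \<theta> i * (y i / r i)))"
        using A y r by (intro ennreal_leI mult_left_mono weighted_AM_GM J \<theta>) (auto simp: less_imp_le)
      also have "\<dots> = ennreal A * (\<Sum>i\<in>J. ennreal (\<theta> i * (y i / r i)))"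
        using A y r \<theta>(1) by (subst sum_ennreal) (auto simp: ennreal_mult' less_imp_le)
      also have "(\<Sum>i\<in>J. ennreal (\<theta> i * (y i / r i))) = (\<Sum>i\<in>J. ennreal (\<theta> i / r i) * g i x)"
        using y r \<theta>(1) by (intro sum.cong refl) (auto simp: ennreal_mult'[symmetric] less_imp_le)
      finally show ?thesis .
    qed
    have "(\<integral>\<^sup>+x. (\<Prod>i\<in>J. epow (g i x) (\<theta> i)) \<partial>M) \<le> (\<integral>\<^sup>+x. ennreal A * (\<Sum>i\<in>J. ennreal (\<theta> i / r i) * g i x) \<partial>M)"
      by (intro nn_integral_mono pw)
    also have "\<dots> = ennreal A * (\<Sum>i\<in>J. ennreal (\<theta> i / r i) * G i)"
      by (simp add: nn_integral_cmult nn_integral_sum G_def)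
    also have "(\<Sum>i\<in>J. ennreal (\<theta> i / r i) * G i) = (\<Sum>i\<in>J. ennreal (\<theta> i))"
    proof (intro sum.cong refl)
      fix i assume i: "i \<in> J"
      have "ennreal (\<theta> i / r i) * G i = ennreal (\<theta> i / r i * r i)"
        using r[OF i] \<theta>(1)[OF i] by (simp add: ennreal_mult'[symmetric] less_imp_le del: times_divide_eq_left)
      then show "ennreal (\<theta> i / r i) * G i = ennreal (\<theta> i)" using r[OF i] by simp
    qed
    also have "\<dots> = 1" using \<theta> by (subst sum_ennreal) (auto simp: less_imp_le)
    finally show ?thesis using AG by (simp add: G_def)
  qed
qed

text \<open>Zero weights occur at the endpoint of Gagliardo's argument, where the weight 1 - |J| p
  of the factor f itself becomes 0. Such factors are 1 by the convention in \<open>epow\<close> and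
  drop out of both products.\<close>

lemma nn_integral_Holder:
  fixes g :: "'k \<Rightarrow> 'a \<Rightarrow> ennreal"
  assumes J: "finite J" and \<theta>: "\<And>i. i \<in> J \<Longrightarrow> 0 \<le> \<theta> i" "sum \<theta> J = 1"
    and g [measurable]: "\<And>i. i \<in> J \<Longrightarrow> g i \<in> borel_measurable M"
  shows "(\<integral>\<^sup>+x. (\<Prod>i\<in>J. epow (g i x) (\<theta> i)) \<partial>M) \<le> (\<Prod>i\<in>J. epow (\<integral>\<^sup>+x. g i x \<partial>M) (\<theta> i))"
proof -
  define J' where "J' = {i\<in>J. 0 < \<theta> i}"
  have sub: "J' \<subseteq> J" "\<forall>i\<in>J - J'. \<theta> i = 0" using \<theta>(1) by (force simp: J'_def)+
  have r: "(\<Prod>i\<in>J. epow (h i) (\<theta> i)) = (\<Prod>i\<in>J'. epow (h i) (\<theta> i))" for h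
    using sub by (intro prod.mono_neutral_right J) auto
  have "sum \<theta> J' = 1" using sum.mono_neutral_left[OF J sub] \<theta>(2) by simp
  then show ?thesis unfolding r using sub(1) J
    by (intro nn_integral_Holder_pos) (auto simp: J'_def)
qed

text \<open>Induction on \<open>J\<close>: in the variable \<open>i\<close> the factor \<open>(\<integral>f dx\<^sub>i)\<^sup>p\<close> is constant, and Holder's inequality with the
  exponents \<open>1 - |J| p\<close> and \<open>p\<close> (\<open>|J|\<close> times) moves the integral over \<open>x\<^sub>i\<close> inside all other factors. This
  leaves the same expression for \<open>F = \<integral>f dx\<^sub>i\<close> over \<open>J\<close>.\<close>
lemma Gagliardo_PiM:
  fixes f :: "('i \<Rightarrow> real) \<Rightarrow> ennreal"
  assumes "finite J" "0 \<le> p" "(real (card J) - 1) * p \<le> 1"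
    and "f \<in> borel_measurable (\<Pi>\<^sub>M j\<in>J. lborel)"
  shows "(\<integral>\<^sup>+x. epow (f x) (1 - (real (card J) - 1) * p) * (\<Prod>j\<in>J. epow (\<integral>\<^sup>+t. f (x(j := t)) \<partial>lborel) p)
      \<partial>(\<Pi>\<^sub>M j\<in>J. lborel)) \<le> epow (\<integral>\<^sup>+x. f x \<partial>(\<Pi>\<^sub>M j\<in>J. lborel)) (1 + p)"
  using assms
proof (induction J arbitrary: f rule: finite_induct)
  \<comment> \<open>\<open>card J - 1\<close> is computed in the reals and equals -1 here, so that
    the exponent on the left is 1 + p and both sides coincide.\<close>
  case empty
  interpret product_sigma_finite "\<lambda>_::'i. lborel :: real measure"
    by (simp add: product_sigma_finite_def lborel.sigma_finite_measure_axioms)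
  show ?case by (simp add: nn_integral_empty)
next
  case (insert i J)
  interpret product_sigma_finite "\<lambda>_::'i. lborel :: real measure"
    by (simp add: product_sigma_finite_def lborel.sigma_finite_measure_axioms)
  let ?P = "\<lambda>J. \<Pi>\<^sub>M j\<in>J. (lborel :: real measure)"
  have f [measurable]: "f \<in> borel_measurable (?P (insert i J))" by fact
  have c: "real (card (insert i J)) - 1 = real (card J)" using insert.hyps by simp
  have cp: "real (card J) * p \<le> 1" using insert.prems(2) by (simp only: c)
  define F where "F x = (\<integral>\<^sup>+y. f (x(i := y)) \<partial>lborel)" for x
  have f1 [measurable]: "(\<lambda>(x, y). f (x(i := y))) \<in> borel_measurable (?P J \<Otimes>\<^sub>M lborel)"
    unfolding split_beta'
    by (rule measurable_compose[OF _ f], rule measurable_fun_upd[of _ J]) auto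
  have F [measurable]: "F \<in> borel_measurable (?P J)"
    unfolding F_def using f1 by (intro lborel.borel_measurable_nn_integral)
  have upd [measurable]: "(\<lambda>y. x(i := y)) \<in> lborel \<rightarrow>\<^sub>M ?P (insert i J)" if "x \<in> space (?P J)" for x
    using that by (intro measurable_fun_upd[of _ J]) auto
  have upd2: "(\<lambda>(y, t). x(i := y, j := t)) \<in> lborel \<Otimes>\<^sub>M lborel \<rightarrow>\<^sub>M ?P (insert i J)"
    if "x \<in> space (?P J)" "j \<in> J" for x j
    unfolding split_beta' using that
    by (intro measurable_fun_upd[of _ "insert i J"] measurable_compose[OF measurable_fst upd]) auto
  have fm: "(\<lambda>(y, t). f (x(i := y, j := t))) \<in> borel_measurable (lborel \<Otimes>\<^sub>M lborel)"
    if "x \<in> space (?P J)" "j \<in> J" for x j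
    using measurable_compose[OF upd2[OF that] f] by (simp add: split_beta')
  have inner: "(\<integral>\<^sup>+y. epow (f (x(i := y))) (1 - real (card J) * p) *
        (\<Prod>j\<in>insert i J. epow (\<integral>\<^sup>+t. f (x(i := y, j := t)) \<partial>lborel) p) \<partial>lborel)
      \<le> epow (F x) (1 - (real (card J) - 1) * p) * (\<Prod>j\<in>J. epow (\<integral>\<^sup>+t. F (x(j := t)) \<partial>lborel) p)"
    if x: "x \<in> space (?P J)" for x
  proof -
    define g where "g k y = (if k = i then f (x(i := y)) else (\<integral>\<^sup>+t. f (x(i := y, k := t)) \<partial>lborel))" for k y
    define \<theta> where "\<theta> k = (if k = i then 1 - real (card J) * p else p)" for k
    have g [measurable]: "g k \<in> borel_measurable lborel" if "k \<in> insert i J" for k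
    proof (cases "k = i")
      case True
      then show ?thesis unfolding g_def using measurable_compose[OF upd[OF x] f] by simp
    next
      case False
      then have "k \<in> J" using that by simp
      then show ?thesis unfolding g_def using False lborel.borel_measurable_nn_integral[OF fm[OF x]] by simp
    qed
    have "(\<integral>\<^sup>+y. epow (f (x(i := y))) (1 - real (card J) * p) *
        (\<Prod>j\<in>insert i J. epow (\<integral>\<^sup>+t. f (x(i := y, j := t)) \<partial>lborel) p) \<partial>lborel)
      = (\<integral>\<^sup>+y. epow (F x) p * (\<Prod>k\<in>insert i J. epow (g k y) (\<theta> k)) \<partial>lborel)"
    proof (intro nn_integral_cong)
      fix y
      have "(\<Prod>j\<in>J. epow (\<integral>\<^sup>+t. f (x(i := y, j := t)) \<partial>lborel) p) = (\<Prod>k\<in>J. epow (g k y) (\<theta> k))"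
        using insert.hyps by (intro prod.cong refl) (auto simp: g_def \<theta>_def)
      then show "epow (f (x(i := y))) (1 - real (card J) * p) *
        (\<Prod>j\<in>insert i J. epow (\<integral>\<^sup>+t. f (x(i := y, j := t)) \<partial>lborel) p)
        = epow (F x) p * (\<Prod>k\<in>insert i J. epow (g k y) (\<theta> k))"
        using insert.hyps by (simp add: g_def \<theta>_def F_def ac_simps)
    qed
    also have "\<dots> = epow (F x) p * (\<integral>\<^sup>+y. (\<Prod>k\<in>insert i J. epow (g k y) (\<theta> k)) \<partial>lborel)"
      by (intro nn_integral_cmult borel_measurable_prod_ennreal borel_measurable_epow g)
    also have "\<dots> \<le> epow (F x) p * (\<Prod>k\<in>insert i J. epow (\<integral>\<^sup>+y. g k y \<partial>lborel) (\<theta> k))"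
    proof (intro mult_left_mono nn_integral_Holder)
      have "sum \<theta> J = real (card J) * p"
        using insert.hyps sum.cong[of J J \<theta> "\<lambda>_. p"] unfolding \<theta>_def by fastforce
      then show "sum \<theta> (insert i J) = 1" using insert.hyps by (simp add: \<theta>_def)
    qed (use insert.hyps insert.prems cp in \<open>auto simp: \<theta>_def intro: g\<close>)
    also have "(\<Prod>k\<in>insert i J. epow (\<integral>\<^sup>+y. g k y \<partial>lborel) (\<theta> k))
        = epow (F x) (1 - real (card J) * p) * (\<Prod>j\<in>J. epow (\<integral>\<^sup>+t. F (x(j := t)) \<partial>lborel) p)"
    proof -
      have "(\<Prod>k\<in>J. epow (\<integral>\<^sup>+y. g k y \<partial>lborel) (\<theta> k)) = (\<Prod>j\<in>J. epow (\<integral>\<^sup>+t. F (x(j := t)) \<partial>lborel) p)"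
      proof (intro prod.cong refl)
        fix j assume j: "j \<in> J"
        then have ji: "j \<noteq> i" using insert.hyps by auto
        have "(\<integral>\<^sup>+y. g j y \<partial>lborel) = (\<integral>\<^sup>+y. \<integral>\<^sup>+t. f (x(i := y, j := t)) \<partial>lborel \<partial>lborel)"
          using ji by (simp add: g_def)
        also have "\<dots> = (\<integral>\<^sup>+t. \<integral>\<^sup>+y. f (x(i := y, j := t)) \<partial>lborel \<partial>lborel)"
          using lborel_pair.Fubini'[OF fm[OF x j]] by simp
        also have "\<dots> = (\<integral>\<^sup>+t. F (x(j := t)) \<partial>lborel)"
          using ji by (simp add: F_def fun_upd_twist)
        finally show "epow (\<integral>\<^sup>+y. g j y \<partial>lborel) (\<theta> j) = epow (\<integral>\<^sup>+t. F (x(j := t)) \<partial>lborel) p"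
          using ji by (simp add: \<theta>_def)
      qed
      then show ?thesis using insert.hyps by (simp add: g_def \<theta>_def F_def)
    qed
    also have "epow (F x) p * (epow (F x) (1 - real (card J) * p) * (\<Prod>j\<in>J. epow (\<integral>\<^sup>+t. F (x(j := t)) \<partial>lborel) p))
        = epow (F x) (1 - (real (card J) - 1) * p) * (\<Prod>j\<in>J. epow (\<integral>\<^sup>+t. F (x(j := t)) \<partial>lborel) p)"
    proof -
      have "p + (1 - real (card J) * p) = 1 - (real (card J) - 1) * p" by (simp add: algebra_simps)
      then have "epow (F x) (1 - (real (card J) - 1) * p) = epow (F x) p * epow (F x) (1 - real (card J) * p)"
        using epow_add[of p "1 - real (card J) * p" "F x"] insert.prems(1) cp by (simp only:)
      then show ?thesis by (simp only: mult.assoc)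
    qed
    finally show ?thesis .
  qed
  have updJ: "(\<lambda>(x, t). x(j := t)) \<in> ?P (insert i J) \<Otimes>\<^sub>M lborel \<rightarrow>\<^sub>M ?P (insert i J)" if "j \<in> insert i J" for j
    unfolding split_beta' using that by (intro measurable_fun_upd[of _ "insert i J"]) auto
  have "(\<lambda>(x, t). f (x(j := t))) \<in> borel_measurable (?P (insert i J) \<Otimes>\<^sub>M lborel)" if "j \<in> insert i J" for j
    using measurable_compose[OF updJ[OF that] f] by (simp add: split_beta')
  then have [measurable]: "(\<lambda>x. \<integral>\<^sup>+t. f (x(j := t)) \<partial>lborel) \<in> borel_measurable (?P (insert i J))" if "j \<in> insert i J" for j
    using that by (intro lborel.borel_measurable_nn_integral)
  have "(\<integral>\<^sup>+x. epow (f x) (1 - (real (card (insert i J)) - 1) * p) *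
        (\<Prod>j\<in>insert i J. epow (\<integral>\<^sup>+t. f (x(j := t)) \<partial>lborel) p) \<partial>?P (insert i J))
      = (\<integral>\<^sup>+x. \<integral>\<^sup>+y. epow (f (x(i := y))) (1 - real (card J) * p) *
        (\<Prod>j\<in>insert i J. epow (\<integral>\<^sup>+t. f (x(i := y, j := t)) \<partial>lborel) p) \<partial>lborel \<partial>?P J)"
    unfolding c using insert.hyps by (subst product_nn_integral_insert) auto
  also have "\<dots> \<le> (\<integral>\<^sup>+x. epow (F x) (1 - (real (card J) - 1) * p) *
        (\<Prod>j\<in>J. epow (\<integral>\<^sup>+t. F (x(j := t)) \<partial>lborel) p) \<partial>?P J)"
    by (intro nn_integral_mono inner)
  also have "\<dots> \<le> epow (\<integral>\<^sup>+x. F x \<partial>?P J) (1 + p)"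
    using insert.prems cp by (intro insert.IH F) (auto simp: algebra_simps)
  also have "(\<integral>\<^sup>+x. F x \<partial>?P J) = (\<integral>\<^sup>+x. f x \<partial>?P (insert i J))"
    using insert.hyps unfolding F_def by (subst product_nn_integral_insert) auto
  finally show ?case .
qed

lemma prod_mono_ennreal:
  fixes f g :: "'k \<Rightarrow> ennreal"
  shows "(\<And>i. i \<in> J \<Longrightarrow> f i \<le> g i) \<Longrightarrow> prod f J \<le> prod g J"
  by (induction J rule: infinite_finite_induct) (auto intro!: mult_mono)

text \<open>For this value of the exponent the power of f in \<open>Gagliardo_PiM\<close> over the
  whole basis is 0, which leaves only the line integrals. Lebesgue measure is the image of the
  product measure under the coordinate map \<open>S\<close>.\<close>

lemma Gagliardo_lborel:
  fixes f :: "'a::euclidean_space \<Rightarrow> ennreal"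
  assumes f [measurable]: "f \<in> borel_measurable borel" and D: "2 \<le> DIM('a)"
  defines "\<kappa> \<equiv> 1 / (real DIM('a) - 1)"
  shows "(\<integral>\<^sup>+z. (\<Prod>b\<in>Basis. epow (\<integral>\<^sup>+t. f (z + t *\<^sub>R b) \<partial>lborel) \<kappa>) \<partial>lborel)
    \<le> epow (\<integral>\<^sup>+z. f z \<partial>lborel) (1 + \<kappa>)"
proof -
  let ?P = "\<Pi>\<^sub>M b\<in>(Basis::'a set). (lborel :: real measure)"
  define S :: "('a \<Rightarrow> real) \<Rightarrow> 'a" where "S x = (\<Sum>b\<in>Basis. x b *\<^sub>R b)" for x
  have S [measurable]: "S \<in> ?P \<rightarrow>\<^sub>M borel" unfolding S_def by measurable
  have L: "(\<integral>\<^sup>+z. g z \<partial>lborel) = (\<integral>\<^sup>+x. g (S x) \<partial>?P)"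
    if [measurable]: "g \<in> borel_measurable borel" for g :: "'a \<Rightarrow> ennreal"
    by (subst lborel_eq, subst nn_integral_distr) (auto simp: S_def)
  have \<kappa>: "0 < \<kappa>" "(real DIM('a) - 1) * \<kappa> = 1" using D by (auto simp: \<kappa>_def)
  have meas: "(\<lambda>(z, t). f (z + t *\<^sub>R b)) \<in> borel_measurable (borel \<Otimes>\<^sub>M lborel)" for b
    by measurable
  have [measurable]: "(\<lambda>z. \<integral>\<^sup>+t. f (z + t *\<^sub>R b) \<partial>lborel) \<in> borel_measurable borel" for b
    using meas by (intro lborel.borel_measurable_nn_integral)
  have upd: "S (x(b := t)) = S x + (t - x b) *\<^sub>R b" if b: "b \<in> Basis" for x b t
  proof -
    have "S (x(b := t)) = t *\<^sub>R b + (\<Sum>c\<in>Basis - {b}. x c *\<^sub>R c)"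
      unfolding S_def using b by (subst sum.remove[OF _ b]) auto
    moreover have "S x = x b *\<^sub>R b + (\<Sum>c\<in>Basis - {b}. x c *\<^sub>R c)"
      unfolding S_def using b by (subst sum.remove[OF _ b]) auto
    ultimately show ?thesis by (simp add: algebra_simps)
  qed
  \<comment> \<open>Replacing a coordinate by t and adding t to it differ by a translation of the
    line, which preserves the integral.\<close>
  have tr: "(\<integral>\<^sup>+t. f (S (x(b := t))) \<partial>lborel) = (\<integral>\<^sup>+t. f (S x + t *\<^sub>R b) \<partial>lborel)" if b: "b \<in> Basis" for x b
    unfolding upd[OF b]
    using nn_integral_real_affine[of "\<lambda>t. f (S x + (t - x b) *\<^sub>R b)" 1 "x b"] by simp
  have "(\<integral>\<^sup>+z. (\<Prod>b\<in>Basis. epow (\<integral>\<^sup>+t. f (z + t *\<^sub>R b) \<partial>lborel) \<kappa>) \<partial>lborel)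
      = (\<integral>\<^sup>+x. (\<Prod>b\<in>Basis. epow (\<integral>\<^sup>+t. f (S x + t *\<^sub>R b) \<partial>lborel) \<kappa>) \<partial>?P)"
    by (rule L) measurable
  also have "\<dots> = (\<integral>\<^sup>+x. epow (f (S x)) (1 - (real DIM('a) - 1) * \<kappa>) *
      (\<Prod>b\<in>Basis. epow (\<integral>\<^sup>+t. f (S (x(b := t))) \<partial>lborel) \<kappa>) \<partial>?P)"
    by (simp add: \<kappa> tr)
  also have "\<dots> \<le> epow (\<integral>\<^sup>+x. f (S x) \<partial>?P) (1 + \<kappa>)"
    using \<kappa> by (intro Gagliardo_PiM) auto
  also have "(\<integral>\<^sup>+x. f (S x) \<partial>?P) = (\<integral>\<^sup>+z. f z \<partial>lborel)" by (rule L[symmetric]) simp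
  finally show ?thesis .
qed

section \<open>From line integrals to the critical Sobolev inequality\<close>

lemma tendsto_abs_powr_0:
  assumes "0 < s" shows "((\<lambda>h::real. \<bar>h\<bar> powr s) \<longlongrightarrow> 0) (at 0)"
proof -
  have "((\<lambda>h::real. \<bar>h\<bar> powr s) \<longlongrightarrow> \<bar>0\<bar> powr s) (at 0)"
    using assms by (intro tendsto_powr' tendsto_intros) auto
  then show ?thesis by simp
qed

lemma has_real_derivative_abs_powr:
  assumes s: "1 < s"
  shows "((\<lambda>x. \<bar>x\<bar> powr s) has_real_derivative s * (sgn x * \<bar>x\<bar> powr (s - 1))) (at x)"
proof -
  consider "x < 0" | "x = 0" | "x > 0" by linarith
  then show ?thesis
  proof cases
    case 1
    have "((\<lambda>x. (- x) powr s) has_real_derivative s * (sgn x * \<bar>x\<bar> powr (s - 1))) (at x)"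
      using 1 by (auto intro!: derivative_eq_intros)
    then show ?thesis
      by (rule has_field_derivative_transform_within_open[of _ _ _ "{..<0}"]) (use 1 in auto)
  next
    case 2
    have "((\<lambda>h::real. \<bar>h\<bar> powr (s - 1)) \<longlongrightarrow> 0) (at 0)" using s by (simp add: tendsto_abs_powr_0)
    then have "((\<lambda>h. (\<bar>0 + h\<bar> powr s - \<bar>0::real\<bar> powr s) / h) \<longlongrightarrow> 0) (at 0)"
    proof (rule Lim_null_comparison[rotated])
      have "norm ((\<bar>0 + h\<bar> powr s - \<bar>0::real\<bar> powr s) / h) \<le> \<bar>h\<bar> powr (s - 1)" for h :: real
        by (cases "h = 0") (auto simp: powr_diff)
      then show "\<forall>\<^sub>F h in at 0. norm ((\<bar>0 + h\<bar> powr s - \<bar>0::real\<bar> powr s) / h) \<le> \<bar>h\<bar> powr (s - 1)"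
        by simp
    qed
    then show ?thesis using 2 by (simp add: DERIV_def)
  next
    case 3
    have "((\<lambda>x. x powr s) has_real_derivative s * (sgn x * \<bar>x\<bar> powr (s - 1))) (at x)"
      using 3 by (auto intro!: derivative_eq_intros)
    then show ?thesis
      by (rule has_field_derivative_transform_within_open[of _ _ _ "{0<..}"]) (use 3 in auto)
  qed
qed

text \<open>The fundamental theorem of calculus along the line through z, from a point where u
  vanishes up to z. The condition s > 1 makes |u|^s continuously differentiable along the line, also
  across zeros of u.\<close>

lemma abs_powr_le_line_integral:
  fixes u :: "real^'n \<Rightarrow> real"
  assumes u: "u \<in> Cc_1 UNIV" and s: "1 < s" and b: "b \<in> Basis"
  shows "ennreal (\<bar>u z\<bar> powr s) \<le>
    (\<integral>\<^sup>+t. ennreal (s * \<bar>u (z + t *\<^sub>R b)\<bar> powr (s - 1) * norm (cgrad u (z + t *\<^sub>R b))) \<partial>lborel)"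
proof -
  obtain K where K: "compact K" "\<And>x. x \<notin> K \<Longrightarrow> u x = 0" using Cc_1_D(4)[OF u] by blast
  obtain R where R: "R > 0" "\<And>x. x \<in> K \<Longrightarrow> norm x \<le> R"
    using compact_imp_bounded[OF K(1)] bounded_pos by blast
  \<comment> \<open>|T| exceeds |z| + R, so z + T b lies outside the ball of radius R that contains
    the support.\<close>
  define T where "T = - (norm z + R + 1)"
  have T: "T < 0" using R(1) norm_ge_zero[of z] unfolding T_def by linarith
  have uT: "u (z + T *\<^sub>R b) = 0"
  proof (rule K(2))
    have "norm (T *\<^sub>R b) = \<bar>T\<bar>" using b by simp
    then have "norm (T *\<^sub>R b) \<le> norm (z + T *\<^sub>R b) + norm z"
      by (metis add.commute add_diff_cancel_left' norm_triangle_ineq4)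
    then have "norm (z + T *\<^sub>R b) > R" using b T by (simp add: T_def)
    then show "z + T *\<^sub>R b \<notin> K" using R(2) by force
  qed
  define d where "d t = s * (sgn (u (z + t *\<^sub>R b)) * \<bar>u (z + t *\<^sub>R b)\<bar> powr (s - 1)) * frechet_derivative u (at (z + t *\<^sub>R b)) b" for t

  have du: "((\<lambda>t. u (z + t *\<^sub>R b)) has_real_derivative frechet_derivative u (at (z + t *\<^sub>R b)) b) (at t)" for t
    by (rule has_real_derivative_along_line[OF Cc_1_D(2)[OF u, THEN frechet_derivative_works[THEN iffD1]]])
  have D: "((\<lambda>t. \<bar>u (z + t *\<^sub>R b)\<bar> powr s) has_real_derivative d t) (at t)" for t
    unfolding d_def by (rule DERIV_chain2[OF has_real_derivative_abs_powr[OF s] du])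
  have contu: "continuous_on UNIV (\<lambda>t. u (z + t *\<^sub>R b))"
    by (intro continuous_on_compose2[OF Cc_1_D(1)[OF u]] continuous_intros) auto
  have cs: "continuous_on UNIV (\<lambda>x::real. sgn x * \<bar>x\<bar> powr (s - 1))"
  proof (subst continuous_on_eq_continuous_within, rule ballI)
    fix x :: real
    consider "x \<noteq> 0" | "x = 0" by blast
    then show "continuous (at x within UNIV) (\<lambda>x. sgn x * \<bar>x\<bar> powr (s - 1))"
    proof cases
      case 1
      then show ?thesis by (auto intro!: continuous_intros)
    next
      case 2
      have "((\<lambda>h::real. \<bar>h\<bar> powr (s - 1)) \<longlongrightarrow> 0) (at 0)" using s by (simp add: tendsto_abs_powr_0)
      then have "((\<lambda>h::real. sgn h * \<bar>h\<bar> powr (s - 1)) \<longlongrightarrow> 0) (at 0)"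
        by (rule Lim_null_comparison[rotated]) (auto simp: abs_mult sgn_if)
      then show ?thesis using 2 by (simp add: continuous_within)
    qed
  qed
  have cd: "continuous_on UNIV d"
    unfolding d_def
    by (intro continuous_intros continuous_on_compose2[OF cs contu] continuous_on_compose2[OF Cc_1_D(3)[OF u]]) auto
  have "\<bar>u z\<bar> powr s = \<bar>u (z + 0 *\<^sub>R b)\<bar> powr s - \<bar>u (z + T *\<^sub>R b)\<bar> powr s"
    using s by (simp add: uT)
  also have "\<dots> = (LINT t|lborel. indicator {T..0} t *\<^sub>R d t)"
    using T D continuous_on_subset[OF cd]
    by (intro integral_FTC_Icc[symmetric])
      (auto intro: has_field_derivative_at_within simp: has_real_derivative_iff_has_vector_derivative[symmetric])
  finally have "ennreal (\<bar>u z\<bar> powr s) = ennreal (norm (LINT t|lborel. indicator {T..0} t *\<^sub>R d t))"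
    by (metis abs_of_nonneg powr_ge_zero real_norm_def)
  also have "\<dots> \<le> (\<integral>\<^sup>+t. norm (indicator {T..0} t *\<^sub>R d t) \<partial>lborel)"
    using continuous_on_subset[OF cd] by (intro integral_norm_bound_ennreal borel_integrable_compact) auto
  also have "\<dots> \<le> (\<integral>\<^sup>+t. ennreal (s * \<bar>u (z + t *\<^sub>R b)\<bar> powr (s - 1) * norm (cgrad u (z + t *\<^sub>R b))) \<partial>lborel)"
  proof (intro nn_integral_mono ennreal_leI)
    fix t
    obtain i where i: "b = axis i 1" using b by (auto simp: Basis_vec_def)
    have "\<bar>frechet_derivative u (at y) b\<bar> \<le> norm (cgrad u y)" for y
      using component_le_norm_cart[of "cgrad u y" i] by (simp add: cgrad_def i)
    moreover have "\<bar>sgn x\<bar> \<le> (1::real)" for x by (simp add: sgn_if)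
    ultimately have "\<bar>d t\<bar> \<le> s * (1 * \<bar>u (z + t *\<^sub>R b)\<bar> powr (s - 1)) * norm (cgrad u (z + t *\<^sub>R b))"
      unfolding d_def abs_mult using s by (intro mult_mono) auto
    moreover have "norm (indicator {T..0} t *\<^sub>R d t) \<le> \<bar>d t\<bar>" by (simp add: indicator_def)
    ultimately show "norm (indicator {T..0} t *\<^sub>R d t) \<le> s * \<bar>u (z + t *\<^sub>R b)\<bar> powr (s - 1) * norm (cgrad u (z + t *\<^sub>R b))"
      by simp
  qed
  finally show ?thesis .
qed

text \<open>Gagliardo's inequality is applied to |u|^\<gamma>, and Hoelder's inequality separates u
  from its gradient. The exponent \<gamma> is chosen so that the powers of u arising on both sides
  are the same, namely \<open>pstar\<close>; the u-integral on the right has a smaller power and can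
  be divided out.\<close>

lemma Sobolev_pstar:
  fixes u :: "real^'n \<Rightarrow> real"
  assumes u: "u \<in> Cc_1 UNIV" and P: "1 < P" "P < real CARD('n)" and N: "2 \<le> CARD('n)"
  defines "N \<equiv> real CARD('n)"
  defines "\<gamma> \<equiv> P * (N - 1) / (N - P)"
  shows "(\<integral>\<^sup>+x. ennreal (\<bar>u x\<bar> powr pstar N P) \<partial>lborel)
    \<le> ennreal ((\<gamma> * (LINT x|lborel. norm (cgrad u x) powr P) powr (1 / P)) powr pstar N P)"
proof -
  define \<kappa> where "\<kappa> = 1 / (N - 1)"
  have N1: "1 < N" "P < N" using P(2) N by (auto simp: N_def)
  have g1: "1 < \<gamma>"
  proof -
    have "N - P < P * (N - 1)" using P(1) N1 by (simp add: algebra_simps)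
    then show ?thesis using N1 by (simp add: \<gamma>_def)
  qed
  define r where "r = pstar N P"
  have r_def': "r = N * P / (N - P)" by (simp add: r_def pstar_def)
  have r0: "0 < r" using P(1) N1 by (simp add: r_def')
  have \<kappa>: "0 < \<kappa>" "\<gamma> * (1 + \<kappa>) = r" "\<gamma> * \<kappa> * N = r"
    using N1 by (auto simp: \<kappa>_def \<gamma>_def r_def' divide_simps)
  \<comment> \<open>This identity characterises \<gamma>: the conjugate exponent P/(P - 1) turns
    |u|^(\<gamma> - 1) into |u|^r.\<close>
  have gr: "\<gamma> - 1 = r * (1 - 1 / P)"
    using N1 P(1) by (simp add: \<gamma>_def r_def' divide_simps) (simp add: algebra_simps)
  obtain K where K: "compact K" "\<And>x. x \<notin> K \<Longrightarrow> u x = 0" and g0: "\<And>x. x \<notin> K \<Longrightarrow> cgrad u x = 0"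
    using Cc_1_support[OF u] by blast
  have cu: "continuous_on UNIV u" by (rule Cc_1_D(1)[OF u])
  have cg: "continuous_on UNIV (cgrad u)" by (rule Cc_1_continuous_cgrad[OF u])
  have [measurable]: "u \<in> borel_measurable borel" "cgrad u \<in> borel_measurable borel"
    using cu cg by (auto intro: borel_measurable_continuous_onI)
  have iX: "integrable lborel (\<lambda>x. \<bar>u x\<bar> powr r)"
    using r0 K(2) by (intro integrable_continuous_compact_support[OF _ K(1)] continuous_on_powr' continuous_intros cu) auto
  have iY: "integrable lborel (\<lambda>x. norm (cgrad u x) powr P)"
    using P(1) g0 by (intro integrable_continuous_compact_support[OF _ K(1)] continuous_on_powr' continuous_intros cg) auto
  have iZ: "integrable lborel (\<lambda>x. \<bar>u x\<bar> powr (\<gamma> - 1) * norm (cgrad u x))"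
    using g1 g0 by (intro integrable_continuous_compact_support[OF _ K(1)] continuous_on_powr' continuous_intros cg cu) auto
  define X where "X = (LINT x|lborel. \<bar>u x\<bar> powr r)"
  define Y where "Y = (LINT x|lborel. norm (cgrad u x) powr P)"
  define Z where "Z = (LINT x|lborel. \<bar>u x\<bar> powr (\<gamma> - 1) * norm (cgrad u x))"
  have nn: "0 \<le> X" "0 \<le> Y" "0 \<le> Z" by (auto simp: X_def Y_def Z_def)
  have eX: "(\<integral>\<^sup>+x. ennreal (\<bar>u x\<bar> powr r) \<partial>lborel) = ennreal X"
    using iX by (simp add: X_def nn_integral_eq_integral)
  have eY: "(\<integral>\<^sup>+x. ennreal (norm (cgrad u x) powr P) \<partial>lborel) = ennreal Y"
    using iY by (simp add: Y_def nn_integral_eq_integral)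
  have eZ: "(\<integral>\<^sup>+x. ennreal (\<bar>u x\<bar> powr (\<gamma> - 1) * norm (cgrad u x)) \<partial>lborel) = ennreal Z"
    using iZ by (simp add: Z_def nn_integral_eq_integral)
  define f where "f z = ennreal (\<gamma> * \<bar>u z\<bar> powr (\<gamma> - 1) * norm (cgrad u z))" for z
  have f [measurable]: "f \<in> borel_measurable borel" unfolding f_def by measurable
  have ef: "(\<integral>\<^sup>+z. f z \<partial>lborel) = ennreal (\<gamma> * Z)"
  proof -
    have "(\<integral>\<^sup>+z. f z \<partial>lborel) = (\<integral>\<^sup>+z. ennreal \<gamma> * ennreal (\<bar>u z\<bar> powr (\<gamma> - 1) * norm (cgrad u z)) \<partial>lborel)"
      using g1 by (simp add: f_def ennreal_mult'[symmetric] mult.assoc)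
    also have "\<dots> = ennreal \<gamma> * ennreal Z" by (subst nn_integral_cmult) (auto simp: eZ)
    finally show ?thesis using g1 nn by (simp add: ennreal_mult')
  qed
  have dim: "DIM(real^'n) = CARD('n)" by simp
  have "ennreal X = (\<integral>\<^sup>+x. ennreal (\<bar>u x\<bar> powr r) \<partial>lborel)" by (simp add: eX)
  also have "\<dots> \<le> (\<integral>\<^sup>+z. (\<Prod>b\<in>Basis. epow (\<integral>\<^sup>+t. f (z + t *\<^sub>R b) \<partial>lborel) \<kappa>) \<partial>lborel)"
  proof (intro nn_integral_mono)
    fix z
    have "ennreal (\<bar>u z\<bar> powr r) = (\<Prod>b\<in>(Basis::(real^'n) set). epow (ennreal (\<bar>u z\<bar> powr \<gamma>)) \<kappa>)"
    proof -
      have "(\<bar>u z\<bar> powr (\<gamma> * \<kappa>)) ^ CARD('n) = (\<bar>u z\<bar> powr (\<gamma> * \<kappa>)) powr N"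
        by (cases "u z = 0") (simp_all add: powr_realpow N_def)
      then show ?thesis
        using \<kappa> by (simp add: epow_ennreal powr_powr ennreal_power)
    qed
    also have "\<dots> \<le> (\<Prod>b\<in>Basis. epow (\<integral>\<^sup>+t. f (z + t *\<^sub>R b) \<partial>lborel) \<kappa>)"
      using \<kappa>(1) unfolding f_def by (intro prod_mono_ennreal epow_mono abs_powr_le_line_integral[OF u g1]) auto
    finally show "ennreal (\<bar>u z\<bar> powr r) \<le> (\<Prod>b\<in>Basis. epow (\<integral>\<^sup>+t. f (z + t *\<^sub>R b) \<partial>lborel) \<kappa>)" .
  qed
  also have "\<dots> \<le> epow (\<integral>\<^sup>+z. f z \<partial>lborel) (1 + \<kappa>)"
    using Gagliardo_lborel[OF f] N unfolding dim \<kappa>_def N_def by simp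
  also have "\<dots> = ennreal ((\<gamma> * Z) powr (1 + \<kappa>))"
    using g1 nn \<kappa> by (simp add: ef epow_ennreal)
  finally have XZ: "X \<le> (\<gamma> * Z) powr (1 + \<kappa>)" by (simp add: nn ennreal_le_iff)
  have ZXY: "Z \<le> X powr (1 - 1 / P) * Y powr (1 / P)"
  proof -
    \<comment> \<open>The classical two-factor inequality is the indexed one over the type
      \<open>bool\<close>.\<close>
    define g where "g b x = (if b then ennreal (\<bar>u x\<bar> powr r) else ennreal (norm (cgrad u x) powr P))" for b x
    define \<theta> where "\<theta> b = (if b then 1 - 1 / P else 1 / P)" for b
    have P': "1 - 1 / P > 0" using P(1) by simp
    have "ennreal Z = (\<integral>\<^sup>+x. (\<Prod>b\<in>UNIV. epow (g b x) (\<theta> b)) \<partial>lborel)"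
      unfolding eZ[symmetric]
      using P P' by (intro nn_integral_cong)
         (simp add: UNIV_bool g_def \<theta>_def epow_ennreal powr_powr gr ennreal_mult'[symmetric] mult.commute)
    also have "\<dots> \<le> (\<Prod>b\<in>UNIV. epow (\<integral>\<^sup>+x. g b x \<partial>lborel) (\<theta> b))"
      using P P' by (intro nn_integral_Holder) (auto simp: UNIV_bool \<theta>_def g_def)
    also have "\<dots> = ennreal (X powr (1 - 1 / P) * Y powr (1 / P))"
      using P P' nn by (simp add: UNIV_bool \<theta>_def g_def eX eY epow_ennreal ennreal_mult'[symmetric] mult.commute)
    finally show ?thesis by (simp add: ennreal_le_iff)
  qed
  \<comment> \<open>X is finite because u has compact support, so X^e can be cancelled; e + (1 +
    \<kappa>)/r = 1 leaves the power (1 + \<kappa>)/r of X.\<close>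
  have "X \<le> (\<gamma> * Y powr (1 / P)) powr r"
  proof (cases "X = 0")
    case False
    then have X: "0 < X" using nn by simp
    define A where "A = \<gamma> * Y powr (1 / P)"
    have A: "0 \<le> A" using g1 by (simp add: A_def)
    define e where "e = (1 - 1 / P) * (1 + \<kappa>)"
    have e: "e + (1 + \<kappa>) / r = 1"
      using N1 P(1) by (simp add: e_def \<kappa>_def r_def' divide_simps) (simp add: algebra_simps)
    have "X \<le> (A * X powr (1 - 1 / P)) powr (1 + \<kappa>)"
      using XZ ZXY g1 nn \<kappa>(1) by (elim order_trans) (auto intro!: powr_mono2 simp: A_def mult_ac)
    also have "\<dots> = A powr (1 + \<kappa>) * X powr e"
      using A X by (simp add: powr_mult powr_powr e_def)
    finally have "X powr e * X powr ((1 + \<kappa>) / r) \<le> X powr e * A powr (1 + \<kappa>)"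
      using X e by (simp add: powr_add[symmetric] mult.commute)
    then have "X powr ((1 + \<kappa>) / r) \<le> A powr (1 + \<kappa>)" using X by simp
    then have "(X powr ((1 + \<kappa>) / r)) powr (r / (1 + \<kappa>)) \<le> (A powr (1 + \<kappa>)) powr (r / (1 + \<kappa>))"
      using r0 \<kappa>(1) by (intro powr_mono2) auto
    then show ?thesis using r0 \<kappa>(1) X by (simp add: powr_powr A_def)
  qed simp
  then show ?thesis using eX unfolding r_def Y_def by (simp add: ennreal_leI)
qed

section \<open>Finsler--Minkowski norms\<close>

lemma frechet_derivative_eq_cgrad:
  fixes f :: "real^'n \<Rightarrow> real"
  assumes f: "f differentiable (at x)"
  shows "frechet_derivative f (at x) v = cgrad f x \<bullet> v"
proof -
  have lin: "linear (frechet_derivative f (at x))" by (rule linear_frechet_derivative[OF f])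
  have "v = (\<Sum>i\<in>UNIV. v $ i *\<^sub>R axis i 1)"
    using basis_expansion[of v] by (simp add: scalar_mult_eq_scaleR)
  then have "frechet_derivative f (at x) v = frechet_derivative f (at x) (\<Sum>i\<in>UNIV. v $ i *\<^sub>R axis i 1)"
    by (rule arg_cong)
  also have "\<dots> = (\<Sum>i\<in>UNIV. v $ i *\<^sub>R frechet_derivative f (at x) (axis i 1))"
    by (simp only: linear_sum[OF lin] linear_cmul[OF lin])
  also have "\<dots> = cgrad f x \<bullet> v"
    by (simp add: inner_vec_def cgrad_def mult.commute)
  finally show ?thesis .
qed

lemma fgrad_eq_cgrad: "fgrad H = cgrad H"
  by (simp add: fgrad_def cgrad_def fun_eq_iff)

lemma powr_add_le:
  fixes x y s :: real
  assumes "0 \<le> x" "0 \<le> y" "0 \<le> s"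
  shows "(x + y) powr s \<le> 2 powr s * (x powr s + y powr s)"
proof -
  have "(x + y) powr s \<le> (2 * max x y) powr s" using assms by (intro powr_mono2) auto
  also have "\<dots> = 2 powr s * (max x y powr s)" using assms by (simp add: powr_mult)
  also have "\<dots> \<le> 2 powr s * (x powr s + y powr s)" by (intro mult_left_mono) (auto simp: max_def)
  finally show ?thesis .
qed

text \<open>The exponent s - 1 is deliberately raised to s: on a domain of finite measure 1 + x^s is
  integrable as soon as x^s is, and a multiple of it then serves as a majorant.\<close>

lemma powr_pred_le:
  fixes x y s D :: real
  assumes "0 \<le> x" "0 \<le> y" "1 \<le> s" "1 \<le> D" "y \<le> D * (1 + x)"
  shows "y powr (s - 1) \<le> D powr s * (2 powr s * (1 + x powr s))"
proof -
  have "y powr (s - 1) \<le> (D * (1 + x)) powr (s - 1)" using assms by (intro powr_mono2) auto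
  also have "\<dots> \<le> (D * (1 + x)) powr s"
  proof (intro powr_mono)
    have "1 * 1 \<le> D * (1 + x)" using assms by (intro mult_mono) auto
    then show "1 \<le> D * (1 + x)" by simp
  qed simp
  also have "\<dots> = D powr s * (1 + x) powr s" using assms by (simp add: powr_mult)
  also have "\<dots> \<le> D powr s * (2 powr s * (1 + x powr s))"
    using powr_add_le[of 1 x s] assms by (intro mult_left_mono) auto
  finally show ?thesis .
qed

context
  fixes H :: "real^'n \<Rightarrow> real"
  assumes H: "finsler_minkowski H"
begin

lemma finsler_nonneg: "0 \<le> H \<xi>"
  and finsler_eq_0_iff: "H \<xi> = 0 \<longleftrightarrow> \<xi> = 0"
  and finsler_scaleR: "H (t *\<^sub>R \<xi>) = \<bar>t\<bar> * H \<xi>"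
  and finsler_smooth: "smooth_on (- {0}) H"
  using H by (auto simp: finsler_minkowski_def)

lemma finsler_zero: "H 0 = 0"
  by (simp add: finsler_eq_0_iff)

lemma finsler_differentiable: "\<xi> \<noteq> 0 \<Longrightarrow> H differentiable (at \<xi>)"
  and finsler_continuous_derivative: "continuous_on (- {0}) (\<lambda>\<xi>. frechet_derivative H (at \<xi>) v)"
  and finsler_continuous_off_0: "continuous_on (- {0}) H"
proof -
  have "Ck 1 (- {0}) H" using finsler_smooth unfolding smooth_on_def by blast
  then show "\<xi> \<noteq> 0 \<Longrightarrow> H differentiable (at \<xi>)" "continuous_on (- {0}) H"
    "continuous_on (- {0}) (\<lambda>\<xi>. frechet_derivative H (at \<xi>) v)" by auto
qed

text \<open>By homogeneity it suffices to bound H on the unit sphere, where it is continuous and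
  positive on a compact set.\<close>

lemma finsler_norm_bounds:
  obtains c C where "0 < c" "0 < C" "\<And>\<xi>. c * norm \<xi> \<le> H \<xi>" "\<And>\<xi>. H \<xi> \<le> C * norm \<xi>"
proof -
  let ?S = "sphere (0::real^'n) 1"
  have S: "compact ?S" "continuous_on ?S H"
    by (auto intro: continuous_on_subset[OF finsler_continuous_off_0])
  have "axis undefined 1 \<in> ?S" by simp
  then have ne: "?S \<noteq> {}" by blast
  obtain m where m: "m \<in> ?S" "\<And>x. x \<in> ?S \<Longrightarrow> H m \<le> H x"
    using continuous_attains_inf[OF S(1) ne S(2)] by blast
  obtain M where M: "M \<in> ?S" "\<And>x. x \<in> ?S \<Longrightarrow> H x \<le> H M"
    using continuous_attains_sup[OF S(1) ne S(2)] by blast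
  have pos: "0 < H x" if "x \<in> ?S" for x
  proof -
    have "x \<noteq> 0" using that by auto
    then show ?thesis using finsler_nonneg[of x] finsler_eq_0_iff[of x] by linarith
  qed
  have eq: "H \<xi> = norm \<xi> * H ((1 / norm \<xi>) *\<^sub>R \<xi>)" "(1 / norm \<xi>) *\<^sub>R \<xi> \<in> ?S" if "\<xi> \<noteq> 0" for \<xi>
    using that by (auto simp: finsler_scaleR)
  show ?thesis
  proof
    show "0 < H m" "0 < H M" using pos m(1) M(1) by auto
    show "H m * norm \<xi> \<le> H \<xi>" for \<xi>
    proof (cases "\<xi> = 0")
      case False
      then have "norm \<xi> * H m \<le> norm \<xi> * H ((1 / norm \<xi>) *\<^sub>R \<xi>)"
        using m(2)[OF eq(2)] by (intro mult_left_mono) auto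
      then show ?thesis using eq(1)[OF False] by (simp add: mult.commute)
    qed (simp add: finsler_nonneg)
    show "H \<xi> \<le> H M * norm \<xi>" for \<xi>
    proof (cases "\<xi> = 0")
      case False
      then have "norm \<xi> * H ((1 / norm \<xi>) *\<^sub>R \<xi>) \<le> norm \<xi> * H M"
        using M(2)[OF eq(2)] by (intro mult_left_mono) auto
      then show ?thesis using eq(1)[OF False] by (simp add: mult.commute)
    qed (simp add: finsler_zero)
  qed
qed

text \<open>Comparison with the Euclidean norm gives subadditivity up to the factor C / c, which the
  later estimates absorb into their constants.\<close>

lemma finsler_quasi_triangle:
  obtains Q where "1 \<le> Q" "\<And>\<xi> \<eta>. H (\<xi> + \<eta>) \<le> Q * (H \<xi> + H \<eta>)"
proof -
  obtain c C where c: "0 < c" "0 < C" "\<And>\<xi>. c * norm \<xi> \<le> H \<xi>" "\<And>\<xi>. H \<xi> \<le> C * norm \<xi>"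
    using finsler_norm_bounds by blast
  have "H (\<xi> + \<eta>) \<le> max 1 (C / c) * (H \<xi> + H \<eta>)" for \<xi> \<eta>
  proof -
    have "H (\<xi> + \<eta>) \<le> C * (norm \<xi> + norm \<eta>)"
      using c(2) by (intro order_trans[OF c(4)] mult_left_mono norm_triangle_ineq) auto
    also have "\<dots> = (C / c) * (c * norm \<xi> + c * norm \<eta>)"
      using c(1) by (simp add: field_simps)
    also have "\<dots> \<le> (C / c) * (H \<xi> + H \<eta>)" using c by (intro mult_left_mono add_mono) auto
    also have "\<dots> \<le> max 1 (C / c) * (H \<xi> + H \<eta>)" using finsler_nonneg by (intro mult_right_mono) auto
    finally show ?thesis .
  qed
  then show ?thesis by (intro that[of "max 1 (C / c)"]) auto
qed

lemma finsler_continuous: "continuous_on UNIV H"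
proof -
  obtain c C where c: "0 < C" "\<And>\<xi>. H \<xi> \<le> C * norm \<xi>" using finsler_norm_bounds by metis
  have "continuous (at \<xi>) H" for \<xi>
  proof (cases "\<xi> = 0")
    case False
    have "open (- {0::real^'n})" by (intro open_Compl closed_singleton)
    then show ?thesis using False finsler_continuous_off_0 continuous_on_eq_continuous_at by blast
  next
    case True
    have "((\<lambda>\<xi>::real^'n. C * norm \<xi>) \<longlongrightarrow> C * norm (0::real^'n)) (at 0)"
      by (rule tendsto_mult[OF tendsto_const tendsto_norm[OF tendsto_ident_at]])
    then have "((\<lambda>\<xi>::real^'n. C * norm \<xi>) \<longlongrightarrow> 0) (at 0)" by simp
    then have "(H \<longlongrightarrow> 0) (at 0)"
      by (rule Lim_null_comparison[rotated]) (use c(2) finsler_nonneg in auto)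
    then show ?thesis using True finsler_zero by (simp add: continuous_at)
  qed
  then show ?thesis by (simp add: continuous_at_imp_continuous_on)
qed

lemma finsler_measurable: "H \<in> borel_measurable borel"
  by (intro borel_measurable_continuous_onI finsler_continuous)

lemma finsler_fgrad_measurable: "fgrad H \<in> borel_measurable borel"
proof -
  have c: "continuous_on (- {0}) (fgrad H)"
    unfolding fgrad_def by (intro continuous_on_vec_lambda finsler_continuous_derivative)
  \<comment> \<open>At 0 \<open>fgrad H\<close> has some unspecified value; altering a function at
    one point does not affect Borel measurability.\<close>
  have "(\<lambda>\<xi>. if \<xi> \<in> - {0} then fgrad H \<xi> else fgrad H 0) \<in> borel_measurable borel"
    by (intro borel_measurable_continuous_on_if[OF _ c]) auto
  moreover have "(\<lambda>\<xi>. if \<xi> \<in> - {0} then fgrad H \<xi> else fgrad H 0) = fgrad H" by auto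
  ultimately show ?thesis by simp
qed

lemma finsler_derivative_homogeneous:
  assumes t: "0 < t" and \<xi>: "\<xi> \<noteq> 0"
  shows "frechet_derivative H (at (t *\<^sub>R \<xi>)) v = frechet_derivative H (at \<xi>) v"
proof -
  have "t *\<^sub>R \<xi> \<noteq> 0" using t \<xi> by simp
  then have D: "(H has_derivative frechet_derivative H (at (t *\<^sub>R \<xi>))) (at (t *\<^sub>R \<xi>))"
    using finsler_differentiable frechet_derivative_works by blast
  have "((\<lambda>x. t *\<^sub>R x) has_derivative (\<lambda>v. t *\<^sub>R v)) (at \<xi>)" by (auto intro!: derivative_eq_intros)
  from has_derivative_compose[OF this D]
  have "((\<lambda>x. (1 / t) * H (t *\<^sub>R x)) has_derivative
      (\<lambda>v. (1 / t) * frechet_derivative H (at (t *\<^sub>R \<xi>)) (t *\<^sub>R v))) (at \<xi>)"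
    by (rule has_derivative_mult_right)
  moreover have "(1 / t) * H (t *\<^sub>R x) = H x" for x using t by (simp add: finsler_scaleR)
  moreover have "(1 / t) * frechet_derivative H (at (t *\<^sub>R \<xi>)) (t *\<^sub>R v) = frechet_derivative H (at (t *\<^sub>R \<xi>)) v" for v
    using t linear_cmul[OF has_derivative_linear[OF D]] by simp
  ultimately have "(H has_derivative frechet_derivative H (at (t *\<^sub>R \<xi>))) (at \<xi>)" by simp
  then show ?thesis using frechet_derivative_at by metis
qed

text \<open>The gradient is homogeneous of degree 0 under positive scaling, so all its values off 0
  are attained on the compact unit sphere.\<close>

lemma finsler_fgrad_bound:
  obtains G where "0 < G" "\<And>\<xi>. \<xi> \<noteq> 0 \<Longrightarrow> norm (fgrad H \<xi>) \<le> G"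
proof -
  have "continuous_on (- {0}) (fgrad H)"
    unfolding fgrad_def by (intro continuous_on_vec_lambda finsler_continuous_derivative)
  then have "continuous_on (sphere 0 1) (fgrad H)"
    by (rule continuous_on_subset) auto
  from compact_imp_bounded[OF compact_continuous_image[OF this compact_sphere]]
  obtain G where G: "0 < G" "\<And>x. x \<in> sphere 0 1 \<Longrightarrow> norm (fgrad H x) \<le> G"
    by (auto simp: bounded_pos)
  have "norm (fgrad H \<xi>) \<le> G" if "\<xi> \<noteq> 0" for \<xi>
  proof -
    have "fgrad H \<xi> = fgrad H ((1 / norm \<xi>) *\<^sub>R \<xi>)"
      using that by (simp add: fgrad_def vec_eq_iff finsler_derivative_homogeneous)
    then show ?thesis using G(2)[of "(1 / norm \<xi>) *\<^sub>R \<xi>"] that by simp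
  qed
  then show ?thesis using G(1) that by blast
qed

text \<open>For s > 1 the power removes the singularity of H at 0: there H^s is of order |h|^s, and
  the factor H^(s - 1) = 0 in the formula cancels the unspecified value of
  \<open>fgrad H 0\<close>.\<close>

lemma finsler_powr_has_derivative:
  assumes s: "1 < s"
  shows "((\<lambda>\<xi>. H \<xi> powr s) has_derivative (\<lambda>v. s * (H \<xi> powr (s - 1) * (fgrad H \<xi> \<bullet> v)))) (at \<xi>)"
proof (cases "\<xi> = 0")
  case False
  have "(H has_derivative (\<lambda>v. fgrad H \<xi> \<bullet> v)) (at \<xi>)"
  proof -
    have "frechet_derivative H (at \<xi>) = (\<lambda>v. fgrad H \<xi> \<bullet> v)"
      using frechet_derivative_eq_cgrad[OF finsler_differentiable[OF False]] by (auto simp: fgrad_eq_cgrad)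
    then show ?thesis
      using finsler_differentiable[OF False] by (simp add: frechet_derivative_works)
  qed
  moreover have "0 < H \<xi>" using finsler_nonneg[of \<xi>] finsler_eq_0_iff[of \<xi>] False by linarith
  ultimately show ?thesis
    by (auto intro!: derivative_eq_intros simp: powr_diff field_simps)
next
  case True
  obtain c C where C: "0 < C" "\<And>\<xi>. H \<xi> \<le> C * norm \<xi>" using finsler_norm_bounds by metis
  have "((\<lambda>h::real^'n. C powr s * norm h powr (s - 1)) \<longlongrightarrow> C powr s * norm (0::real^'n) powr (s - 1)) (at 0)"
    using s by (intro tendsto_intros tendsto_powr') auto
  then have "((\<lambda>h::real^'n. C powr s * norm h powr (s - 1)) \<longlongrightarrow> 0) (at 0)" using s by simp
  then have "((\<lambda>h. (H (0 + h) powr s - H 0 powr s) /\<^sub>R norm h) \<longlongrightarrow> 0) (at 0)"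
  proof (rule Lim_null_comparison[rotated], intro always_eventually allI)
    fix h :: "real^'n"
    have "H h powr s \<le> (C * norm h) powr s" using s C finsler_nonneg by (intro powr_mono2) auto
    also have "\<dots> = C powr s * norm h powr s" using C(1) by (simp add: powr_mult)
    finally show "norm ((H (0 + h) powr s - H 0 powr s) /\<^sub>R norm h) \<le> C powr s * norm h powr (s - 1)"
      using s finsler_zero by (cases "h = 0") (auto simp: powr_diff field_simps)
  qed
  then show ?thesis using True s finsler_zero by (simp add: has_derivative_at divide_inverse mult.commute)
qed

lemma finsler_flux_bound:
  assumes s: "1 < s"
  obtains K where "0 < K" "\<And>\<xi> v. \<bar>H \<xi> powr (s - 1) * (fgrad H \<xi> \<bullet> v)\<bar> \<le> K * (norm v * (1 + H \<xi>) powr (s - 1))"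
proof -
  obtain G where G: "0 < G" "\<And>\<xi>. \<xi> \<noteq> 0 \<Longrightarrow> norm (fgrad H \<xi>) \<le> G" using finsler_fgrad_bound by blast
  have "\<bar>H \<xi> powr (s - 1) * (fgrad H \<xi> \<bullet> v)\<bar> \<le> G * (norm v * (1 + H \<xi>) powr (s - 1))" for \<xi> v
  proof (cases "\<xi> = 0")
    case True
    then show ?thesis using G(1) finsler_zero by simp
  next
    case False
    have "\<bar>fgrad H \<xi> \<bullet> v\<bar> \<le> G * norm v"
      using G(2)[OF False] by (intro order_trans[OF Cauchy_Schwarz_ineq2] mult_right_mono) auto
    moreover have "H \<xi> powr (s - 1) \<le> (1 + H \<xi>) powr (s - 1)"
      using s finsler_nonneg by (intro powr_mono2) auto
    ultimately have "H \<xi> powr (s - 1) * \<bar>fgrad H \<xi> \<bullet> v\<bar> \<le> (1 + H \<xi>) powr (s - 1) * (G * norm v)"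
      by (intro mult_mono) auto
    then show ?thesis by (simp add: abs_mult mult_ac)
  qed
  then show ?thesis using G(1) that by blast
qed

text \<open>The mean value theorem on the segment from xi to xi + t eta, with a derivative bound
  that involves xi alone. The first estimate is the domination hypothesis of
  \<open>has_real_derivative_integral\<close>; the second bounds the flux when limits of test
  functions are taken.\<close>

lemma finsler_powr_diff_bound:
  assumes s: "1 < s" and B: "0 \<le> B"
  obtains K where "0 < K"
    "\<And>\<xi> \<eta> t. norm \<eta> \<le> B \<Longrightarrow> \<bar>t\<bar> \<le> 1 \<Longrightarrow> \<bar>H (\<xi> + t *\<^sub>R \<eta>) powr s - H \<xi> powr s\<bar> \<le> \<bar>t\<bar> * (K * (1 + H \<xi> powr s))"
    "\<And>\<xi> \<eta>. norm \<eta> \<le> B \<Longrightarrow> \<bar>H \<xi> powr (s - 1) * (fgrad H \<xi> \<bullet> \<eta>)\<bar> \<le> K * (1 + H \<xi> powr s)"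
proof -
  obtain L where L: "0 < L" "\<And>\<xi> v. \<bar>H \<xi> powr (s - 1) * (fgrad H \<xi> \<bullet> v)\<bar> \<le> L * (norm v * (1 + H \<xi>) powr (s - 1))"
    using finsler_flux_bound[OF s] by blast
  obtain Q where Q: "1 \<le> Q" "\<And>\<xi> \<eta>. H (\<xi> + \<eta>) \<le> Q * (H \<xi> + H \<eta>)" using finsler_quasi_triangle by blast
  obtain c C where C: "0 < C" "\<And>\<xi>. H \<xi> \<le> C * norm \<xi>" using finsler_norm_bounds by metis
  \<comment> \<open>D is the constant in H(xi + tau eta) <= D (1 + H xi) for |tau| <= 1 and |eta| <=
    B.\<close>
  define D where "D = Q * (1 + C * B)"
  have "1 * 1 \<le> Q * (1 + C * B)" using Q(1) C(1) B by (intro mult_mono) auto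
  then have D: "1 \<le> D" by (simp add: D_def)
  define K0 where "K0 = L * (B * ((1 + D) powr s * 2 powr s))"
  have K0: "0 \<le> K0" using L(1) B by (simp add: K0_def)
  have step: "\<bar>H (\<xi> + \<tau> *\<^sub>R \<eta>) powr (s - 1) * (fgrad H (\<xi> + \<tau> *\<^sub>R \<eta>) \<bullet> \<eta>)\<bar> \<le> K0 * (1 + H \<xi> powr s)"
    if \<eta>: "norm \<eta> \<le> B" and \<tau>: "\<bar>\<tau>\<bar> \<le> 1" for \<xi> \<eta> \<tau>
  proof -
    have "H (\<xi> + \<tau> *\<^sub>R \<eta>) \<le> Q * (H \<xi> + \<bar>\<tau>\<bar> * H \<eta>)" using Q(2)[of \<xi> "\<tau> *\<^sub>R \<eta>"] by (simp add: finsler_scaleR)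
    also have "\<bar>\<tau>\<bar> * H \<eta> \<le> 1 * (C * B)"
      using \<tau> C \<eta> finsler_nonneg by (intro mult_mono order_trans[OF C(2)]) auto
    also have "Q * (H \<xi> + 1 * (C * B)) \<le> D * (1 + H \<xi>)"
    proof -
      have "0 \<le> C * B * H \<xi>" using C(1) B finsler_nonneg by simp
      then have "H \<xi> + C * B \<le> (1 + C * B) * (1 + H \<xi>)" by (simp add: algebra_simps)
      then show ?thesis using Q(1) by (simp add: D_def mult.assoc)
    qed
    finally have "H (\<xi> + \<tau> *\<^sub>R \<eta>) \<le> D * (1 + H \<xi>)" using Q(1) by (auto simp: mult_left_mono)
    then have "1 + H (\<xi> + \<tau> *\<^sub>R \<eta>) \<le> (1 + D) * (1 + H \<xi>)"
      using finsler_nonneg[of \<xi>] by (simp add: algebra_simps)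
    then have "(1 + H (\<xi> + \<tau> *\<^sub>R \<eta>)) powr (s - 1) \<le> (1 + D) powr s * (2 powr s * (1 + H \<xi> powr s))"
      using s D finsler_nonneg by (intro powr_pred_le) auto
    then have "L * (norm \<eta> * (1 + H (\<xi> + \<tau> *\<^sub>R \<eta>)) powr (s - 1)) \<le> L * (B * ((1 + D) powr s * (2 powr s * (1 + H \<xi> powr s))))"
      using L(1) \<eta> B by (intro mult_left_mono mult_mono) auto
    then show ?thesis using L(2)[of "\<xi> + \<tau> *\<^sub>R \<eta>" \<eta>] by (simp add: K0_def mult_ac)
  qed
  show ?thesis
  proof
    \<comment> \<open>One constant serves both estimates, as it exceeds K0 and s K0; the summand 1
      keeps it positive when B = 0.\<close>
    show "0 < s * K0 + 1" using s K0 by (simp add: add_nonneg_pos)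
    have K0le: "s * K0 * (1 + H \<xi> powr s) \<le> (s * K0 + 1) * (1 + H \<xi> powr s)" 
       "K0 * (1 + H \<xi> powr s) \<le> (s * K0 + 1) * (1 + H \<xi> powr s)" for \<xi>
    proof -
      have "1 * K0 \<le> s * K0" using s K0 by (intro mult_right_mono) auto
      then show "s * K0 * (1 + H \<xi> powr s) \<le> (s * K0 + 1) * (1 + H \<xi> powr s)" 
       "K0 * (1 + H \<xi> powr s) \<le> (s * K0 + 1) * (1 + H \<xi> powr s)"
        by (auto intro!: mult_right_mono simp: add_nonneg_nonneg)
    qed
    fix \<xi> \<eta> :: "real^'n" assume \<eta>: "norm \<eta> \<le> B"
    show "\<bar>H \<xi> powr (s - 1) * (fgrad H \<xi> \<bullet> \<eta>)\<bar> \<le> (s * K0 + 1) * (1 + H \<xi> powr s)"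
      using step[OF \<eta>, of 0 \<xi>] K0le(2)[of \<xi>] by simp
    fix t :: real assume t: "\<bar>t\<bar> \<le> 1"
    have "norm (H (\<xi> + t *\<^sub>R \<eta>) powr s - H (\<xi> + 0 *\<^sub>R \<eta>) powr s) \<le> (s * K0 * (1 + H \<xi> powr s)) * norm (t - 0)"
    proof (rule field_differentiable_bound[of "{-1..1}" "\<lambda>\<tau>. H (\<xi> + \<tau> *\<^sub>R \<eta>) powr s"
        "\<lambda>\<tau>. s * (H (\<xi> + \<tau> *\<^sub>R \<eta>) powr (s - 1) * (fgrad H (\<xi> + \<tau> *\<^sub>R \<eta>) \<bullet> \<eta>))"])
      fix \<tau> :: real assume \<tau>: "\<tau> \<in> {-1..1}"
      show "((\<lambda>\<tau>. H (\<xi> + \<tau> *\<^sub>R \<eta>) powr s) has_field_derivative s * (H (\<xi> + \<tau> *\<^sub>R \<eta>) powr (s - 1) * (fgrad H (\<xi> + \<tau> *\<^sub>R \<eta>) \<bullet> \<eta>))) (at \<tau> within {-1..1})"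
        by (rule has_field_derivative_at_within[OF has_real_derivative_along_line[OF finsler_powr_has_derivative[OF s]]])
      have "s * \<bar>H (\<xi> + \<tau> *\<^sub>R \<eta>) powr (s - 1) * (fgrad H (\<xi> + \<tau> *\<^sub>R \<eta>) \<bullet> \<eta>)\<bar> \<le> s * (K0 * (1 + H \<xi> powr s))"
        using \<tau> s by (intro mult_left_mono step[OF \<eta>]) auto
      then show "norm (s * (H (\<xi> + \<tau> *\<^sub>R \<eta>) powr (s - 1) * (fgrad H (\<xi> + \<tau> *\<^sub>R \<eta>) \<bullet> \<eta>))) \<le> s * K0 * (1 + H \<xi> powr s)"
        using s by (simp add: abs_mult mult.assoc)
    qed (use t in auto)
    then have "\<bar>H (\<xi> + t *\<^sub>R \<eta>) powr s - H \<xi> powr s\<bar> \<le> \<bar>t\<bar> * (s * K0 * (1 + H \<xi> powr s))" by (simp add: mult.commute)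
    also have "\<dots> \<le> \<bar>t\<bar> * ((s * K0 + 1) * (1 + H \<xi> powr s))"
      using K0le(1) by (intro mult_left_mono) auto
    finally show "\<bar>H (\<xi> + t *\<^sub>R \<eta>) powr s - H \<xi> powr s\<bar> \<le> \<bar>t\<bar> * ((s * K0 + 1) * (1 + H \<xi> powr s))" .
  qed
qed

end

section \<open>The double phase Luxemburg functional\<close>

lemma LINT_eq_lebesgue_on:
  fixes f :: "'a::euclidean_space \<Rightarrow> real"
  shows "\<Omega> \<in> sets lebesgue \<Longrightarrow> (LINT x:\<Omega>|lebesgue. f x) = (LINT x|lebesgue_on \<Omega>. f x)"
  unfolding set_lebesgue_integral_def by (subst integral_restrict_space) auto

lemma set_integrable_eq_lebesgue_on:
  fixes f :: "'a::euclidean_space \<Rightarrow> real"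
  shows "\<Omega> \<in> sets lebesgue \<Longrightarrow> set_integrable lebesgue \<Omega> f \<longleftrightarrow> integrable (lebesgue_on \<Omega>) f"
  unfolding set_integrable_def by (subst integrable_restrict_space) auto

text \<open>Weak differentiability provides integrability on compact subsets only. Measurability on
  the whole domain is pieced together from countably many closed boxes.\<close>

lemma borel_measurable_lebesgue_on_locally_integrable:
  fixes f :: "'a::euclidean_space \<Rightarrow> real"
  assumes \<Omega>: "open \<Omega>" and f: "\<And>K. compact K \<Longrightarrow> K \<subseteq> \<Omega> \<Longrightarrow> set_integrable lebesgue K f"
  shows "f \<in> borel_measurable (lebesgue_on \<Omega>)"
proof -
  obtain \<D> where D: "countable \<D>" "\<D> \<subseteq> Pow \<Omega>" "\<And>X. X \<in> \<D> \<Longrightarrow> \<exists>a b. X = cbox a b" "\<Union>\<D> = \<Omega>"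
    using open_countable_Union_open_cbox[OF \<Omega>] by metis
  have leb: "X \<in> sets lebesgue" if "X \<in> \<D>" for X using D(3)[OF that] by auto
  show ?thesis
  proof (rule measurable_piecewise_restrict[OF D(1)])
    fix X assume X: "X \<in> \<D>"
    have sub: "X \<subseteq> \<Omega>" using X D(2) by auto
    show "X \<inter> space (lebesgue_on \<Omega>) \<in> sets (lebesgue_on \<Omega>)"
      using leb[OF X] \<Omega> by (auto simp: sets_restrict_space)
    have "compact X" using D(3)[OF X] compact_cbox by auto
    then have "integrable (lebesgue_on X) f"
      using f[OF _ sub] leb[OF X] by (simp add: set_integrable_eq_lebesgue_on)
    moreover have "restrict_space (lebesgue_on \<Omega>) X = lebesgue_on X"
      using \<Omega> leb[OF X] sub by (subst restrict_restrict_space) (auto simp: Int_absorb1)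
    ultimately show "f \<in> borel_measurable (restrict_space (lebesgue_on \<Omega>) X)" by simp
  qed (use D in simp)
qed

lemma weak_grad_measurable:
  fixes u :: "real^'n \<Rightarrow> real"
  assumes \<Omega>: "open \<Omega>" and g: "weak_grad \<Omega> u g"
  shows "g \<in> borel_measurable (lebesgue_on \<Omega>)"
proof (rule borel_measurable_euclidean_space[THEN iffD2], rule ballI)
  fix b :: "real^'n" assume "b \<in> Basis"
  then obtain i where b: "b = axis i 1" by (auto simp: Basis_vec_def)
  have "(\<lambda>x. g x $ i) \<in> borel_measurable (lebesgue_on \<Omega>)"
    using g by (intro borel_measurable_lebesgue_on_locally_integrable[OF \<Omega>]) (auto simp: weak_grad_def)
  then show "(\<lambda>x. g x \<bullet> b) \<in> borel_measurable (lebesgue_on \<Omega>)"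
    by (simp add: b inner_axis)
qed

lemma cgrad_lincomb:
  fixes f g :: "real^'n \<Rightarrow> real"
  assumes "f differentiable (at x)" "g differentiable (at x)"
  shows "cgrad (\<lambda>x. c * f x + d * g x) x = c *\<^sub>R cgrad f x + d *\<^sub>R cgrad g x"
proof -
  have "((\<lambda>x. c * f x + d * g x) has_derivative
      (\<lambda>v. c * frechet_derivative f (at x) v + d * frechet_derivative g (at x) v)) (at x)"
    using assms by (auto intro!: derivative_eq_intros simp: frechet_derivative_works[symmetric])
  from frechet_derivative_apply[OF this] show ?thesis by (simp add: cgrad_def vec_eq_iff)
qed

lemma Cc_inf_lincomb:
  assumes "f \<in> Cc_inf \<Omega>" "g \<in> Cc_inf \<Omega>"
  shows "(\<lambda>x. c * f x + d * g x) \<in> Cc_inf \<Omega>"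
proof -
  obtain K L where K: "compact K" "K \<subseteq> \<Omega>" "\<And>x. x \<notin> K \<Longrightarrow> f x = 0"
    and L: "compact L" "L \<subseteq> \<Omega>" "\<And>x. x \<notin> L \<Longrightarrow> g x = 0"
    using assms by (auto simp: Cc_inf_def compact_supp_in_def)
  have "compact_supp_in \<Omega> (\<lambda>x. c * f x + d * g x)"
    unfolding compact_supp_in_def using K L by (intro exI[of _ "K \<union> L"]) (auto intro: compact_Un)
  moreover have "Ck k UNIV (\<lambda>x. c * f x + d * g x)" for k
    using assms by (intro Ck_add Ck_mult Ck_const) (auto simp: Cc_inf_def smooth_on_def)
  ultimately show ?thesis by (simp add: Cc_inf_def smooth_on_def)
qed

lemma continuous_imp_measurable_lebesgue_on:
  fixes f :: "'a::euclidean_space \<Rightarrow> 'b::topological_space"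
  assumes "continuous_on UNIV f" shows "f \<in> borel_measurable (lebesgue_on \<Omega>)"
  by (intro measurable_restrict_space1 continuous_imp_borel_measurable_lebesgue assms)

lemma tendsto_ennreal_0I:
  fixes f :: "'a \<Rightarrow> ennreal"
  assumes "\<And>e::real. 0 < e \<Longrightarrow> \<forall>\<^sub>F n in F. f n \<le> ennreal e"
  shows "(f \<longlongrightarrow> 0) F"
proof (rule order_tendstoI)
  fix a :: ennreal assume "0 < a"
  then obtain e where e: "0 < e" "ennreal e < a"
  proof (cases a)
    case (real r)
    then have "0 < r" using \<open>0 < a\<close> by simp
    then show thesis using real that[of "r / 2"] by (simp add: ennreal_less_iff)
  next
    case top
    then show thesis using that[of 1] by simp
  qed
  show "\<forall>\<^sub>F n in F. f n < a"
    using assms[OF e(1)] by eventually_elim (use e(2) in auto)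
qed simp

locale double_phase =
  fixes p q :: real and \<mu> :: "real^'n \<Rightarrow> real" and \<Omega> :: "(real^'n) set"
  assumes open_domain: "open \<Omega>" and bounded_domain: "bounded \<Omega>" and pq: "1 < p" "p \<le> q"
    and \<mu>_nonneg: "\<And>x. x \<in> \<Omega> \<Longrightarrow> 0 \<le> \<mu> x"
    and \<mu>_measurable [measurable]: "\<mu> \<in> borel_measurable (lebesgue_on \<Omega>)"
    and \<mu>_bounded: "\<exists>m. \<forall>x\<in>\<Omega>. \<mu> x \<le> m"
begin

abbreviation "M \<equiv> lebesgue_on \<Omega>"
abbreviation "Mod \<equiv> modular p q \<mu> \<Omega>"
abbreviation "LH \<equiv> in_LH p q \<mu> \<Omega>"
abbreviation "Lux \<equiv> lux p q \<mu> \<Omega>"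

lemma domain_lebesgue [measurable, simp]: "\<Omega> \<in> sets lebesgue"
  using open_domain by auto

lemma finite_measure_domain: "finite_measure M"
proof
  show "emeasure M (space M) \<noteq> \<infinity>"
    using fmeasurableD2[OF lmeasurable_open[OF bounded_domain open_domain]] by (simp add: emeasure_restrict_space)
qed

lemma integrable_const_domain: "integrable M (\<lambda>x. c :: real)"
  using finite_measure.integrable_const[OF finite_measure_domain] .

lemma integrable_\<mu>: "integrable M \<mu>"
proof -
  obtain m where m: "\<And>x. x \<in> \<Omega> \<Longrightarrow> \<mu> x \<le> m" using \<mu>_bounded by blast
  show ?thesis
    by (rule Bochner_Integration.integrable_bound[OF integrable_const_domain[of m]])
      (use m \<mu>_nonneg in \<open>fastforce intro!: AE_I2\<close>)+
qed

lemma modH_mono: "x \<in> \<Omega> \<Longrightarrow> 0 \<le> s \<Longrightarrow> s \<le> t \<Longrightarrow> modH p q \<mu> x s \<le> modH p q \<mu> x t"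
  unfolding modH_def using pq \<mu>_nonneg by (intro add_mono mult_left_mono powr_mono2) auto

lemma modH_nonneg: "x \<in> \<Omega> \<Longrightarrow> 0 \<le> modH p q \<mu> x t"
  using \<mu>_nonneg by (simp add: modH_def)

text \<open>Both exponents exceed 1, so shrinking the argument by s gains at least the factor s.
  This is the only form of convexity on which the Luxemburg estimates below draw.\<close>

lemma modH_scale_small:
  assumes "x \<in> \<Omega>" "0 \<le> s" "s \<le> 1" "0 \<le> t"
  shows "modH p q \<mu> x (s * t) \<le> s * modH p q \<mu> x t"
proof -
  have "s powr r \<le> s" if "1 < r" for r
    using assms that powr_mono'[of 1 r s] by (cases "s = 0") auto
  then have "s powr p * t powr p + \<mu> x * (s powr q * t powr q) \<le> s * t powr p + \<mu> x * (s * t powr q)"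
    using assms pq \<mu>_nonneg by (intro add_mono mult_left_mono mult_right_mono) auto
  then show ?thesis using assms by (simp add: modH_def powr_mult algebra_simps)
qed

lemma modH_scale_large:
  assumes "x \<in> \<Omega>" "1 \<le> s" "0 \<le> t"
  shows "modH p q \<mu> x (s * t) \<le> s powr q * modH p q \<mu> x t"
proof -
  have "s powr p \<le> s powr q" using assms pq by (intro powr_mono) auto
  then have "s powr p * t powr p + \<mu> x * (s powr q * t powr q) \<le> s powr q * t powr p + \<mu> x * (s powr q * t powr q)"
    by (intro add_mono mult_right_mono) auto
  then show ?thesis using assms by (simp add: modH_def powr_mult algebra_simps)
qed

lemma modH_max: "modH p q \<mu> x (max s t) \<le> modH p q \<mu> x s + modH p q \<mu> x t" if "x \<in> \<Omega>"
  using modH_nonneg[OF that, of s] modH_nonneg[OF that, of t] by (simp add: max_def)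

text \<open>The sum of s and t is at most twice their maximum, so (s + t)/4 is at most half of it;
  the remaining factor 1/2 is gained by \<open>modH_scale_small\<close>.\<close>

lemma modH_average:
  assumes "x \<in> \<Omega>" "0 \<le> s" "0 \<le> t"
  shows "modH p q \<mu> x ((s + t) / 4) \<le> (modH p q \<mu> x s + modH p q \<mu> x t) / 2"
proof -
  have "modH p q \<mu> x ((s + t) / 4) \<le> modH p q \<mu> x (1 / 2 * max s t)"
    using assms by (intro modH_mono) auto
  also have "\<dots> \<le> 1 / 2 * modH p q \<mu> x (max s t)" using assms by (intro modH_scale_small) auto
  also have "\<dots> \<le> (modH p q \<mu> x s + modH p q \<mu> x t) / 2" using modH_max[OF assms(1), of s t] by simp
  finally show ?thesis .
qed

lemma modH_measurable [measurable]:
  "f \<in> borel_measurable M \<Longrightarrow> (\<lambda>x. modH p q \<mu> x \<bar>f x\<bar>) \<in> borel_measurable M"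
  unfolding modH_def
  by (intro borel_measurable_add borel_measurable_times powr_real_measurable borel_measurable_abs
      borel_measurable_const \<mu>_measurable)

lemma modular_mono:
  assumes "AE x in M. \<bar>f x\<bar> \<le> \<bar>g x\<bar>" shows "Mod f \<le> Mod g"
  unfolding modular_def
proof (rule nn_integral_mono_AE)
  have "AE x in M. x \<in> space M" by (rule AE_space)
  then show "AE x in M. ennreal (modH p q \<mu> x \<bar>f x\<bar>) \<le> ennreal (modH p q \<mu> x \<bar>g x\<bar>)"
    using assms by eventually_elim (auto intro!: ennreal_leI modH_mono)
qed

lemma modular_cong_AE:
  assumes "AE x in M. f x = g x" shows "Mod f = Mod g"
  by (intro antisym modular_mono) (use assms in \<open>auto elim: eventually_mono\<close>)

lemma lux_cong_AE:
  assumes "AE x in M. f x = g x" shows "Lux f = Lux g"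
proof -
  have "Mod (\<lambda>x. f x / \<tau>) = Mod (\<lambda>x. g x / \<tau>)" for \<tau>
    using assms by (intro modular_cong_AE) (auto elim: eventually_mono)
  then show ?thesis by (simp add: lux_def)
qed

lemma modular_scale_small:
  assumes "f \<in> borel_measurable M" "0 \<le> s" "s \<le> 1"
  shows "Mod (\<lambda>x. s * f x) \<le> ennreal s * Mod f"
proof -
  have "Mod (\<lambda>x. s * f x) \<le> (\<integral>\<^sup>+x. ennreal s * ennreal (modH p q \<mu> x \<bar>f x\<bar>) \<partial>M)"
    unfolding modular_def
  proof (intro nn_integral_mono)
    fix x assume "x \<in> space M"
    then have "modH p q \<mu> x (s * \<bar>f x\<bar>) \<le> s * modH p q \<mu> x \<bar>f x\<bar>"
      using assms by (intro modH_scale_small) auto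
    then show "ennreal (modH p q \<mu> x \<bar>s * f x\<bar>) \<le> ennreal s * ennreal (modH p q \<mu> x \<bar>f x\<bar>)"
      using assms by (simp add: abs_mult ennreal_mult'[symmetric] ennreal_leI)
  qed
  also have "\<dots> = ennreal s * Mod f"
    unfolding modular_def using assms by (intro nn_integral_cmult) measurable
  finally show ?thesis .
qed

lemma in_LH_bound:
  assumes f: "LH f" and h: "h \<in> borel_measurable M" and "0 \<le> C" and le: "AE x in M. \<bar>h x\<bar> \<le> C * \<bar>f x\<bar>"
  shows "LH h"
proof -
  have fm: "f \<in> borel_measurable M" "Mod f < \<infinity>" using f by (auto simp: in_LH_def)
  define s where "s = max 1 C"
  have s: "1 \<le> s" "C \<le> s" by (auto simp: s_def)
  have "Mod h \<le> (\<integral>\<^sup>+x. ennreal (s powr q) * ennreal (modH p q \<mu> x \<bar>f x\<bar>) \<partial>M)"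
    unfolding modular_def
  proof (rule nn_integral_mono_AE)
    have "AE x in M. x \<in> space M" by (rule AE_space)
    then show "AE x in M. ennreal (modH p q \<mu> x \<bar>h x\<bar>) \<le> ennreal (s powr q) * ennreal (modH p q \<mu> x \<bar>f x\<bar>)"
      using le
    proof eventually_elim
      case (elim x)
      have "\<bar>h x\<bar> \<le> s * \<bar>f x\<bar>" using elim(2) s by (meson abs_ge_zero mult_right_mono order_trans)
      then have "modH p q \<mu> x \<bar>h x\<bar> \<le> modH p q \<mu> x (s * \<bar>f x\<bar>)"
        using elim by (intro modH_mono) auto
      also have "\<dots> \<le> s powr q * modH p q \<mu> x \<bar>f x\<bar>" using elim s by (intro modH_scale_large) auto
      finally show ?case by (simp add: ennreal_mult'[symmetric] ennreal_leI)
    qed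
  qed
  also have "\<dots> = ennreal (s powr q) * Mod f"
    unfolding modular_def using fm by (intro nn_integral_cmult) measurable
  also have "\<dots> < \<infinity>" using fm(2) by (simp add: ennreal_mult_less_top)
  finally show ?thesis using h by (simp add: in_LH_def)
qed

lemma in_LH_add_abs:
  assumes f: "LH f" and g: "LH g" shows "LH (\<lambda>x. \<bar>f x\<bar> + \<bar>g x\<bar>)"
proof -
  have m [measurable]: "f \<in> borel_measurable M" "g \<in> borel_measurable M"
    and fin: "Mod f < \<infinity>" "Mod g < \<infinity>" using f g by (auto simp: in_LH_def)
  have "Mod (\<lambda>x. max \<bar>f x\<bar> \<bar>g x\<bar>) \<le> (\<integral>\<^sup>+x. ennreal (modH p q \<mu> x \<bar>f x\<bar>) + ennreal (modH p q \<mu> x \<bar>g x\<bar>) \<partial>M)"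
    unfolding modular_def
  proof (intro nn_integral_mono)
    fix x assume "x \<in> space M"
    then show "ennreal (modH p q \<mu> x \<bar>max \<bar>f x\<bar> \<bar>g x\<bar>\<bar>) \<le> ennreal (modH p q \<mu> x \<bar>f x\<bar>) + ennreal (modH p q \<mu> x \<bar>g x\<bar>)"
      using modH_max[of x "\<bar>f x\<bar>" "\<bar>g x\<bar>"] by (simp add: modH_nonneg flip: ennreal_plus)
  qed
  also have "\<dots> = Mod f + Mod g"
    unfolding modular_def by (intro nn_integral_add) measurable
  also have "\<dots> < \<infinity>" using fin by simp
  finally have "LH (\<lambda>x. max \<bar>f x\<bar> \<bar>g x\<bar>)" by (simp add: in_LH_def)
  then show ?thesis by (rule in_LH_bound[where C = 2]) auto
qed

lemma in_LH_const: "LH (\<lambda>x. c)"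
proof -
  obtain m where m: "\<And>x. x \<in> \<Omega> \<Longrightarrow> \<mu> x \<le> m" using \<mu>_bounded by blast
  have "Mod (\<lambda>x. c) \<le> (\<integral>\<^sup>+x. ennreal (\<bar>c\<bar> powr p + \<bar>m\<bar> * \<bar>c\<bar> powr q) \<partial>M)"
    unfolding modular_def modH_def
  proof (intro nn_integral_mono ennreal_leI add_mono mult_right_mono order_refl)
    fix x assume "x \<in> space M" then show "\<mu> x \<le> \<bar>m\<bar>" using m[of x] by auto
  qed auto
  also have "\<dots> < \<infinity>"
  proof -
    interpret finite_measure M by (rule finite_measure_domain)
    have "emeasure M \<Omega> < top" using emeasure_finite[of \<Omega>] by (simp add: top.not_eq_extremum[symmetric])
    then show ?thesis by (simp add: ennreal_mult_less_top)
  qed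
  finally show ?thesis by (simp add: in_LH_def)
qed

section \<open>The Luxemburg functional as a quasi-norm\<close>

lemma lux_le: "0 < \<tau> \<Longrightarrow> Mod (\<lambda>x. f x / \<tau>) \<le> 1 \<Longrightarrow> Lux f \<le> \<tau>"
  unfolding lux_def by (intro cInf_lower bdd_belowI[of _ 0]) auto

text \<open>\<open>lux\<close> is a real \<open>Inf\<close> and says nothing about an empty set.
  Dividing f by its own modular, or by 1 if that is larger, brings the modular below 1.\<close>

lemma lux_set_nonempty:
  assumes "LH f" shows "{\<tau>. 0 < \<tau> \<and> Mod (\<lambda>x. f x / \<tau>) \<le> 1} \<noteq> {}"
proof -
  have m: "f \<in> borel_measurable M" and fin: "Mod f < \<infinity>" using assms by (auto simp: in_LH_def)
  define \<tau> where "\<tau> = max 1 (enn2real (Mod f))"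
  have \<tau>: "1 \<le> \<tau>" "enn2real (Mod f) \<le> \<tau>" by (auto simp: \<tau>_def)
  have "Mod (\<lambda>x. f x / \<tau>) \<le> ennreal (1 / \<tau>) * Mod f"
    using modular_scale_small[OF m, of "1 / \<tau>"] \<tau> by simp
  also have "\<dots> = ennreal (1 / \<tau> * enn2real (Mod f))"
  proof -
    have "Mod f = ennreal (enn2real (Mod f))" using fin by simp
    then have "ennreal (1 / \<tau>) * Mod f = ennreal (1 / \<tau>) * ennreal (enn2real (Mod f))" by (rule arg_cong)
    then show ?thesis using \<tau> by (simp only: ennreal_mult''[symmetric] enn2real_nonneg)
  qed
  also have "\<dots> \<le> 1" using \<tau> by (simp add: divide_le_eq)
  finally show ?thesis using \<tau> by (auto intro!: exI[of _ \<tau>])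
qed

lemma lux_nonneg: "LH f \<Longrightarrow> 0 \<le> Lux f"
  unfolding lux_def using lux_set_nonempty by (intro cInf_greatest) (auto simp: less_imp_le)

lemma modular_le_1:
  assumes f: "LH f" and \<tau>: "Lux f < \<tau>" shows "Mod (\<lambda>x. f x / \<tau>) \<le> 1"
proof -
  obtain \<sigma> where \<sigma>: "0 < \<sigma>" "Mod (\<lambda>x. f x / \<sigma>) \<le> 1" "\<sigma> < \<tau>"
    using cInf_lessD[OF lux_set_nonempty[OF f]] \<tau> unfolding lux_def by blast
  have "Mod (\<lambda>x. f x / \<tau>) \<le> Mod (\<lambda>x. f x / \<sigma>)"
    using \<sigma> by (intro modular_mono) (auto intro!: divide_left_mono)
  then show ?thesis using \<sigma>(2) by simp
qed

text \<open>The 4 comes from \<open>modH_average\<close>: with this divisor the modular of the sum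
  is at most the mean of two modulars that are at most 1. The bound \<open>s\<close> is strict
  because an infimum only yields admissible divisors above it.\<close>

lemma lux_add_le:
  assumes f: "LH f" "Lux f < s" and g: "LH g" "Lux g < s" and Q: "1 \<le> Q"
    and h: "AE x in M. \<bar>h x\<bar> \<le> Q * (\<bar>f x\<bar> + \<bar>g x\<bar>)"
  shows "Lux h \<le> 4 * Q * s"
proof -
  have s: "0 < s" using lux_nonneg[OF f(1)] f(2) by simp
  have [measurable]: "f \<in> borel_measurable M" "g \<in> borel_measurable M" using f g by (auto simp: in_LH_def)
  show ?thesis
  proof (rule lux_le)
    have "Mod (\<lambda>x. h x / (4 * Q * s)) \<le> Mod (\<lambda>x. (\<bar>f x / s\<bar> + \<bar>g x / s\<bar>) / 4)"
    proof (rule modular_mono)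
      show "AE x in M. \<bar>h x / (4 * Q * s)\<bar> \<le> \<bar>(\<bar>f x / s\<bar> + \<bar>g x / s\<bar>) / 4\<bar>"
        using h
      proof eventually_elim
        case (elim x)
        have "\<bar>h x / (4 * Q * s)\<bar> = \<bar>h x\<bar> / (4 * Q * s)" using Q s by simp
        also have "\<dots> \<le> (Q * (\<bar>f x\<bar> + \<bar>g x\<bar>)) / (4 * Q * s)" using elim Q s by (intro divide_right_mono) auto
        also have "\<dots> = \<bar>(\<bar>f x / s\<bar> + \<bar>g x / s\<bar>) / 4\<bar>" using Q s by (simp add: field_simps)
        finally show ?case .
      qed
    qed
    also have "\<dots> \<le> (\<integral>\<^sup>+x. ennreal (1/2) * (ennreal (modH p q \<mu> x \<bar>f x / s\<bar>) + ennreal (modH p q \<mu> x \<bar>g x / s\<bar>)) \<partial>M)"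
      unfolding modular_def
    proof (intro nn_integral_mono)
      fix x assume x: "x \<in> space M"
      then have "modH p q \<mu> x ((\<bar>f x / s\<bar> + \<bar>g x / s\<bar>) / 4) \<le> 1/2 * (modH p q \<mu> x \<bar>f x / s\<bar> + modH p q \<mu> x \<bar>g x / s\<bar>)"
        using modH_average[of x "\<bar>f x / s\<bar>" "\<bar>g x / s\<bar>"] by simp
      then have "ennreal (modH p q \<mu> x ((\<bar>f x / s\<bar> + \<bar>g x / s\<bar>) / 4)) \<le> ennreal (1/2 * (modH p q \<mu> x \<bar>f x / s\<bar> + modH p q \<mu> x \<bar>g x / s\<bar>))"
        by (rule ennreal_leI)
      also have "\<dots> = ennreal (1/2) * (ennreal (modH p q \<mu> x \<bar>f x / s\<bar>) + ennreal (modH p q \<mu> x \<bar>g x / s\<bar>))"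
        using x by (subst ennreal_mult'') (auto simp: modH_nonneg ennreal_plus)
      finally show "ennreal (modH p q \<mu> x \<bar>(\<bar>f x / s\<bar> + \<bar>g x / s\<bar>) / 4\<bar>)
          \<le> ennreal (1/2) * (ennreal (modH p q \<mu> x \<bar>f x / s\<bar>) + ennreal (modH p q \<mu> x \<bar>g x / s\<bar>))"
        by simp
    qed
    also have "\<dots> = ennreal (1/2) * (Mod (\<lambda>x. f x / s) + Mod (\<lambda>x. g x / s))"
    proof -
      have [measurable]: "(\<lambda>x. modH p q \<mu> x \<bar>f x / s\<bar>) \<in> borel_measurable M" "(\<lambda>x. modH p q \<mu> x \<bar>g x / s\<bar>) \<in> borel_measurable M"
        by (rule modH_measurable, measurable)+
      show ?thesis unfolding modular_def by (subst nn_integral_cmult, measurable, subst nn_integral_add, measurable)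
    qed
    also have "\<dots> \<le> ennreal (1/2) * (1 + 1)"
      using f g by (intro mult_left_mono add_mono modular_le_1) auto
    also have "\<dots> = ennreal (1/2 * 2)" by (subst ennreal_mult') auto
    finally show "Mod (\<lambda>x. h x / (4 * Q * s)) \<le> 1" by simp
  qed (use s Q in auto)
qed

lemma lux_scale_le:
  assumes f: "LH f" and c: "0 < c" shows "Lux (\<lambda>x. c * f x) \<le> c * Lux f"
proof -
  have "Lux (\<lambda>x. c * f x) / c \<le> s" if s: "Lux f < s" for s
  proof -
    have s0: "0 < s" using lux_nonneg[OF f] s by simp
    have "Lux (\<lambda>x. c * f x) \<le> c * s"
      using modular_le_1[OF f s] c s0 by (intro lux_le) auto
    then show ?thesis using c by (simp add: field_simps)
  qed
  then have "Lux (\<lambda>x. c * f x) / c \<le> Lux f" by (rule dense_ge)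
  then show ?thesis using c by (simp add: field_simps)
qed

text \<open>If the norm of f is below \<tau> <= 1, then the modular of f is at most \<tau> times
  that of f / \<tau>, hence at most \<tau>.\<close>

lemma lux_tendsto_imp_modular_tendsto:
  assumes f: "\<And>n. LH (f n)" and l: "(\<lambda>n. Lux (f n)) \<longlonglongrightarrow> 0"
  shows "(\<lambda>n. Mod (f n)) \<longlonglongrightarrow> 0"
proof (rule tendsto_ennreal_0I)
  fix e :: real assume e: "0 < e"
  define \<tau> where "\<tau> = min e 1"
  have \<tau>: "0 < \<tau>" "\<tau> \<le> 1" "\<tau> \<le> e" using e by (auto simp: \<tau>_def)
  have "\<forall>\<^sub>F n in sequentially. Lux (f n) < \<tau>" using order_tendstoD(2)[OF l \<tau>(1)] .
  then show "\<forall>\<^sub>F n in sequentially. Mod (f n) \<le> ennreal e"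
  proof eventually_elim
    case (elim n)
    have m: "(\<lambda>x. f n x / \<tau>) \<in> borel_measurable M" using f[of n] by (auto simp: in_LH_def)
    have "Mod (f n) = Mod (\<lambda>x. \<tau> * (f n x / \<tau>))" using \<tau> by simp
    also have "\<dots> \<le> ennreal \<tau> * Mod (\<lambda>x. f n x / \<tau>)" using \<tau> by (intro modular_scale_small m) auto
    also have "\<dots> \<le> ennreal \<tau> * 1" by (intro mult_left_mono modular_le_1 f elim) auto
    also have "\<dots> \<le> ennreal e" using \<tau> by (simp add: ennreal_leI)
    finally show ?case .
  qed
qed

end

section \<open>The Sobolev space\<close>

lemma nn_integral_lebesgue_on_le:
  fixes f :: "'a::euclidean_space \<Rightarrow> ennreal"
  assumes "\<Omega> \<in> sets lebesgue"
  shows "(\<integral>\<^sup>+x. f x \<partial>lebesgue_on \<Omega>) \<le> (\<integral>\<^sup>+x. f x \<partial>lborel)"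
proof -
  have "(\<integral>\<^sup>+x. f x \<partial>lebesgue_on \<Omega>) = (\<integral>\<^sup>+x. f x * indicator \<Omega> x \<partial>lebesgue)"
    using assms by (subst nn_integral_restrict_space) auto
  also have "\<dots> \<le> (\<integral>\<^sup>+x. f x \<partial>lebesgue)" by (intro nn_integral_mono) (auto simp: indicator_def)
  also have "\<dots> = (\<integral>\<^sup>+x. f x \<partial>lborel)" by (rule nn_integral_completion)
  finally show ?thesis .
qed

lemma weak_grad_wgrad:
  assumes "weak_grad \<Omega> u g" shows "weak_grad \<Omega> u (wgrad \<Omega> u)"
  unfolding wgrad_def by (rule someI[of "weak_grad \<Omega> u", OF assms])

lemma wgrad_AE_eq:
  "open \<Omega> \<Longrightarrow> weak_grad \<Omega> u g \<Longrightarrow> AE x in lebesgue_on \<Omega>. wgrad \<Omega> u x = g x"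
  using weak_grad_unique[OF _ weak_grad_wgrad] by blast

locale finsler_double_phase = double_phase p q \<mu> \<Omega> for p q and \<mu> :: "real^'n \<Rightarrow> real" and \<Omega> +
  fixes H :: "real^'n \<Rightarrow> real"
  assumes H: "finsler_minkowski H"
begin

abbreviation "W \<equiv> W0 H p q \<mu> \<Omega>"
abbreviation "gr \<equiv> wgrad \<Omega>"

lemma finsler_compose_measurable:
  "g \<in> borel_measurable M \<Longrightarrow> (\<lambda>x. H (g x)) \<in> borel_measurable M"
  by (rule measurable_compose[OF _ finsler_measurable[OF H]])

lemma finsler_abs: "\<bar>H \<xi>\<bar> = H \<xi>"
  using finsler_nonneg[OF H] by simp

lemma in_LH_finsler_add:
  assumes g: "LH (\<lambda>x. H (g x))" and h: "LH (\<lambda>x. H (h x))"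
    and m: "g \<in> borel_measurable M" "h \<in> borel_measurable M"
  shows "LH (\<lambda>x. H (c *\<^sub>R g x + d *\<^sub>R h x))"
proof -
  obtain Q where Q: "1 \<le> Q" "\<And>\<xi> \<eta>. H (\<xi> + \<eta>) \<le> Q * (H \<xi> + H \<eta>)"
    using finsler_quasi_triangle[OF H] by blast
  show ?thesis
  proof (rule in_LH_bound[OF in_LH_add_abs[OF g h], where C = "Q * (\<bar>c\<bar> + \<bar>d\<bar>)"])
    show "AE x in M. \<bar>H (c *\<^sub>R g x + d *\<^sub>R h x)\<bar> \<le> Q * (\<bar>c\<bar> + \<bar>d\<bar>) * \<bar>\<bar>H (g x)\<bar> + \<bar>H (h x)\<bar>\<bar>"
    proof (rule AE_I2)
      fix x
      have n: "0 \<le> H (g x)" "0 \<le> H (h x)" using finsler_nonneg[OF H] by auto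
      have "\<bar>c\<bar> * H (g x) + \<bar>d\<bar> * H (h x) \<le> (\<bar>c\<bar> + \<bar>d\<bar>) * (H (g x) + H (h x))"
        using n by (simp add: algebra_simps)
      then have "Q * (\<bar>c\<bar> * H (g x) + \<bar>d\<bar> * H (h x)) \<le> Q * ((\<bar>c\<bar> + \<bar>d\<bar>) * (H (g x) + H (h x)))"
        using Q(1) by (intro mult_left_mono) auto
      then show "\<bar>H (c *\<^sub>R g x + d *\<^sub>R h x)\<bar> \<le> Q * (\<bar>c\<bar> + \<bar>d\<bar>) * \<bar>\<bar>H (g x)\<bar> + \<bar>H (h x)\<bar>\<bar>"
        using Q(2)[of "c *\<^sub>R g x" "d *\<^sub>R h x"] n by (simp add: finsler_abs finsler_scaleR[OF H] mult.assoc)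
    qed
  qed (use Q(1) m in \<open>auto intro!: finsler_compose_measurable\<close>)
qed

lemma Cc_1_in_LH:
  assumes "\<phi> \<in> Cc_1 \<Omega>" shows "LH \<phi>" "LH (\<lambda>x. H (cgrad \<phi> x))"
proof -
  obtain B where B: "0 < B" "\<And>x. \<bar>\<phi> x\<bar> \<le> B" "\<And>x. norm (cgrad \<phi> x) \<le> B" using Cc_1_bounds[OF assms] by blast
  obtain C where C: "0 < C" "\<And>\<xi>. H \<xi> \<le> C * norm \<xi>" using finsler_norm_bounds[OF H] by metis
  show "LH \<phi>"
    using B by (intro in_LH_bound[OF in_LH_const[of B], of _ 1] continuous_imp_measurable_lebesgue_on Cc_1_D(1)[OF assms]) auto
  have "H (cgrad \<phi> x) \<le> C * B" for x
    by (rule order_trans[OF C(2)]) (use C(1) B(3) in \<open>auto intro: mult_left_mono\<close>)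
  then show "LH (\<lambda>x. H (cgrad \<phi> x))"
    using B C(1) by (intro in_LH_bound[OF in_LH_const[of "C * B"], of _ 1] finsler_compose_measurable
        continuous_imp_measurable_lebesgue_on Cc_1_continuous_cgrad[OF assms]) (auto simp: finsler_abs)
qed

text \<open>\<open>W0\<close> speaks of some weak gradient. Since it is unique almost everywhere,
  all its properties pass to the canonical choice \<open>gr u\<close>.\<close>

lemma W0_D:
  assumes u: "u \<in> W"
  shows "weak_grad \<Omega> u (gr u)" "gr u \<in> borel_measurable M" "LH u" "LH (\<lambda>x. H (gr u x))"
    "\<exists>\<phi>s. (\<forall>n. \<phi>s n \<in> Cc_inf \<Omega>) \<and>
      (\<lambda>n. Lux (\<lambda>x. \<phi>s n x - u x) + Lux (\<lambda>x. H (cgrad (\<phi>s n) x - gr u x))) \<longlonglongrightarrow> 0"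
proof -
  obtain g \<phi>s where g: "weak_grad \<Omega> u g" "LH u" "LH (\<lambda>x. H (g x))" "\<forall>n. \<phi>s n \<in> Cc_inf \<Omega>"
    "(\<lambda>n. Lux (\<lambda>x. \<phi>s n x - u x) + Lux (\<lambda>x. H (cgrad (\<phi>s n) x - g x))) \<longlonglongrightarrow> 0"
    using u unfolding W0_def by blast
  show wg: "weak_grad \<Omega> u (gr u)" by (rule weak_grad_wgrad[OF g(1)])
  show m: "gr u \<in> borel_measurable M" by (rule weak_grad_measurable[OF open_domain wg])
  show "LH u" by fact
  have eq: "AE x in M. gr u x = g x" by (rule wgrad_AE_eq[OF open_domain g(1)])
  show "LH (\<lambda>x. H (gr u x))"
    by (rule in_LH_bound[OF g(3), of _ 1]) (use eq m in \<open>auto intro: finsler_compose_measurable elim!: eventually_mono\<close>)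
  have "Lux (\<lambda>x. H (cgrad (\<phi>s n) x - g x)) = Lux (\<lambda>x. H (cgrad (\<phi>s n) x - gr u x))" for n
    using eq by (intro lux_cong_AE) (auto elim!: eventually_mono)
  then show "\<exists>\<phi>s. (\<forall>n. \<phi>s n \<in> Cc_inf \<Omega>) \<and>
      (\<lambda>n. Lux (\<lambda>x. \<phi>s n x - u x) + Lux (\<lambda>x. H (cgrad (\<phi>s n) x - gr u x))) \<longlonglongrightarrow> 0"
    using g by auto
qed

lemma W0_integrable_gradient:
  assumes u: "u \<in> W"
  shows "integrable M (\<lambda>x. H (gr u x) powr p)" "integrable M (\<lambda>x. \<mu> x * H (gr u x) powr q)"
proof -
  have m: "(\<lambda>x. H (gr u x)) \<in> borel_measurable M" and fin: "Mod (\<lambda>x. H (gr u x)) < \<infinity>"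
    using W0_D(4)[OF u] by (auto simp: in_LH_def)
  have i: "integrable M (\<lambda>x. modH p q \<mu> x \<bar>H (gr u x)\<bar>)"
  proof (rule integrableI_nonneg)
    show "(\<lambda>x. modH p q \<mu> x \<bar>H (gr u x)\<bar>) \<in> borel_measurable M" by (rule modH_measurable[OF m])
    show "AE x in M. 0 \<le> modH p q \<mu> x \<bar>H (gr u x)\<bar>" by (rule AE_I2) (simp add: modH_nonneg)
    show "(\<integral>\<^sup>+x. ennreal (modH p q \<mu> x \<bar>H (gr u x)\<bar>) \<partial>M) < \<infinity>" using fin by (simp add: modular_def)
  qed
  show "integrable M (\<lambda>x. H (gr u x) powr p)"
    by (rule Bochner_Integration.integrable_bound[OF i])
      (use m in \<open>auto simp: modH_def finsler_abs \<mu>_nonneg intro!: AE_I2\<close>)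
  show "integrable M (\<lambda>x. \<mu> x * H (gr u x) powr q)"
    by (rule Bochner_Integration.integrable_bound[OF i])
      (use m in \<open>auto simp: modH_def finsler_abs \<mu>_nonneg intro!: AE_I2\<close>)
qed

text \<open>If phi_n approximates u, then c phi_n + d phi approximates c u + d phi, and phi cancels
  from the error, which is exactly c times the old one. This is why phi is taken smooth and why c >
  0 suffices.\<close>

lemma W0_perturb:
  assumes u: "u \<in> W" and \<phi>: "\<phi> \<in> Cc_inf \<Omega>" and c: "0 < c"
  shows "(\<lambda>x. c * u x + d * \<phi> x) \<in> W"
    "AE x in M. gr (\<lambda>x. c * u x + d * \<phi> x) x = c *\<^sub>R gr u x + d *\<^sub>R cgrad \<phi> x"
proof -
  note \<phi>1 = Cc_inf_subset_Cc_1[OF \<phi>]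
  define g where "g x = c *\<^sub>R gr u x + d *\<^sub>R cgrad \<phi> x" for x
  have wg: "weak_grad \<Omega> (\<lambda>x. c * u x + d * \<phi> x) g"
    unfolding g_def by (rule weak_grad_lincomb[OF W0_D(1)[OF u] weak_grad_Cc_1[OF \<phi>1]])
  then show "AE x in M. gr (\<lambda>x. c * u x + d * \<phi> x) x = c *\<^sub>R gr u x + d *\<^sub>R cgrad \<phi> x"
    using wgrad_AE_eq[OF open_domain wg] by (simp add: g_def)
  have um: "u \<in> borel_measurable M" using W0_D(3)[OF u] by (simp add: in_LH_def)
  have \<phi>m: "\<phi> \<in> borel_measurable M" "cgrad \<phi> \<in> borel_measurable M"
    by (intro continuous_imp_measurable_lebesgue_on Cc_1_D(1)[OF \<phi>1] Cc_1_continuous_cgrad[OF \<phi>1])+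
  have "LH (\<lambda>x. c * u x + d * \<phi> x)"
  proof (rule in_LH_bound[OF in_LH_add_abs[OF W0_D(3)[OF u] Cc_1_in_LH(1)[OF \<phi>1]], where C = "c + \<bar>d\<bar>"])
    show "AE x in M. \<bar>c * u x + d * \<phi> x\<bar> \<le> (c + \<bar>d\<bar>) * \<bar>\<bar>u x\<bar> + \<bar>\<phi> x\<bar>\<bar>"
    proof (rule AE_I2)
      fix x
      have "\<bar>c * u x + d * \<phi> x\<bar> \<le> c * \<bar>u x\<bar> + \<bar>d\<bar> * \<bar>\<phi> x\<bar>"
        using abs_triangle_ineq[of "c * u x" "d * \<phi> x"] c by (simp add: abs_mult)
      also have "\<dots> \<le> (c + \<bar>d\<bar>) * (\<bar>u x\<bar> + \<bar>\<phi> x\<bar>)" using c by (simp add: algebra_simps)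
      finally show "\<bar>c * u x + d * \<phi> x\<bar> \<le> (c + \<bar>d\<bar>) * \<bar>\<bar>u x\<bar> + \<bar>\<phi> x\<bar>\<bar>" by simp
    qed
  qed (use um \<phi>m c in auto)
  moreover have "LH (\<lambda>x. H (g x))"
    unfolding g_def by (intro in_LH_finsler_add W0_D[OF u] Cc_1_in_LH[OF \<phi>1] \<phi>m)
  moreover obtain \<phi>s where \<phi>s: "\<And>n. \<phi>s n \<in> Cc_inf \<Omega>"
    and lim: "(\<lambda>n. Lux (\<lambda>x. \<phi>s n x - u x) + Lux (\<lambda>x. H (cgrad (\<phi>s n) x - gr u x))) \<longlonglongrightarrow> 0"
    using W0_D(5)[OF u] by blast
  have l1: "LH (\<lambda>x. \<phi>s n x - u x)" for n
  proof (rule in_LH_bound[OF in_LH_add_abs[OF Cc_1_in_LH(1)[OF Cc_inf_subset_Cc_1[OF \<phi>s[of n]]] W0_D(3)[OF u]], where C = 1])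
    show "(\<lambda>x. \<phi>s n x - u x) \<in> borel_measurable M"
      using um continuous_imp_measurable_lebesgue_on[OF Cc_1_D(1)[OF Cc_inf_subset_Cc_1[OF \<phi>s]]] by measurable
  qed auto
  have l2: "LH (\<lambda>x. H (cgrad (\<phi>s n) x - gr u x))" for n
    using in_LH_finsler_add[OF Cc_1_in_LH(2)[OF Cc_inf_subset_Cc_1[OF \<phi>s[of n]]] W0_D(4)[OF u]
        continuous_imp_measurable_lebesgue_on[OF Cc_1_continuous_cgrad[OF Cc_inf_subset_Cc_1[OF \<phi>s[of n]]]] W0_D(2)[OF u], of 1 "-1"]
    by simp
  define \<psi> where "\<psi> n x = c * \<phi>s n x + d * \<phi> x" for n x
  have \<psi>: "\<psi> n \<in> Cc_inf \<Omega>" for n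
    unfolding \<psi>_def by (rule Cc_inf_lincomb[OF \<phi>s \<phi>])
  have e1: "(\<lambda>x. \<psi> n x - (c * u x + d * \<phi> x)) = (\<lambda>x. c * (\<phi>s n x - u x))" for n
    by (auto simp: \<psi>_def algebra_simps)
  have e2: "(\<lambda>x. H (cgrad (\<psi> n) x - g x)) = (\<lambda>x. c * H (cgrad (\<phi>s n) x - gr u x))" for n
  proof
    fix x
    have "cgrad (\<psi> n) x = c *\<^sub>R cgrad (\<phi>s n) x + d *\<^sub>R cgrad \<phi> x"
      unfolding \<psi>_def by (intro cgrad_lincomb Cc_1_D(2)[OF \<phi>1] Cc_1_D(2)[OF Cc_inf_subset_Cc_1[OF \<phi>s]])
    then have "cgrad (\<psi> n) x - g x = c *\<^sub>R (cgrad (\<phi>s n) x - gr u x)" by (simp add: g_def algebra_simps)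
    then show "H (cgrad (\<psi> n) x - g x) = c * H (cgrad (\<phi>s n) x - gr u x)"
      using c by (simp add: finsler_scaleR[OF H])
  qed
  have "(\<lambda>n. Lux (\<lambda>x. \<psi> n x - (c * u x + d * \<phi> x)) + Lux (\<lambda>x. H (cgrad (\<psi> n) x - g x))) \<longlonglongrightarrow> 0"
  proof (rule tendsto_sandwich[of "\<lambda>_. 0"])
    have a1: "LH (\<lambda>x. c * (\<phi>s n x - u x))" for n
      by (rule in_LH_bound[OF l1[of n], of _ c]) (use c l1[of n] in \<open>auto simp: abs_mult in_LH_def\<close>)
    have a2: "LH (\<lambda>x. c * H (cgrad (\<phi>s n) x - gr u x))" for n
      by (rule in_LH_bound[OF l2[of n], of _ c]) (use c l2[of n] in \<open>auto simp: abs_mult in_LH_def\<close>)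
    show "\<forall>\<^sub>F n in sequentially. 0 \<le> Lux (\<lambda>x. \<psi> n x - (c * u x + d * \<phi> x)) + Lux (\<lambda>x. H (cgrad (\<psi> n) x - g x))"
      unfolding e1 e2 using lux_nonneg[OF a1] lux_nonneg[OF a2] by (simp add: add_nonneg_nonneg)
    show "\<forall>\<^sub>F n in sequentially. Lux (\<lambda>x. \<psi> n x - (c * u x + d * \<phi> x)) + Lux (\<lambda>x. H (cgrad (\<psi> n) x - g x))
        \<le> c * (Lux (\<lambda>x. \<phi>s n x - u x) + Lux (\<lambda>x. H (cgrad (\<phi>s n) x - gr u x)))"
      unfolding e1 e2 distrib_left using lux_scale_le[OF l1 c] lux_scale_le[OF l2 c] by (simp add: add_mono)
    show "(\<lambda>n. c * (Lux (\<lambda>x. \<phi>s n x - u x) + Lux (\<lambda>x. H (cgrad (\<phi>s n) x - gr u x)))) \<longlonglongrightarrow> 0"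
      using tendsto_mult_right_zero[OF lim] .
  qed simp
  ultimately show "(\<lambda>x. c * u x + d * \<phi> x) \<in> W"
    unfolding W0_def using wg \<psi> by blast
qed

lemma W0_diff:
  assumes u: "u \<in> W" and v: "v \<in> W"
  shows "AE x in M. gr (\<lambda>x. u x - v x) x = gr u x - gr v x"
    "LH (\<lambda>x. H (gr (\<lambda>x. u x - v x) x))"
proof -
  have wg: "weak_grad \<Omega> (\<lambda>x. u x - v x) (\<lambda>x. gr u x - gr v x)"
    using weak_grad_lincomb[OF W0_D(1)[OF u] W0_D(1)[OF v], of 1 "-1"] by simp
  show eq: "AE x in M. gr (\<lambda>x. u x - v x) x = gr u x - gr v x" by (rule wgrad_AE_eq[OF open_domain wg])
  have "LH (\<lambda>x. H (gr u x - gr v x))"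
    using in_LH_finsler_add[OF W0_D(4)[OF u] W0_D(4)[OF v] W0_D(2)[OF u] W0_D(2)[OF v], of 1 "-1"] by simp
  then show "LH (\<lambda>x. H (gr (\<lambda>x. u x - v x) x))"
    by (rule in_LH_bound[of _ _ 1])
      (use eq weak_grad_measurable[OF open_domain weak_grad_wgrad[OF wg]] in \<open>auto intro: finsler_compose_measurable elim!: eventually_mono\<close>)
qed

lemma wnorm_quasi_triangle:
  obtains Q where "0 < Q" "\<And>u v w s. u \<in> W \<Longrightarrow> v \<in> W \<Longrightarrow> w \<in> W \<Longrightarrow>
    wnorm H p q \<mu> \<Omega> (\<lambda>x. u x - w x) < s \<Longrightarrow> wnorm H p q \<mu> \<Omega> (\<lambda>x. v x - w x) < s \<Longrightarrow>
    wnorm H p q \<mu> \<Omega> (\<lambda>x. u x - v x) \<le> Q * s"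
proof -
  obtain Q where Q: "1 \<le> Q" "\<And>\<xi> \<eta>. H (\<xi> + \<eta>) \<le> Q * (H \<xi> + H \<eta>)"
    using finsler_quasi_triangle[OF H] by blast
  have "wnorm H p q \<mu> \<Omega> (\<lambda>x. u x - v x) \<le> 4 * Q * s"
    if W: "u \<in> W" "v \<in> W" "w \<in> W" and s: "wnorm H p q \<mu> \<Omega> (\<lambda>x. u x - w x) < s" "wnorm H p q \<mu> \<Omega> (\<lambda>x. v x - w x) < s"
    for u v w s
    unfolding wnorm_def
  proof (rule lux_add_le[OF W0_diff(2)[OF W(1,3)] _ W0_diff(2)[OF W(2,3)] _ Q(1)])
    show "AE x in M. \<bar>H (gr (\<lambda>x. u x - v x) x)\<bar> \<le> Q * (\<bar>H (gr (\<lambda>x. u x - w x) x)\<bar> + \<bar>H (gr (\<lambda>x. v x - w x) x)\<bar>)"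
      using W0_diff(1)[OF W(1,2)] W0_diff(1)[OF W(1,3)] W0_diff(1)[OF W(2,3)]
    proof eventually_elim
      case (elim x)
      have "H (- (gr v x - gr w x)) = H (gr v x - gr w x)"
        using finsler_scaleR[OF H, where t = "-1" and \<xi> = "gr v x - gr w x"] by simp
      then show ?case
        using Q(2)[of "gr u x - gr w x" "- (gr v x - gr w x)"] by (simp add: elim finsler_abs)
    qed
  qed (use s in \<open>auto simp: wnorm_def\<close>)
  then show ?thesis using Q(1) by (intro that[of "4 * Q"]) auto
qed

text \<open>The Sobolev inequality bounds the critical integrals of the approximating test functions
  uniformly, and Fatou's lemma hands the bound over to u along an almost everywhere convergent
  subsequence.\<close>

lemma W0_integrable_pstar:
  assumes u: "u \<in> W" and N: "2 \<le> CARD('n)" "p < real CARD('n)"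
  shows "integrable M (\<lambda>x. \<bar>u x\<bar> powr pstar (real CARD('n)) p)"
proof -
  let ?r = "pstar (real CARD('n)) p"
  have r0: "0 < ?r" using pq N by (simp add: pstar_def)
  have um: "u \<in> borel_measurable M" using W0_D(3)[OF u] by (simp add: in_LH_def)
  obtain \<phi>0 where \<phi>0: "\<And>n. \<phi>0 n \<in> Cc_inf \<Omega>"
    and lim0: "(\<lambda>n. Lux (\<lambda>x. \<phi>0 n x - u x) + Lux (\<lambda>x. H (cgrad (\<phi>0 n) x - gr u x))) \<longlonglongrightarrow> 0"
    using W0_D(5)[OF u] by blast
  have \<phi>1: "\<phi>0 n \<in> Cc_1 \<Omega>" for n by (rule Cc_inf_subset_Cc_1[OF \<phi>0])
  have \<phi>m: "\<phi>0 n \<in> borel_measurable M" "cgrad (\<phi>0 n) \<in> borel_measurable M" for n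
    by (intro continuous_imp_measurable_lebesgue_on Cc_1_D(1)[OF \<phi>1] Cc_1_continuous_cgrad[OF \<phi>1])+
  have l1: "LH (\<lambda>x. \<phi>0 n x - u x)" for n
    by (rule in_LH_bound[OF in_LH_add_abs[OF Cc_1_in_LH(1)[OF \<phi>1[of n]] W0_D(3)[OF u]], where C = 1])
      (use um \<phi>m in auto)
  have l2: "LH (\<lambda>x. H (cgrad (\<phi>0 n) x - gr u x))" for n
    using in_LH_finsler_add[OF Cc_1_in_LH(2)[OF \<phi>1[of n]] W0_D(4)[OF u] \<phi>m(2)[of n] W0_D(2)[OF u], of 1 "-1"]
    by simp
  have "(\<lambda>n. Lux (\<lambda>x. \<phi>0 n x - u x)) \<longlonglongrightarrow> 0" "(\<lambda>n. Lux (\<lambda>x. H (cgrad (\<phi>0 n) x - gr u x))) \<longlonglongrightarrow> 0"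
    by (rule tendsto_sandwich[OF _ _ tendsto_const lim0]; use lux_nonneg[OF l1] lux_nonneg[OF l2] in simp)+
  then have m1: "(\<lambda>n. Mod (\<lambda>x. \<phi>0 n x - u x)) \<longlonglongrightarrow> 0" and m2: "(\<lambda>n. Mod (\<lambda>x. H (cgrad (\<phi>0 n) x - gr u x))) \<longlonglongrightarrow> 0"
    using lux_tendsto_imp_modular_tendsto[OF l1] lux_tendsto_imp_modular_tendsto[OF l2] by auto
  have "\<forall>\<^sub>F n in sequentially. Mod (\<lambda>x. H (cgrad (\<phi>0 n) x - gr u x)) < 1"
    using order_tendstoD(2)[OF m2] by simp
  then obtain n0 where n0: "\<And>n. n \<ge> n0 \<Longrightarrow> Mod (\<lambda>x. H (cgrad (\<phi>0 n) x - gr u x)) < 1"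
    by (auto simp: eventually_sequentially)
  \<comment> \<open>The modular dominates the p-th power, so F n tends to 0 in L^1, and some
    subsequence tends to 0 almost everywhere.\<close>
  define F where "F n x = \<bar>\<phi>0 n x - u x\<bar> powr p" for n x
  have Fm: "F n \<in> borel_measurable M" for n unfolding F_def using um \<phi>m by measurable
  have Fle: "(\<integral>\<^sup>+x. ennreal (F n x) \<partial>M) \<le> Mod (\<lambda>x. \<phi>0 n x - u x)" for n
    unfolding modular_def modH_def F_def by (intro nn_integral_mono ennreal_leI) (auto simp: \<mu>_nonneg)
  have Fi: "integrable M (F n)" for n
  proof (rule integrableI_nonneg)
    show "(\<integral>\<^sup>+x. ennreal (F n x) \<partial>M) < \<infinity>"
      using Fle[of n] l1[of n] by (auto simp: in_LH_def intro: le_less_trans)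
  qed (use Fm in \<open>auto simp: F_def\<close>)
  have "(\<lambda>n. ennreal (LINT x|M. norm (F n x))) \<longlonglongrightarrow> 0"
  proof (rule tendsto_sandwich[OF _ _ tendsto_const m1])
    show "\<forall>\<^sub>F n in sequentially. ennreal (LINT x|M. norm (F n x)) \<le> Mod (\<lambda>x. \<phi>0 n x - u x)"
    proof (intro always_eventually allI)
      fix n
      have F0: "norm (F n x) = F n x" "0 \<le> F n x" for x by (auto simp: F_def)
      have "(\<integral>\<^sup>+x. ennreal (F n x) \<partial>M) = ennreal (LINT x|M. F n x)"
        by (rule nn_integral_eq_integral[OF Fi]) (auto simp: F0)
      then show "ennreal (LINT x|M. norm (F n x)) \<le> Mod (\<lambda>x. \<phi>0 n x - u x)"
        using Fle[of n] by (simp only: F0)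
    qed
  qed simp
  then have "(\<lambda>n. LINT x|M. norm (F n x)) \<longlonglongrightarrow> 0"
    by (subst tendsto_ennreal_iff[symmetric]) auto
  then obtain k where k: "strict_mono k" "AE x in M. (\<lambda>n. F (k n) x) \<longlonglongrightarrow> 0"
    using tendsto_L1_AE_subseq[of M F] Fi by blast
  have conv: "AE x in M. (\<lambda>n. \<phi>0 (k n) x) \<longlonglongrightarrow> u x"
    using k(2)
  proof eventually_elim
    case (elim x)
    have "(\<lambda>n. F (k n) x powr (1 / p)) \<longlonglongrightarrow> 0 powr (1 / p)"
      using pq by (intro tendsto_powr'[OF elim tendsto_const]) (auto simp: F_def)
    then have "(\<lambda>n. \<bar>\<phi>0 (k n) x - u x\<bar>) \<longlonglongrightarrow> 0"
      using pq by (simp add: F_def powr_powr)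
    then show ?case by (simp add: tendsto_rabs_zero_iff LIM_zero_iff)
  qed
  obtain c C where c: "0 < c" "\<And>\<xi>. c * norm \<xi> \<le> H \<xi>" using finsler_norm_bounds[OF H] by metis
  obtain Q where Q: "1 \<le> Q" "\<And>\<xi> \<eta>. H (\<xi> + \<eta>) \<le> Q * (H \<xi> + H \<eta>)"
    using finsler_quasi_triangle[OF H] by blast
  define G where "G = enn2real (Mod (\<lambda>x. H (gr u x)))"
  have G: "Mod (\<lambda>x. H (gr u x)) = ennreal G"
    using W0_D(4)[OF u] by (simp add: G_def in_LH_def)
  define A where "A = (Q / c * 2) powr p"
  have A: "0 \<le> A" by (simp add: A_def)
  \<comment> \<open>From index n0 on, the gradient error has modular below 1; the quasi-triangle
    inequality bounds the gradients in L^p uniformly.\<close>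
  have Y: "(LINT x|lborel. norm (cgrad (\<phi>0 n) x) powr p) \<le> A * (1 + G)" if n: "n \<ge> n0" for n
  proof -
    have pw: "norm (cgrad (\<phi>0 n) x) powr p \<le> A * (H (cgrad (\<phi>0 n) x - gr u x) powr p + H (gr u x) powr p)" for x
    proof -
      have "norm (cgrad (\<phi>0 n) x) \<le> Q / c * (H (cgrad (\<phi>0 n) x - gr u x) + H (gr u x))"
        using order_trans[OF c(2) Q(2)[of "cgrad (\<phi>0 n) x - gr u x" "gr u x"]] c(1) by (simp add: field_simps)
      then have "norm (cgrad (\<phi>0 n) x) powr p \<le> (Q / c * (H (cgrad (\<phi>0 n) x - gr u x) + H (gr u x))) powr p"
        using pq by (intro powr_mono2) auto
      also have "\<dots> = (Q / c) powr p * (H (cgrad (\<phi>0 n) x - gr u x) + H (gr u x)) powr p"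
        using Q(1) c(1) finsler_nonneg[OF H] by (subst powr_mult) (auto intro: add_nonneg_nonneg)
      also have "\<dots> \<le> (Q / c) powr p * (2 powr p * (H (cgrad (\<phi>0 n) x - gr u x) powr p + H (gr u x) powr p))"
        using pq finsler_nonneg[OF H] by (intro mult_left_mono powr_add_le) auto
      also have "\<dots> = A * (H (cgrad (\<phi>0 n) x - gr u x) powr p + H (gr u x) powr p)"
        using Q(1) c(1) by (simp add: A_def powr_mult mult.assoc powr_divide)
      finally show ?thesis .
    qed
    have cont: "continuous_on UNIV (\<lambda>x. norm (cgrad (\<phi>0 n) x) powr p)"
      using pq by (intro continuous_on_powr' continuous_intros Cc_1_continuous_cgrad[OF \<phi>1]) auto
    obtain K where K: "compact K" "K \<subseteq> \<Omega>" and g0: "\<And>x. x \<notin> K \<Longrightarrow> cgrad (\<phi>0 n) x = 0"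
      using Cc_1_support[OF \<phi>1[of n]] by blast
    have iY: "integrable lborel (\<lambda>x. norm (cgrad (\<phi>0 n) x) powr p)"
      using pq g0 by (intro integrable_continuous_compact_support[OF cont K(1)]) auto
    have "ennreal (LINT x|lborel. norm (cgrad (\<phi>0 n) x) powr p) = (\<integral>\<^sup>+x. ennreal (norm (cgrad (\<phi>0 n) x) powr p) \<partial>lborel)"
      using iY by (simp add: nn_integral_eq_integral)
    also have "\<dots> = (\<integral>\<^sup>+x. ennreal (norm (cgrad (\<phi>0 n) x) powr p) \<partial>lebesgue)" by (simp add: nn_integral_completion)
    also have "\<dots> = (\<integral>\<^sup>+x. ennreal (norm (cgrad (\<phi>0 n) x) powr p) * indicator \<Omega> x \<partial>lebesgue)"
      using g0 K(2) pq by (intro nn_integral_cong) (auto simp: indicator_def)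
    also have "\<dots> = (\<integral>\<^sup>+x. ennreal (norm (cgrad (\<phi>0 n) x) powr p) \<partial>M)"
      by (subst nn_integral_restrict_space) auto
    also have "\<dots> \<le> (\<integral>\<^sup>+x. ennreal A * (ennreal (modH p q \<mu> x \<bar>H (cgrad (\<phi>0 n) x - gr u x)\<bar>) + ennreal (modH p q \<mu> x \<bar>H (gr u x)\<bar>)) \<partial>M)"
    proof (intro nn_integral_mono)
      fix x assume x: "x \<in> space M"
      have "A * (H (cgrad (\<phi>0 n) x - gr u x) powr p + H (gr u x) powr p)
          \<le> A * (modH p q \<mu> x \<bar>H (cgrad (\<phi>0 n) x - gr u x)\<bar> + modH p q \<mu> x \<bar>H (gr u x)\<bar>)"
        using A x by (intro mult_left_mono add_mono) (auto simp: modH_def finsler_abs \<mu>_nonneg)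
      then show "ennreal (norm (cgrad (\<phi>0 n) x) powr p) \<le> ennreal A * (ennreal (modH p q \<mu> x \<bar>H (cgrad (\<phi>0 n) x - gr u x)\<bar>) + ennreal (modH p q \<mu> x \<bar>H (gr u x)\<bar>))"
        using pw[of x] x A by (simp add: modH_nonneg flip: ennreal_plus ennreal_mult')
    qed
    also have "\<dots> = ennreal A * (Mod (\<lambda>x. H (cgrad (\<phi>0 n) x - gr u x)) + Mod (\<lambda>x. H (gr u x)))"
    proof -
      have [measurable]: "(\<lambda>x. modH p q \<mu> x \<bar>H (cgrad (\<phi>0 n) x - gr u x)\<bar>) \<in> borel_measurable M"
        "(\<lambda>x. modH p q \<mu> x \<bar>H (gr u x)\<bar>) \<in> borel_measurable M"
        using l2[of n] W0_D(4)[OF u] by (auto simp: in_LH_def intro!: modH_measurable)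
      show ?thesis unfolding modular_def by (subst nn_integral_cmult, measurable, subst nn_integral_add, measurable)
    qed
    also have "\<dots> \<le> ennreal A * (1 + ennreal G)"
      using n0[OF n] G by (intro mult_left_mono add_mono) auto
    also have "\<dots> = ennreal (A * (1 + G))"
      using A by (simp add: ennreal_mult' G_def flip: ennreal_1 ennreal_plus)
    finally show ?thesis using A by (subst (asm) ennreal_le_iff) (auto simp: G_def)
  qed
  define \<gamma> where "\<gamma> = p * (real CARD('n) - 1) / (real CARD('n) - p)"
  have \<gamma>: "0 \<le> \<gamma>" using pq N by (simp add: \<gamma>_def)
  define R where "R = (\<gamma> * (A * (1 + G)) powr (1 / p)) powr ?r"
  have X: "(\<integral>\<^sup>+x. ennreal (\<bar>\<phi>0 n x\<bar> powr ?r) \<partial>M) \<le> ennreal R" if n: "n \<ge> n0" for n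
  proof -
    have "(\<integral>\<^sup>+x. ennreal (\<bar>\<phi>0 n x\<bar> powr ?r) \<partial>M) \<le> (\<integral>\<^sup>+x. ennreal (\<bar>\<phi>0 n x\<bar> powr ?r) \<partial>lborel)"
      by (rule nn_integral_lebesgue_on_le) simp
    also have "\<dots> \<le> ennreal ((\<gamma> * (LINT x|lborel. norm (cgrad (\<phi>0 n) x) powr p) powr (1 / p)) powr ?r)"
      using Sobolev_pstar[OF Cc_1_subset[OF _ \<phi>1] pq(1) N(2,1)] by (simp add: \<gamma>_def)
    also have "\<dots> \<le> ennreal R"
      unfolding R_def using Y[OF n] \<gamma> r0 pq by (intro ennreal_leI powr_mono2 mult_left_mono) auto
    finally show ?thesis .
  qed
  \<comment> \<open>Shifting the subsequence by n0 puts all of its indices into the range of the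
    uniform bound.\<close>
  have kn: "k (n + n0) \<ge> n0" for n using seq_suble[OF k(1), of "n + n0"] by simp
  have "(\<integral>\<^sup>+x. ennreal (\<bar>u x\<bar> powr ?r) \<partial>M) = (\<integral>\<^sup>+x. liminf (\<lambda>n. ennreal (\<bar>\<phi>0 (k (n + n0)) x\<bar> powr ?r)) \<partial>M)"
  proof (rule nn_integral_cong_AE)
    show "AE x in M. ennreal (\<bar>u x\<bar> powr ?r) = liminf (\<lambda>n. ennreal (\<bar>\<phi>0 (k (n + n0)) x\<bar> powr ?r))"
      using conv
    proof eventually_elim
      case (elim x)
      have "(\<lambda>n. \<bar>\<phi>0 (k (n + n0)) x\<bar> powr ?r) \<longlonglongrightarrow> \<bar>u x\<bar> powr ?r"
        using r0 LIMSEQ_ignore_initial_segment[OF elim] by (intro tendsto_powr' tendsto_intros) auto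
      from tendsto_ennrealI[OF this]
      show ?case by (rule lim_imp_Liminf[OF sequentially_bot, symmetric])
    qed
  qed
  also have "\<dots> \<le> liminf (\<lambda>n. \<integral>\<^sup>+x. ennreal (\<bar>\<phi>0 (k (n + n0)) x\<bar> powr ?r) \<partial>M)"
    by (rule nn_integral_liminf) (use \<phi>m in measurable)
  also have "\<dots> \<le> liminf (\<lambda>n. ennreal R)"
    by (intro Liminf_mono always_eventually allI X kn)
  also have "\<dots> = ennreal R" by (simp add: Liminf_const)
  finally show ?thesis
    using um by (intro integrableI_nonneg) (auto intro: le_less_trans)
qed

end

section \<open>Calculus along rays\<close>

text \<open>This replaces the implicit function theorem, since only continuity in epsilon is
  available. Positivity of f2 near (0, 1) makes f1 increasing in t; its opposite signs at 1 - \<eta>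
  and 1 + \<eta> persist for small epsilon, and the zero between them minimises f over that
  interval, which contains 1.\<close>

lemma nearby_fibre_minimum:
  fixes f f1 f2 :: "real \<Rightarrow> real \<Rightarrow> real"
  assumes f: "\<And>\<epsilon> t. 0 < t \<Longrightarrow> (f \<epsilon> has_real_derivative f1 \<epsilon> t) (at t)"
    and f1: "\<And>\<epsilon> t. 0 < t \<Longrightarrow> (f1 \<epsilon> has_real_derivative f2 \<epsilon> t) (at t)"
    and cont1: "\<And>t. 0 < t \<Longrightarrow> ((\<lambda>\<epsilon>. f1 \<epsilon> t) \<longlongrightarrow> f1 0 t) (nhds 0)"
    and cont2: "((\<lambda>z. f2 (fst z) (snd z)) \<longlongrightarrow> f2 0 1) (nhds 0 \<times>\<^sub>F nhds 1)"
    and crit: "f1 0 1 = 0" "0 < f2 0 1"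
  shows "\<forall>\<^sub>F \<epsilon> in nhds 0. \<exists>t>0. f1 \<epsilon> t = 0 \<and> 0 < f2 \<epsilon> t \<and> f \<epsilon> t \<le> f \<epsilon> 1"
proof -
  have "\<forall>\<^sub>F z in nhds 0 \<times>\<^sub>F nhds 1. 0 < f2 (fst z) (snd z)"
    using order_tendstoD(1)[OF cont2 crit(2)] .
  then obtain P Q where P: "eventually P (nhds 0)" and Q: "eventually Q (nhds 1)"
    and PQ: "\<And>\<epsilon> t. P \<epsilon> \<Longrightarrow> Q t \<Longrightarrow> 0 < f2 \<epsilon> t"
    by (auto simp: eventually_prod_filter)
  obtain d where d: "d > 0" "\<And>t. dist t 1 < d \<Longrightarrow> Q t"
    using Q by (auto simp: eventually_nhds_metric)
  \<comment> \<open>The bound 1/2 keeps the whole interval inside t > 0, where the derivatives are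
    known.\<close>
  define \<eta> where "\<eta> = min (d / 2) (1 / 2)"
  have \<eta>: "0 < \<eta>" "\<eta> < 1" "\<eta> < d" using d(1) by (auto simp: \<eta>_def min_def)
  have Qt: "Q t" if "1 - \<eta> \<le> t" "t \<le> 1 + \<eta>" for t
    using that \<eta> by (intro d(2)) (auto simp: dist_real_def)
  have inc: "f1 \<epsilon> s < f1 \<epsilon> t" if "P \<epsilon>" "1 - \<eta> \<le> s" "s < t" "t \<le> 1 + \<eta>" for \<epsilon> s t
  proof (rule DERIV_pos_imp_increasing[OF that(3)])
    fix x assume "s \<le> x" "x \<le> t"
    then show "\<exists>y. DERIV (f1 \<epsilon>) x :> y \<and> 0 < y"
      using that \<eta> f1[of x \<epsilon>] PQ[OF that(1) Qt[of x]] by auto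
  qed
  have P0: "P 0" using P by (rule eventually_nhds_x_imp_x)
  have s1: "f1 0 (1 - \<eta>) < 0" "0 < f1 0 (1 + \<eta>)"
    using inc[OF P0, of "1 - \<eta>" 1] inc[OF P0, of 1 "1 + \<eta>"] \<eta> crit(1) by auto
  have "\<forall>\<^sub>F \<epsilon> in nhds 0. f1 \<epsilon> (1 - \<eta>) < 0"
    using order_tendstoD(2)[OF cont1 s1(1)] \<eta> by auto
  moreover have "\<forall>\<^sub>F \<epsilon> in nhds 0. 0 < f1 \<epsilon> (1 + \<eta>)"
    using order_tendstoD(1)[OF cont1 s1(2)] \<eta> by auto
  ultimately show ?thesis using P
  proof eventually_elim
    case (elim \<epsilon>)
    have "\<exists>t\<ge>1 - \<eta>. t \<le> 1 + \<eta> \<and> f1 \<epsilon> t = 0"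
    proof (rule IVT)
      show "\<forall>x. 1 - \<eta> \<le> x \<and> x \<le> 1 + \<eta> \<longrightarrow> isCont (f1 \<epsilon>) x"
      proof (intro allI impI)
        fix x assume "1 - \<eta> \<le> x \<and> x \<le> 1 + \<eta>"
        then have "0 < x" using \<eta> by linarith
        then show "isCont (f1 \<epsilon>) x" by (rule DERIV_isCont[OF f1])
      qed
    qed (use elim \<eta> in auto)
    then obtain t where t: "1 - \<eta> \<le> t" "t \<le> 1 + \<eta>" "f1 \<epsilon> t = 0" by blast
    have "f \<epsilon> t \<le> f \<epsilon> 1"
    proof -
      consider "t < 1" | "t = 1" | "1 < t" by linarith
      then show ?thesis
      proof cases
        case 1
        have "\<exists>z>t. z < 1 \<and> f \<epsilon> 1 - f \<epsilon> t = (1 - t) * f1 \<epsilon> z"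
          using t \<eta> by (intro MVT2[OF 1]) (auto intro!: f)
        then obtain z where z: "t < z" "z < 1" "f \<epsilon> 1 - f \<epsilon> t = (1 - t) * f1 \<epsilon> z" by blast
        have "f1 \<epsilon> t < f1 \<epsilon> z" using z t \<eta> by (intro inc elim) auto
        then have "0 \<le> (1 - t) * f1 \<epsilon> z" using t 1 by simp
        then show ?thesis using z(3) by linarith
      next
        case 3
        have "\<exists>z>1. z < t \<and> f \<epsilon> t - f \<epsilon> 1 = (t - 1) * f1 \<epsilon> z"
          using t \<eta> by (intro MVT2[OF 3]) (auto intro!: f)
        then obtain z where z: "1 < z" "z < t" "f \<epsilon> t - f \<epsilon> 1 = (t - 1) * f1 \<epsilon> z" by blast
        have "f1 \<epsilon> z < f1 \<epsilon> t" using z t \<eta> by (intro inc elim) auto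
        then have "(t - 1) * f1 \<epsilon> z \<le> 0" using t 3 by (simp add: mult_nonneg_nonpos)
        then show ?thesis using z(3) by linarith
      qed simp
    qed
    then show ?case using t \<eta> PQ[OF _ Qt] elim by (intro exI[of _ t]) auto
  qed
qed

text \<open>Differentiation under the integral at the single point 0: pointwise differentiability is
  asked only there, and the majorant bounds the difference quotients directly. The integrands
  occurring below are not differentiable in h everywhere.\<close>

lemma has_real_derivative_integral:
  fixes F :: "real \<Rightarrow> 'a \<Rightarrow> real"
  assumes F0: "integrable M (F 0)" and w: "integrable M w"
    and meas: "\<And>h. F h \<in> borel_measurable M" "D \<in> borel_measurable M"
    and lim: "AE x in M. ((\<lambda>h. F h x) has_real_derivative D x) (at 0)"
    and bound: "AE x in M. \<forall>h. \<bar>h\<bar> \<le> 1 \<longrightarrow> \<bar>F h x - F 0 x\<bar> \<le> \<bar>h\<bar> * w x"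
  shows "integrable M D" "\<And>h. \<bar>h\<bar> \<le> 1 \<Longrightarrow> integrable M (F h)"
    "((\<lambda>h. LINT x|M. F h x) has_real_derivative (LINT x|M. D x)) (at 0)"
proof -
  have dq: "AE x in M. \<forall>h. \<bar>h\<bar> \<le> 1 \<longrightarrow> norm ((F h x - F 0 x) / h) \<le> w x"
    using bound
  proof eventually_elim
    case (elim x)
    have w0: "0 \<le> w x" using elim[rule_format, of 1] by simp
    show ?case
    proof (intro allI impI)
      fix h :: real assume "\<bar>h\<bar> \<le> 1"
      then show "norm ((F h x - F 0 x) / h) \<le> w x"
        using elim[rule_format, of h] w0 by (cases "h = 0") (auto simp: divide_le_eq mult.commute)
    qed
  qed
  show int: "integrable M (F h)" if h: "\<bar>h\<bar> \<le> 1" for h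
  proof -
    have "integrable M (\<lambda>x. F h x - F 0 x)"
    proof (rule Bochner_Integration.integrable_bound)
      show "integrable M (\<lambda>x. \<bar>h\<bar> * w x)" using w by simp
      show "AE x in M. norm (F h x - F 0 x) \<le> norm (\<bar>h\<bar> * w x)"
        using bound by eventually_elim (use h in force)
      show "(\<lambda>x. F h x - F 0 x) \<in> borel_measurable M" using meas(1) by measurable
    qed
    from Bochner_Integration.integrable_add[OF this F0] show ?thesis by simp
  qed
  \<comment> \<open>Dominated convergence is a statement about sequences, so the limit h -> 0 is
    tested along arbitrary null sequences of nonzero steps.\<close>
  have seq: "integrable M D \<and> (\<lambda>k. LINT x|M. (F (X k) x - F 0 x) / X k) \<longlonglongrightarrow> (LINT x|M. D x)"
    if X: "\<And>k. X k \<noteq> 0" "\<And>k. \<bar>X k\<bar> \<le> 1" "X \<longlonglongrightarrow> 0" for X :: "nat \<Rightarrow> real"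
  proof -
    have l: "AE x in M. (\<lambda>k. (F (X k) x - F 0 x) / X k) \<longlonglongrightarrow> D x"
      using lim
    proof eventually_elim
      case (elim x)
      then have "((\<lambda>h. (F h x - F 0 x) / h) \<longlongrightarrow> D x) (at 0)" by (simp add: DERIV_def)
      moreover have "filterlim X (at 0) sequentially" using X by (auto simp: filterlim_at)
      ultimately show ?case by (rule filterlim_compose)
    qed
    have b: "AE x in M. norm ((F (X k) x - F 0 x) / X k) \<le> w x" for k
      using dq by eventually_elim (use X(2) in blast)
    have m: "(\<lambda>x. (F (X k) x - F 0 x) / X k) \<in> borel_measurable M" for k
      using meas(1) by measurable
    show ?thesis
      using integrable_dominated_convergence[OF meas(2) m w l b]
        integral_dominated_convergence[OF meas(2) m w l b] by simp
  qed
  show "integrable M D"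
    using seq[of "\<lambda>k. 1 / real (Suc k)"] LIMSEQ_inverse_real_of_nat by (auto simp: inverse_eq_divide)
  have "((\<lambda>h. ((LINT x|M. F (0 + h) x) - (LINT x|M. F 0 x)) / h) \<longlongrightarrow> (LINT x|M. D x)) (at 0)"
    unfolding tendsto_at_iff_sequentially
  proof (intro allI impI)
    fix X :: "nat \<Rightarrow> real" assume X: "\<forall>i. X i \<in> UNIV - {0}" "X \<longlonglongrightarrow> 0"
    have "\<forall>\<^sub>F k in sequentially. \<bar>X k\<bar> < 1"
      using X(2) by (auto simp: tendsto_iff dist_real_def dest: spec[of _ 1])
    then obtain k0 where k0: "\<And>k. k \<ge> k0 \<Longrightarrow> \<bar>X k\<bar> < 1" by (auto simp: eventually_sequentially)
    have "(\<lambda>k. LINT x|M. (F (X (k + k0)) x - F 0 x) / X (k + k0)) \<longlonglongrightarrow> (LINT x|M. D x)"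
      using X LIMSEQ_ignore_initial_segment[OF X(2), of k0] k0
      by (intro conjunct2[OF seq[of "\<lambda>k. X (k + k0)"]]) (auto intro: less_imp_le)
    moreover have "(LINT x|M. (F (X (k + k0)) x - F 0 x) / X (k + k0))
        = ((LINT x|M. F (X (k + k0)) x) - (LINT x|M. F 0 x)) / X (k + k0)" for k
      using int[of "X (k + k0)"] k0[of "k + k0"] F0 by (simp add: less_imp_le)
    ultimately have "(\<lambda>k. ((LINT x|M. F (X (k + k0)) x) - (LINT x|M. F 0 x)) / X (k + k0)) \<longlonglongrightarrow> (LINT x|M. D x)"
      by (simp only:)
    then show "((\<lambda>h. ((LINT x|M. F (0 + h) x) - (LINT x|M. F 0 x)) / h) \<circ> X) \<longlonglongrightarrow> (LINT x|M. D x)"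
      unfolding o_def by (simp add: LIMSEQ_offset)
  qed
  then show "((\<lambda>h. LINT x|M. F h x) has_real_derivative (LINT x|M. D x)) (at 0)"
    by (simp add: DERIV_def)
qed

text \<open>The scalar counterpart of \<open>finsler_powr_diff_bound\<close>, for the term with b:
  an increment linear in h with a majorant in |x|^s alone.\<close>

lemma abs_powr_diff_bound:
  fixes s B :: real
  assumes s: "1 < s" and B: "0 \<le> B"
  obtains K where "0 < K"
    "\<And>x y h. \<bar>y\<bar> \<le> B \<Longrightarrow> \<bar>h\<bar> \<le> 1 \<Longrightarrow> \<bar>\<bar>x + h * y\<bar> powr s - \<bar>x\<bar> powr s\<bar> \<le> \<bar>h\<bar> * (K * (1 + \<bar>x\<bar> powr s))"
proof -
  define K0 where "K0 = s * ((1 + B) powr s * 2 powr s) * B"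
  have K0: "0 \<le> K0" using s B by (simp add: K0_def)
  have "\<bar>\<bar>x + h * y\<bar> powr s - \<bar>x\<bar> powr s\<bar> \<le> \<bar>h\<bar> * ((K0 + 1) * (1 + \<bar>x\<bar> powr s))"
    if y: "\<bar>y\<bar> \<le> B" and h: "\<bar>h\<bar> \<le> 1" for x y h
  proof -
    have "norm (\<bar>x + h * y\<bar> powr s - \<bar>x + 0 * y\<bar> powr s) \<le> (K0 * (1 + \<bar>x\<bar> powr s)) * norm (h - 0)"
    proof (rule field_differentiable_bound[of "{-1..1}" "\<lambda>t. \<bar>x + t * y\<bar> powr s"
        "\<lambda>t. s * (sgn (x + t * y) * \<bar>x + t * y\<bar> powr (s - 1)) * y"])
      fix t :: real assume t: "t \<in> {-1..1}"
      have "((\<lambda>t. \<bar>x + t * y\<bar> powr s) has_field_derivative s * (sgn (x + t * y) * \<bar>x + t * y\<bar> powr (s - 1)) * y) (at t)"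
        by (rule DERIV_chain2[OF has_real_derivative_abs_powr[OF s]]) (auto intro!: derivative_eq_intros)
      then show "((\<lambda>t. \<bar>x + t * y\<bar> powr s) has_field_derivative s * (sgn (x + t * y) * \<bar>x + t * y\<bar> powr (s - 1)) * y) (at t within {-1..1})"
        by (rule has_field_derivative_at_within)
      have "\<bar>x + t * y\<bar> \<le> \<bar>x\<bar> + \<bar>t\<bar> * \<bar>y\<bar>" using abs_triangle_ineq[of x "t * y"] by (simp add: abs_mult)
      also have "\<bar>t\<bar> * \<bar>y\<bar> \<le> 1 * B" using t y by (intro mult_mono) auto
      also have "\<bar>x\<bar> + 1 * B \<le> (1 + B) * (1 + \<bar>x\<bar>)" using B by (simp add: algebra_simps)
      finally have "\<bar>x + t * y\<bar> powr (s - 1) \<le> (1 + B) powr s * (2 powr s * (1 + \<bar>x\<bar> powr s))"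
        using s B by (intro powr_pred_le) auto
      moreover have "\<bar>sgn (x + t * y)\<bar> \<le> 1" by (simp add: sgn_if)
      ultimately have "s * (\<bar>sgn (x + t * y)\<bar> * \<bar>x + t * y\<bar> powr (s - 1)) * \<bar>y\<bar>
          \<le> s * (1 * ((1 + B) powr s * (2 powr s * (1 + \<bar>x\<bar> powr s)))) * B"
        using s y B by (intro mult_mono) auto
      then show "norm (s * (sgn (x + t * y) * \<bar>x + t * y\<bar> powr (s - 1)) * y) \<le> K0 * (1 + \<bar>x\<bar> powr s)"
        using s by (simp add: abs_mult K0_def mult_ac)
    qed (use h in auto)
    then have "\<bar>\<bar>x + h * y\<bar> powr s - \<bar>x\<bar> powr s\<bar> \<le> \<bar>h\<bar> * (K0 * (1 + \<bar>x\<bar> powr s))" by (simp add: mult.commute)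
    also have "\<dots> \<le> \<bar>h\<bar> * ((K0 + 1) * (1 + \<bar>x\<bar> powr s))"
      by (intro mult_left_mono mult_right_mono) (auto simp: add_nonneg_nonneg)
    finally show ?thesis .
  qed
  then show ?thesis using K0 by (intro that[of "K0 + 1"]) auto
qed

text \<open>The fractions x/(x + y) and y/(x + y) lie in [0, 1], where raising to a power at most 1
  does not decrease them, and they add up to 1.\<close>

lemma powr_subadditive:
  fixes x y \<theta> :: real
  assumes "0 \<le> x" "0 \<le> y" "0 < \<theta>" "\<theta> \<le> 1"
  shows "(x + y) powr \<theta> \<le> x powr \<theta> + y powr \<theta>"
proof (cases "x = 0 \<or> y = 0")
  case False
  then have pos: "0 < x" "0 < y" using assms by auto
  have *: "z / (x + y) \<le> z powr \<theta> / (x + y) powr \<theta>" if "0 < z" "z \<le> x + y" for z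
  proof -
    have "(z / (x + y)) powr 1 \<le> (z / (x + y)) powr \<theta>"
      using that pos assms by (intro powr_mono') auto
    then show ?thesis using that pos by (simp add: powr_divide)
  qed
  have "x / (x + y) + y / (x + y) \<le> (x powr \<theta> + y powr \<theta>) / (x + y) powr \<theta>"
    using *[of x] *[of y] pos by (simp add: add_divide_distrib)
  moreover have "x / (x + y) + y / (x + y) = 1" using pos by (simp add: add_divide_distrib[symmetric])
  ultimately show ?thesis using pos by (simp add: le_divide_eq)
qed auto

lemma abs_powr_diff_le:
  fixes x h \<theta> :: real
  assumes \<theta>: "0 < \<theta>" "\<theta> \<le> 1"
  shows "\<bar>\<bar>x + h\<bar> powr \<theta> - \<bar>x\<bar> powr \<theta>\<bar> \<le> \<bar>h\<bar> powr \<theta>"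
proof -
  have "\<bar>a\<bar> powr \<theta> \<le> \<bar>b\<bar> powr \<theta> + \<bar>a - b\<bar> powr \<theta>" for a b :: real
  proof -
    have "\<bar>a\<bar> powr \<theta> \<le> (\<bar>b\<bar> + \<bar>a - b\<bar>) powr \<theta>" using \<theta> by (intro powr_mono2) auto
    also have "\<dots> \<le> \<bar>b\<bar> powr \<theta> + \<bar>a - b\<bar> powr \<theta>" using \<theta> by (intro powr_subadditive) auto
    finally show ?thesis .
  qed
  from this[of "x + h" x] this[of x "x + h"] show ?thesis by (simp add: abs_le_iff)
qed

text \<open>If |h| <= x/2, the mean value theorem applies on an interval staying above x/2.
  Otherwise Hoelder continuity gives |h|^(1 - \<delta>) = |h| |h|^(-\<delta>), and |h| exceeds x/2.
  Both cases end with (x/2)^(-\<delta>), the source of the factor 2^\<delta>. In the second case x +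
  h may be negative.\<close>

lemma singular_powr_diff_bound:
  fixes x h \<delta> :: real
  assumes \<delta>: "0 < \<delta>" "\<delta> < 1" and x: "0 < x"
  shows "\<bar>\<bar>x + h\<bar> powr (1 - \<delta>) - x powr (1 - \<delta>)\<bar> \<le> 2 powr \<delta> * \<bar>h\<bar> * x powr (- \<delta>)"
proof -
  have half: "(x / 2) powr (- \<delta>) = 2 powr \<delta> * x powr (- \<delta>)"
    using x by (simp add: powr_divide powr_minus field_simps)
  show ?thesis
  proof (cases "\<bar>h\<bar> \<le> x / 2")
    case True
    have "norm (\<bar>x + h\<bar> powr (1 - \<delta>) - \<bar>x + 0\<bar> powr (1 - \<delta>)) \<le> (x / 2) powr (- \<delta>) * norm (h - 0)"
    proof (rule field_differentiable_bound[of "{-(x/2)..x/2}" "\<lambda>t. \<bar>x + t\<bar> powr (1 - \<delta>)"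
        "\<lambda>t. (1 - \<delta>) * (x + t) powr (- \<delta>)"])
      fix t assume t: "t \<in> {-(x/2)..x/2}"
      have "((\<lambda>t. (x + t) powr (1 - \<delta>)) has_field_derivative (1 - \<delta>) * (x + t) powr (- \<delta>)) (at t)"
        using t x by (auto intro!: derivative_eq_intros)
      then have "((\<lambda>t. \<bar>x + t\<bar> powr (1 - \<delta>)) has_field_derivative (1 - \<delta>) * (x + t) powr (- \<delta>)) (at t)"
        by (rule has_field_derivative_transform_within_open[of _ _ _ "{-x<..}"]) (use t x in auto)
      then show "((\<lambda>t. \<bar>x + t\<bar> powr (1 - \<delta>)) has_field_derivative (1 - \<delta>) * (x + t) powr (- \<delta>)) (at t within {-(x/2)..x/2})"
        by (rule has_field_derivative_at_within)
      have "(x + t) powr (- \<delta>) \<le> (x / 2) powr (- \<delta>)"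
        using t x \<delta> by (intro powr_mono2') auto
      then have "(1 - \<delta>) * (x + t) powr (- \<delta>) \<le> 1 * (x / 2) powr (- \<delta>)"
        using \<delta> by (intro mult_mono) auto
      then show "norm ((1 - \<delta>) * (x + t) powr (- \<delta>)) \<le> (x / 2) powr (- \<delta>)"
        using \<delta> by (simp add: abs_mult)
    qed (use True x in auto)
    then show ?thesis using x by (simp add: half mult_ac)
  next
    case False
    then have h: "x / 2 \<le> \<bar>h\<bar>" "0 < \<bar>h\<bar>" using x by auto
    have "\<bar>\<bar>x + h\<bar> powr (1 - \<delta>) - \<bar>x\<bar> powr (1 - \<delta>)\<bar> \<le> \<bar>h\<bar> powr (1 - \<delta>)"
      using \<delta> by (intro abs_powr_diff_le) auto
    also have "\<bar>h\<bar> powr (1 - \<delta>) = \<bar>h\<bar> * \<bar>h\<bar> powr (- \<delta>)"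
      using h(2) by (simp add: powr_diff powr_minus divide_inverse)
    also have "\<dots> \<le> \<bar>h\<bar> * (x / 2) powr (- \<delta>)"
      using h x \<delta> by (intro mult_left_mono powr_mono2') auto
    finally show ?thesis using x by (simp add: half mult_ac)
  qed
qed

section \<open>Mollification\<close>

definition convolve :: "('a::euclidean_space \<Rightarrow> real) \<Rightarrow> ('a \<Rightarrow> real) \<Rightarrow> 'a \<Rightarrow> real" where
  "convolve f g x = (LINT y|lborel. f y * g (x - y))"

lemma convolve_commute:
  fixes f g :: "'a::euclidean_space \<Rightarrow> real"
  assumes "continuous_on UNIV f" "continuous_on UNIV g"
  shows "convolve f g = convolve g f"
proof
  fix x
  have [measurable]: "f \<in> borel_measurable borel" "g \<in> borel_measurable borel"
    using assms by (auto intro: borel_measurable_continuous_onI)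
  have "(LINT y|lborel. f (x + (-1) *\<^sub>R y) * g (x - (x + (-1) *\<^sub>R y))) = (LINT y|lborel. f y * g (x - y))"
    by (rule integral_lborel_affine_isometry[of "\<lambda>y. f y * g (x - y)" "-1" x]) auto
  then show "convolve f g x = convolve g f x" by (simp add: convolve_def mult.commute)
qed

text \<open>The derivative falls on F, while \<open>\<eta>\<close> is only continuous with compact
  support. The lemma is used in both directions: with F the test function, to obtain the derivative
  of a mollification, and with F the bump, to see that it is smooth.\<close>

lemma convolve_has_derivative:
  fixes F \<eta> :: "real^'n \<Rightarrow> real"
  assumes F: "F \<in> Cc_1 UNIV" and \<eta>: "continuous_on UNIV \<eta>" and L: "compact L" "\<And>x. x \<notin> L \<Longrightarrow> \<eta> x = 0"
  shows "(convolve \<eta> F has_derivative (\<lambda>v. convolve \<eta> (\<lambda>z. frechet_derivative F (at z) v) x)) (at x)"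
proof -
  obtain B where B: "0 < B" "\<And>x. norm (cgrad F x) \<le> B" using Cc_1_bounds[OF F] by metis
  have cg: "continuous_on UNIV (cgrad F)" by (rule Cc_1_continuous_cgrad[OF F])
  have fd: "frechet_derivative F (at z) v = cgrad F z \<bullet> v" for z v
    by (rule frechet_derivative_eq_cgrad[OF Cc_1_D(2)[OF F]])
  have cg': "continuous_on UNIV (\<lambda>y. cgrad F (z - y))" for z
    by (intro continuous_on_compose2[OF cg] continuous_intros) auto
  have cF: "continuous_on UNIV (\<lambda>y. F (z - y))" for z
    by (intro continuous_on_compose2[OF Cc_1_D(1)[OF F]] continuous_intros) auto
  have iG: "integrable lborel (\<lambda>y. \<eta> y *\<^sub>R cgrad F (z - y))" for z
    using L by (intro integrable_continuous_compact_support(1)[of _ L] continuous_intros \<eta> cg') auto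
  have iF: "integrable lborel (\<lambda>y. \<eta> y * F (z - y))" for z
    using L by (intro integrable_continuous_compact_support(1)[of _ L] continuous_intros \<eta> cF) auto
  have i\<eta>: "integrable lborel \<eta>" by (rule integrable_continuous_compact_support(1)[OF \<eta> L])
  define G where "G = (LINT y|lborel. \<eta> y *\<^sub>R cgrad F (x - y))"
  have GD: "convolve \<eta> (\<lambda>z. frechet_derivative F (at z) v) x = G \<bullet> v" for v
    unfolding convolve_def fd G_def using integral_inner_left[OF iG, of x v] by simp
  have iGv: "integrable lborel (\<lambda>y. \<eta> y * (cgrad F (x - y) \<bullet> v))" for v
    using integrable_inner_left[of v lborel "\<lambda>y. \<eta> y *\<^sub>R cgrad F (x - y)"] iG by simp
  have "((\<lambda>h. norm (convolve \<eta> F (x + h) - convolve \<eta> F x - G \<bullet> h) / norm h) \<longlongrightarrow> 0) (at 0)"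
    unfolding tendsto_at_iff_sequentially
  proof (intro allI impI)
    fix X :: "nat \<Rightarrow> real^'n" assume X: "\<forall>i. X i \<in> UNIV - {0}" "X \<longlonglongrightarrow> 0"
    define D where "D k y = \<eta> y * ((F (x + X k - y) - F (x - y) - cgrad F (x - y) \<bullet> X k) / norm (X k))" for k y
    have "(\<lambda>k. LINT y|lborel. D k y) \<longlonglongrightarrow> (LINT y::real^'n|lborel. (0::real))"
    proof (rule integral_dominated_convergence)
      show "integrable lborel (\<lambda>y. \<bar>\<eta> y\<bar> * (2 * B))" using i\<eta> by simp
      have [measurable]: "F \<in> borel_measurable borel" "cgrad F \<in> borel_measurable borel" "\<eta> \<in> borel_measurable borel"
        using Cc_1_D(1)[OF F] cg \<eta> by (auto intro: borel_measurable_continuous_onI)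
      show "D k \<in> borel_measurable lborel" for k unfolding D_def by measurable
      \<comment> \<open>The increment of F and its linear part are each at most B times the length
        of the step, hence the 2 B.\<close>
      show "AE y in lborel. norm (D k y) \<le> \<bar>\<eta> y\<bar> * (2 * B)" for k
      proof (rule AE_I2)
        fix y
        have X0: "0 < norm (X k)" using X(1) by auto
        have "\<bar>frechet_derivative F (at z) (X k)\<bar> \<le> B * norm (X k)" for z
          unfolding fd using B by (intro order_trans[OF Cauchy_Schwarz_ineq2] mult_right_mono) auto
        from directional_MVT_bound[of F "X k", OF Cc_1_D(2)[OF F] this, of "x - y" 1] 
        have 1: "\<bar>F (x + X k - y) - F (x - y)\<bar> \<le> B * norm (X k)" by (simp add: algebra_simps)
        have 2: "\<bar>cgrad F (x - y) \<bullet> X k\<bar> \<le> B * norm (X k)"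
          using B by (intro order_trans[OF Cauchy_Schwarz_ineq2] mult_right_mono) auto
        have "\<bar>F (x + X k - y) - F (x - y) - cgrad F (x - y) \<bullet> X k\<bar> \<le> 2 * B * norm (X k)" using 1 2 by linarith
        then have "\<bar>F (x + X k - y) - F (x - y) - cgrad F (x - y) \<bullet> X k\<bar> / norm (X k) \<le> 2 * B"
          using X0 by (simp add: divide_le_eq)
        then show "norm (D k y) \<le> \<bar>\<eta> y\<bar> * (2 * B)"
          unfolding D_def using mult_left_mono[of _ _ "\<bar>\<eta> y\<bar>"] by (auto simp: abs_mult simp flip: times_divide_eq_right)
      qed
      show "AE y in lborel. (\<lambda>k. D k y) \<longlonglongrightarrow> 0"
      proof (rule AE_I2)
        fix y
        have "(F has_derivative (\<lambda>v. cgrad F (x - y) \<bullet> v)) (at (x - y))"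
        proof -
          have "frechet_derivative F (at (x - y)) = (\<lambda>v. cgrad F (x - y) \<bullet> v)" using fd by auto
          then show ?thesis using Cc_1_D(2)[OF F, of "x - y"] by (simp add: frechet_derivative_works)
        qed
        then have "((\<lambda>h. norm (F (x - y + h) - F (x - y) - cgrad F (x - y) \<bullet> h) / norm h) \<longlongrightarrow> 0) (at 0)"
          by (simp add: has_derivative_at)
        then have "(\<lambda>k. norm (F (x - y + X k) - F (x - y) - cgrad F (x - y) \<bullet> X k) / norm (X k)) \<longlonglongrightarrow> 0"
          using X unfolding tendsto_at_iff_sequentially o_def by blast
        then have "(\<lambda>k. (F (x + X k - y) - F (x - y) - cgrad F (x - y) \<bullet> X k) / norm (X k)) \<longlonglongrightarrow> 0"
          by (subst tendsto_norm_zero_iff[symmetric]) (simp add: algebra_simps)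
        then show "(\<lambda>k. D k y) \<longlonglongrightarrow> 0" unfolding D_def by (rule tendsto_mult_right_zero)
      qed
    qed simp
    moreover have "(LINT y|lborel. D k y) = (convolve \<eta> F (x + X k) - convolve \<eta> F x - G \<bullet> X k) / norm (X k)" for k
    proof -
      have "D k y = (\<eta> y * F (x + X k - y) - \<eta> y * F (x - y) - \<eta> y * (cgrad F (x - y) \<bullet> X k)) / norm (X k)" for y
        by (simp add: D_def algebra_simps diff_divide_distrib)
      then have "(LINT y|lborel. D k y) = ((LINT y|lborel. \<eta> y * F (x + X k - y)) - (LINT y|lborel. \<eta> y * F (x - y))
          - (LINT y|lborel. \<eta> y * (cgrad F (x - y) \<bullet> X k))) / norm (X k)"
        using iF[of "x + X k"] iF[of x] iGv[of "X k"] by simp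
      then show ?thesis using GD[of "X k"] by (simp add: convolve_def fd)
    qed
    ultimately have "(\<lambda>k. (convolve \<eta> F (x + X k) - convolve \<eta> F x - G \<bullet> X k) / norm (X k)) \<longlonglongrightarrow> 0" by simp
    from tendsto_norm_zero[OF this]
    show "((\<lambda>h. norm (convolve \<eta> F (x + h) - convolve \<eta> F x - G \<bullet> h) / norm h) \<circ> X) \<longlonglongrightarrow> 0"
      by (simp add: o_def)
  qed
  then show ?thesis unfolding GD has_derivative_at by (intro conjI bounded_linear_inner_right)
qed

lemma Cc_inf_directional_derivative:
  assumes F: "F \<in> Cc_inf \<Omega>" shows "(\<lambda>z. frechet_derivative F (at z) v) \<in> Cc_inf \<Omega>"
proof -
  obtain K where K: "compact K" "K \<subseteq> \<Omega>" "\<And>x. x \<notin> K \<Longrightarrow> F x = 0"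
    using F by (auto simp: Cc_inf_def compact_supp_in_def)
  have "Ck (Suc k) UNIV F" for k using F unfolding Cc_inf_def smooth_on_def by blast
  then have "Ck k UNIV (\<lambda>z. frechet_derivative F (at z) v)" for k by simp
  moreover have "compact_supp_in \<Omega> (\<lambda>z. frechet_derivative F (at z) v)"
    unfolding compact_supp_in_def
  proof (intro exI[of _ K] conjI allI impI)
    fix x assume x: "x \<notin> K"
    show "frechet_derivative F (at x) v = 0"
      by (rule frechet_derivative_zero_off_support[OF compact_imp_closed[OF K(1)] K(3) x])
  qed (use K in auto)
  ultimately show ?thesis by (simp add: Cc_inf_def smooth_on_def)
qed

lemma smooth_convolve:
  fixes F \<eta> :: "real^'n \<Rightarrow> real"
  assumes F: "F \<in> Cc_inf UNIV" and \<eta>: "continuous_on UNIV \<eta>" and L: "compact L" "\<And>x. x \<notin> L \<Longrightarrow> \<eta> x = 0"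
  shows "smooth_on UNIV (convolve \<eta> F)"
proof -
  have "Ck k UNIV (convolve \<eta> F)" for k
    using F
  proof (induction k arbitrary: F)
    case (0 F)
    have "isCont (convolve \<eta> F) x" for x
      using has_derivative_continuous[OF convolve_has_derivative[OF Cc_inf_subset_Cc_1[OF 0] \<eta> L]] .
    then show ?case by (simp add: continuous_at_imp_continuous_on)
  next
    case (Suc k F)
    note d = convolve_has_derivative[OF Cc_inf_subset_Cc_1[OF Suc.prems] \<eta> L]
    have "isCont (convolve \<eta> F) x" for x using has_derivative_continuous[OF d] .
    moreover have "convolve \<eta> F differentiable at x" for x using d differentiable_def by blast
    moreover have "Ck k UNIV (\<lambda>x. frechet_derivative (convolve \<eta> F) (at x) v)" for v
    proof -
      have "(\<lambda>x. frechet_derivative (convolve \<eta> F) (at x) v) = convolve \<eta> (\<lambda>z. frechet_derivative F (at z) v)"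
        by (rule ext) (rule frechet_derivative_apply[OF d])
      then show ?thesis using Suc.IH[OF Cc_inf_directional_derivative[OF Suc.prems]] by simp
    qed
    ultimately show ?case by (simp add: continuous_at_imp_continuous_on)
  qed
  then show ?thesis by (simp add: smooth_on_def)
qed

text \<open>Taking c = f x gives convergence of the mollifications, taking c = 0 their uniform
  bound. The kernel is not normalised, so its mass appears on both sides.\<close>

lemma convolve_average_bounds:
  fixes f \<eta> :: "real^'n \<Rightarrow> real"
  assumes \<eta>: "continuous_on UNIV \<eta>" "\<And>x. 0 \<le> \<eta> x" and L: "compact L" "\<And>x. x \<notin> L \<Longrightarrow> \<eta> x = 0"
    and f: "continuous_on UNIV f" and e: "\<And>y. y \<in> L \<Longrightarrow> \<bar>f (x - y) - c\<bar> \<le> e"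
  shows "\<bar>convolve \<eta> f x - c * (LINT y|lborel. \<eta> y)\<bar> \<le> e * (LINT y|lborel. \<eta> y)"
proof -
  have cf: "continuous_on UNIV (\<lambda>y. f (x - y))"
    by (intro continuous_on_compose2[OF f] continuous_intros) auto
  have i\<eta>: "integrable lborel \<eta>" by (rule integrable_continuous_compact_support(1)[OF \<eta>(1) L])
  have i1: "integrable lborel (\<lambda>y. \<eta> y * f (x - y))"
    using L by (intro integrable_continuous_compact_support(1)[of _ L] continuous_intros \<eta> cf) auto
  have "convolve \<eta> f x - c * (LINT y|lborel. \<eta> y) = (LINT y|lborel. \<eta> y * f (x - y) - c * \<eta> y)"
    unfolding convolve_def using i1 i\<eta> by simp
  also have "\<bar>\<dots>\<bar> \<le> (LINT y|lborel. \<bar>\<eta> y * f (x - y) - c * \<eta> y\<bar>)" by (rule integral_abs_bound)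
  also have "\<dots> \<le> (LINT y|lborel. e * \<eta> y)"
  proof (rule integral_mono)
    fix y
    have "\<eta> y * f (x - y) - c * \<eta> y = \<eta> y * (f (x - y) - c)" by (simp add: algebra_simps)
    then have "\<bar>\<eta> y * f (x - y) - c * \<eta> y\<bar> = \<eta> y * \<bar>f (x - y) - c\<bar>"
      using \<eta>(2)[of y] by (simp add: abs_mult)
    also have "\<dots> \<le> e * \<eta> y"
      using e[of y] L(2)[of y] \<eta>(2)[of y] by (cases "y \<in> L") (auto simp: mult.commute[of e] intro: mult_left_mono)
    finally show "\<bar>\<eta> y * f (x - y) - c * \<eta> y\<bar> \<le> e * \<eta> y" .
  qed (use i1 i\<eta> in auto)
  finally show ?thesis by simp
qed

lemma Cc_1_approximation:
  fixes \<phi> :: "real^'n \<Rightarrow> real"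
  assumes \<Omega>: "open \<Omega>" and \<phi>: "\<phi> \<in> Cc_1 \<Omega>"
  obtains \<psi> K B where "\<And>n::nat. \<psi> n \<in> Cc_inf \<Omega>" "compact K" "K \<subseteq> \<Omega>" "\<And>n x. x \<notin> K \<Longrightarrow> \<psi> n x = 0"
    "\<And>n x. \<bar>\<psi> n x\<bar> \<le> B" "\<And>n x. norm (cgrad (\<psi> n) x) \<le> B"
    "\<And>x. (\<lambda>n. \<psi> n x) \<longlonglongrightarrow> \<phi> x" "\<And>x. (\<lambda>n. cgrad (\<psi> n) x) \<longlonglongrightarrow> cgrad \<phi> x"
proof -
  have \<phi>U: "\<phi> \<in> Cc_1 UNIV" by (rule Cc_1_subset[OF _ \<phi>]) simp
  obtain K where K: "compact K" "K \<subseteq> \<Omega>" "\<And>x. x \<notin> K \<Longrightarrow> \<phi> x = 0" using Cc_1_D(4)[OF \<phi>] by blast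
  obtain e where e: "0 < e" "(\<Union>x\<in>K. ball x e) \<subseteq> \<Omega>"
    using compact_subset_open_imp_ball_epsilon_subset[OF K(1) \<Omega> K(2)] by blast
  \<comment> \<open>This closed e/2-neighbourhood of the support still lies in the domain and
    contains the supports of all mollifications.\<close>
  define K1 where "K1 = {x + y | x y. x \<in> K \<and> y \<in> cball 0 (e / 2)}"
  have K1: "compact K1" unfolding K1_def by (intro compact_sums K(1) compact_cball)
  have K1\<Omega>: "K1 \<subseteq> \<Omega>"
  proof
    fix z assume "z \<in> K1"
    then obtain x y where "z = x + y" "x \<in> K" "norm y \<le> e / 2" by (auto simp: K1_def)
    then have "z \<in> ball x e" "x \<in> K" using e(1) by (auto simp: dist_norm)
    then show "z \<in> \<Omega>" using e(2) by blast
  qed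
  \<comment> \<open>The half side is chosen so that a point of the n-th box has l1 norm, hence
    Euclidean norm, at most (e/2)/(n + 1).\<close>
  define s where "s n = e / (2 * real CARD('n)) / real (Suc n)" for n
  have s: "0 < s n" for n using e(1) by (simp add: s_def)
  define b :: "nat \<Rightarrow> real^'n" where "b n = (\<chi> i. s n)" for n
  define L where "L n = cbox (- b n) (b n)" for n
  have Lnorm: "norm y \<le> e / 2 / real (Suc n)" if "y \<in> L n" for y n
  proof -
    have "norm y \<le> (\<Sum>i\<in>UNIV. \<bar>y $ i\<bar>)" by (rule norm_le_l1_cart)
    also have "\<dots> \<le> (\<Sum>i\<in>(UNIV::'n set). s n)"
      using that by (intro sum_mono) (auto simp: L_def b_def mem_box_cart abs_le_iff minus_le_iff)
    also have "\<dots> = e / 2 / real (Suc n)" by (simp add: s_def del: of_nat_Suc)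
    finally show ?thesis .
  qed
  define \<eta> where "\<eta> n = box_bump 1 (- b n) (b n)" for n
  have \<eta>inf: "\<eta> n \<in> Cc_inf UNIV" for n unfolding \<eta>_def by (rule box_bump_in_Cc_inf) auto
  have \<eta>c: "continuous_on UNIV (\<eta> n)" for n by (rule Cc_1_D(1)[OF Cc_inf_subset_Cc_1[OF \<eta>inf]])
  have \<eta>0: "\<eta> n y = 0" if "y \<notin> L n" for n y
    unfolding \<eta>_def using that box_subset_cbox by (intro box_bump_zero) (auto simp: L_def)
  have \<eta>n: "0 \<le> \<eta> n y" for n y unfolding \<eta>_def by (rule box_bump_nonneg)
  have L: "compact (L n)" for n unfolding L_def by (rule compact_cbox)
  define c where "c n = (LINT y|lborel. \<eta> n y)" for n
  have c: "0 < c n" for n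
  proof -
    have i: "integrable lborel (\<eta> n)" by (rule integrable_continuous_compact_support(1)[OF \<eta>c L \<eta>0])
    have "0 \<noteq> c n"
    proof
      assume "0 = c n"
      then have "AE y in lborel. \<eta> n y = 0"
        using integral_nonneg_eq_0_iff_AE[OF i] \<eta>n by (simp add: c_def)
      then have "AE y in lborel. y \<notin> box (- b n) (b n)"
        by eventually_elim (use box_bump_pos[of 1] in \<open>force simp: \<eta>_def\<close>)
      then have "emeasure lborel (box (- b n) (b n)) = 0"
        by (subst (asm) AE_iff_measurable[of "box (- b n) (b n)"]) auto
      moreover have "emeasure lborel (box (- b n) (b n)) = ennreal (\<Prod>i\<in>Basis. (b n - - b n) \<bullet> i)"
        using less_imp_le[OF s[of n]] by (intro emeasure_lborel_box) (auto simp: Basis_vec_def b_def inner_axis)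
      moreover have "0 < (\<Prod>i\<in>(Basis::(real^'n) set). (b n - - b n) \<bullet> i)"
        using s by (intro prod_pos) (auto simp: Basis_vec_def b_def inner_axis)
      ultimately show False by (metis ennreal_eq_0_iff not_le)
    qed
    moreover have "0 \<le> c n" unfolding c_def using \<eta>n by (intro Bochner_Integration.integral_nonneg) auto
    ultimately show ?thesis by simp
  qed
  have avg: "(\<lambda>n. convolve (\<eta> n) f x / c n) \<longlonglongrightarrow> f x" if f: "continuous_on UNIV f" for f x
  proof (rule tendstoI)
    fix r :: real assume r: "0 < r"
    obtain d where d: "0 < d" "\<And>z. dist z x < d \<Longrightarrow> dist (f z) (f x) < r / 2"
    proof -
      have "isCont f x" using f by (simp add: continuous_on_eq_continuous_at)
      then show thesis using that r unfolding continuous_at_eps_delta by (meson half_gt_zero)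
    qed
    have "(\<lambda>n. e / 2 * inverse (real (Suc n))) \<longlonglongrightarrow> e / 2 * 0" by (intro tendsto_intros LIMSEQ_inverse_real_of_nat)
    then have "\<forall>\<^sub>F n in sequentially. e / 2 / real (Suc n) < d"
      using d(1) unfolding divide_inverse[of _ "real (Suc _)"] mult_zero_right by (rule order_tendstoD(2))
    then show "\<forall>\<^sub>F n in sequentially. dist (convolve (\<eta> n) f x / c n) (f x) < r"
    proof eventually_elim
      case (elim n)
      have "\<bar>convolve (\<eta> n) f x - f x * c n\<bar> \<le> r / 2 * c n"
        unfolding c_def
      proof (rule convolve_average_bounds[OF \<eta>c \<eta>n L \<eta>0 f])
        fix y assume "y \<in> L n"
        then have "norm y < d" using Lnorm elim by fastforce
        then show "\<bar>f (x - y) - f x\<bar> \<le> r / 2" using d(2)[of "x - y"] by (simp add: dist_norm)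
      qed
      moreover have "convolve (\<eta> n) f x / c n - f x = (convolve (\<eta> n) f x - f x * c n) / c n"
        using c[of n] by (simp add: field_simps)
      ultimately have "\<bar>convolve (\<eta> n) f x / c n - f x\<bar> \<le> r / 2"
        using c[of n] by (simp add: divide_le_eq)
      then show ?case using r by (simp add: dist_real_def)
    qed
  qed
  have bd: "\<bar>convolve (\<eta> n) f x / c n\<bar> \<le> B" if f: "continuous_on UNIV f" and B: "\<And>z. \<bar>f z\<bar> \<le> B" for f x n B
  proof -
    have "\<bar>convolve (\<eta> n) f x - 0 * c n\<bar> \<le> B * c n"
      unfolding c_def using B by (intro convolve_average_bounds[OF \<eta>c \<eta>n L \<eta>0 f]) auto
    then show ?thesis using c[of n] by (simp add: divide_le_eq)
  qed
  define \<psi> where "\<psi> n x = convolve (\<eta> n) \<phi> x / c n" for n x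
  have \<psi>d: "frechet_derivative (\<psi> n) (at x) v = convolve (\<eta> n) (\<lambda>z. frechet_derivative \<phi> (at z) v) x / c n" for n x v
  proof -
    have "((\<lambda>x. convolve (\<eta> n) \<phi> x / c n) has_derivative (\<lambda>v. convolve (\<eta> n) (\<lambda>z. frechet_derivative \<phi> (at z) v) x / c n)) (at x)"
      unfolding divide_inverse by (intro has_derivative_mult_left convolve_has_derivative[OF \<phi>U \<eta>c L \<eta>0])
    then show ?thesis unfolding \<psi>_def[abs_def] by (rule frechet_derivative_apply)
  qed
  obtain B where B: "0 < B" "\<And>x. \<bar>\<phi> x\<bar> \<le> B" "\<And>x. norm (cgrad \<phi> x) \<le> B"
    using Cc_1_bounds[OF \<phi>] by blast
  have Bc: "\<bar>frechet_derivative \<phi> (at x) (axis i 1)\<bar> \<le> B" for x i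
    using order_trans[OF component_le_norm_cart B(3), of x i] by (simp add: cgrad_def)
  show ?thesis
  \<comment> \<open>B bounds the functions, and N times B the gradients, since each partial
    derivative is averaged separately and the l1 norm dominates; the sum of the two covers
    both.\<close>
  proof (rule that[of \<psi> K1 "B * (1 + real CARD('n))"])
    show "compact K1" "K1 \<subseteq> \<Omega>" by fact+
    show z: "\<psi> n x = 0" if "x \<notin> K1" for n x
    proof -
      have "\<eta> n y * \<phi> (x - y) = 0" for y
      proof (cases "y \<in> L n")
        case True
        have "norm y \<le> e / 2"
        proof -
          have "e / 2 / real (Suc n) \<le> e / 2 / 1" using e(1) by (intro divide_left_mono) auto
          from order_trans[OF Lnorm[OF True] this] show ?thesis by simp
        qed
        then have "x - y \<notin> K" using that unfolding K1_def by (force intro: exI[of _ "x - y"])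
        then show ?thesis using K(3) by simp
      qed (simp add: \<eta>0)
      then have "convolve (\<eta> n) \<phi> x = (LINT y::real^'n|lborel. 0)"
        unfolding convolve_def by (intro Bochner_Integration.integral_cong) simp_all
      then show ?thesis by (simp add: \<psi>_def)
    qed
    have "smooth_on UNIV (\<psi> n)" for n
    proof -
      \<comment> \<open>Smoothness is read off with the roles exchanged, so that all derivatives
        fall on the bump.\<close>
      have "smooth_on UNIV (convolve \<phi> (\<eta> n))" by (rule smooth_convolve[OF \<eta>inf Cc_1_D(1)[OF \<phi>] K(1,3)])
      then have "Ck k UNIV (\<lambda>x. convolve (\<eta> n) \<phi> x * (1 / c n))" for k
        unfolding convolve_commute[OF \<eta>c Cc_1_D(1)[OF \<phi>]] by (intro Ck_mult Ck_const) (simp add: smooth_on_def)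
      then show ?thesis by (simp add: smooth_on_def \<psi>_def[abs_def])
    qed
    then show "\<psi> n \<in> Cc_inf \<Omega>" for n
      using K1 K1\<Omega> z by (auto simp: Cc_inf_def compact_supp_in_def)
    show "\<bar>\<psi> n x\<bar> \<le> B * (1 + real CARD('n))" for n x
    proof -
      have "\<bar>\<psi> n x\<bar> \<le> B" unfolding \<psi>_def by (rule bd[OF Cc_1_D(1)[OF \<phi>] B(2)])
      also have "\<dots> \<le> B * (1 + real CARD('n))" using B(1) by (simp add: algebra_simps)
      finally show ?thesis .
    qed
    show "norm (cgrad (\<psi> n) x) \<le> B * (1 + real CARD('n))" for n x
    proof -
      have "norm (cgrad (\<psi> n) x) \<le> (\<Sum>i\<in>UNIV. \<bar>cgrad (\<psi> n) x $ i\<bar>)" by (rule norm_le_l1_cart)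
      also have "\<dots> \<le> (\<Sum>i\<in>(UNIV::'n set). B)"
        using bd[OF Cc_1_D(3)[OF \<phi>] Bc] by (intro sum_mono) (simp add: cgrad_def \<psi>d)
      also have "\<dots> \<le> B * (1 + real CARD('n))" using B(1) by (simp add: algebra_simps)
      finally show ?thesis .
    qed
    show "(\<lambda>n. \<psi> n x) \<longlonglongrightarrow> \<phi> x" for x
      unfolding \<psi>_def by (rule avg[OF Cc_1_D(1)[OF \<phi>]])
    show "(\<lambda>n. cgrad (\<psi> n) x) \<longlonglongrightarrow> cgrad \<phi> x" for x
      using avg[OF Cc_1_D(3)[OF \<phi>]] by (intro vec_tendstoI) (simp add: cgrad_def \<psi>d)
  qed
qed

section \<open>The fibering argument\<close>

locale critical_problem = finsler_double_phase p q \<mu> \<Omega> H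
  for p q and \<mu> :: "real^'n \<Rightarrow> real" and \<Omega> and H +
  fixes a b :: "real^'n \<Rightarrow> real" and \<delta> lam r :: real
  assumes r_eq: "r = pstar (real CARD('n)) p"
    and N: "2 \<le> CARD('n)" "p < real CARD('n)"
    and \<delta>: "0 < \<delta>" "\<delta> < 1"
    and a_pos: "AE x in lebesgue_on \<Omega>. 0 < a x"
    and a_measurable [measurable]: "a \<in> borel_measurable (lebesgue_on \<Omega>)"
    and a_power: "(\<integral>\<^sup>+ x. ennreal (\<bar>a x\<bar> powr (r / (r - 1 + \<delta>))) \<partial>lebesgue_on \<Omega>) < \<infinity>"
    and b_measurable [measurable]: "b \<in> borel_measurable (lebesgue_on \<Omega>)"
    and b_bounded: "\<exists>C. AE x in lebesgue_on \<Omega>. \<bar>b x\<bar> \<le> C"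
begin

abbreviation "I \<equiv> Ifun H p q \<mu> \<Omega> a b \<delta> lam"
abbreviation "MP \<equiv> Mplus H p q \<mu> \<Omega> a b \<delta> lam"

lemma r_gt: "p < r" "1 < r"
proof -
  have "p * (real CARD('n) - p) < real CARD('n) * p" using pq N by (simp add: algebra_simps)
  then show "p < r" using pq N by (simp add: r_eq pstar_def less_divide_eq)
  then show "1 < r" using pq by simp
qed

lemma W0_measurable: "w \<in> W \<Longrightarrow> w \<in> borel_measurable M"
  using W0_D(3) by (simp add: in_LH_def)

lemma integrable_b_mult:
  assumes "integrable M f" shows "integrable M (\<lambda>x. b x * f x)"
proof -
  obtain C where C: "AE x in M. \<bar>b x\<bar> \<le> C" using b_bounded by blast
  show ?thesis
  proof (rule Bochner_Integration.integrable_bound)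
    show "integrable M (\<lambda>x. C * f x)" using assms by simp
    show "(\<lambda>x. b x * f x) \<in> borel_measurable M" using assms by measurable
    show "AE x in M. norm (b x * f x) \<le> norm (C * f x)"
      using C by eventually_elim (auto simp: abs_mult intro!: mult_right_mono)
  qed
qed

text \<open>The exponents r/(r - 1 + \<delta>) and r/(1 - \<delta>) are conjugate, so Young's
  inequality bounds the product by an integrable power of a plus |f|^r.\<close>

lemma integrable_a_powr:
  assumes f: "f \<in> borel_measurable M" and i: "integrable M (\<lambda>x. \<bar>f x\<bar> powr r)"
  shows "integrable M (\<lambda>x. a x * \<bar>f x\<bar> powr (1 - \<delta>))"
proof -
  define s where "s = r / (r - 1 + \<delta>)"
  have s: "1 < s" using r_gt \<delta> by (simp add: s_def less_divide_eq)
  have s': "1 < r / (1 - \<delta>)" using r_gt \<delta> by (simp add: less_divide_eq)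
  have ss: "1 / s + 1 / (r / (1 - \<delta>)) = 1"
    using r_gt \<delta> by (simp add: s_def add_divide_distrib[symmetric])
  have ia: "integrable M (\<lambda>x. \<bar>a x\<bar> powr s)"
    using a_power by (intro integrableI_nonneg) (auto simp: s_def)
  show ?thesis
  proof (rule Bochner_Integration.integrable_bound)
    show "integrable M (\<lambda>x. \<bar>a x\<bar> powr s / s + \<bar>f x\<bar> powr r / (r / (1 - \<delta>)))"
      using ia i by (intro Bochner_Integration.integrable_add integrable_divide)
    show "(\<lambda>x. a x * \<bar>f x\<bar> powr (1 - \<delta>)) \<in> borel_measurable M" using f by measurable
    show "AE x in M. norm (a x * \<bar>f x\<bar> powr (1 - \<delta>)) \<le> norm (\<bar>a x\<bar> powr s / s + \<bar>f x\<bar> powr r / (r / (1 - \<delta>)))"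
    proof (rule AE_I2)
      fix x
      have "\<bar>a x\<bar> * \<bar>f x\<bar> powr (1 - \<delta>) \<le> \<bar>a x\<bar> powr s / s + (\<bar>f x\<bar> powr (1 - \<delta>)) powr (r / (1 - \<delta>)) / (r / (1 - \<delta>))"
        using s s' ss by (intro Youngs_inequality) auto
      moreover have "(\<bar>f x\<bar> powr (1 - \<delta>)) powr (r / (1 - \<delta>)) = \<bar>f x\<bar> powr r"
        using \<delta> by (simp add: powr_powr)
      ultimately show "norm (a x * \<bar>f x\<bar> powr (1 - \<delta>)) \<le> norm (\<bar>a x\<bar> powr s / s + \<bar>f x\<bar> powr r / (r / (1 - \<delta>)))"
        by (auto simp: abs_mult intro: order_trans[OF _ abs_ge_self])
    qed
  qed
qed

lemma W0_integrable_critical: "w \<in> W \<Longrightarrow> integrable M (\<lambda>x. \<bar>w x\<bar> powr r)"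
  unfolding r_eq by (rule W0_integrable_pstar[OF _ N])

lemma W0_integrable_a:
  "w \<in> W \<Longrightarrow> integrable M (\<lambda>x. a x * \<bar>w x\<bar> powr (1 - \<delta>))"
  by (intro integrable_a_powr W0_measurable W0_integrable_critical)

text \<open>Integrability of both gradient terms is what allows the integral to be split. After
  splitting, the energy along a ray is an explicit sum of four powers of t.\<close>

lemma Ifun_split:
  assumes w: "w \<in> W"
  shows "I w = (LINT x|M. H (gr w x) powr p) / p + (LINT x|M. \<mu> x * H (gr w x) powr q) / q
    - (LINT x|M. a x * \<bar>w x\<bar> powr (1 - \<delta>)) / (1 - \<delta>) - lam * (LINT x|M. b x * \<bar>w x\<bar> powr r) / r"
  unfolding Ifun_def LINT_eq_lebesgue_on[OF domain_lebesgue] r_eq[symmetric]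
  using W0_integrable_gradient[OF w] by simp

lemma dphi1_split:
  assumes w: "w \<in> W"
  shows "dphi1 H p q \<mu> \<Omega> a b \<delta> lam w = (LINT x|M. H (gr w x) powr p) + (LINT x|M. \<mu> x * H (gr w x) powr q)
    - (LINT x|M. a x * \<bar>w x\<bar> powr (1 - \<delta>)) - lam * (LINT x|M. b x * \<bar>w x\<bar> powr r)"
  unfolding dphi1_def LINT_eq_lebesgue_on[OF domain_lebesgue] r_eq[symmetric]
  using W0_integrable_gradient[OF w] by simp

lemma dphi2_split:
  assumes w: "w \<in> W"
  shows "dphi2 H p q \<mu> \<Omega> a b \<delta> lam w = (p - 1) * (LINT x|M. H (gr w x) powr p) + (q - 1) * (LINT x|M. \<mu> x * H (gr w x) powr q)
    + \<delta> * (LINT x|M. a x * \<bar>w x\<bar> powr (1 - \<delta>)) - lam * (r - 1) * (LINT x|M. b x * \<bar>w x\<bar> powr r)"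
  unfolding dphi2_def LINT_eq_lebesgue_on[OF domain_lebesgue] r_eq[symmetric]
  using W0_integrable_gradient[OF w] by (simp add: mult.assoc)

end

locale critical_minimiser = critical_problem p q \<mu> \<Omega> H a b \<delta> lam r
  for p q and \<mu> :: "real^'n \<Rightarrow> real" and \<Omega> and H a b \<delta> lam r +
  fixes u :: "real^'n \<Rightarrow> real"
  assumes u_Mplus: "u \<in> Mplus H p q \<mu> \<Omega> a b \<delta> lam"
    and u_nonneg: "AE x in lebesgue_on \<Omega>. 0 \<le> u x"
    and u_minimal: "\<And>v. v \<in> Mplus H p q \<mu> \<Omega> a b \<delta> lam \<Longrightarrow>
      Ifun H p q \<mu> \<Omega> a b \<delta> lam u \<le> Ifun H p q \<mu> \<Omega> a b \<delta> lam v"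
begin

lemma u_W: "u \<in> W"
  using u_Mplus by (simp add: Mplus_def)

lemma u_measurable [measurable]: "u \<in> borel_measurable M"
  by (rule W0_measurable[OF u_W])

lemma gr_u_measurable [measurable]: "gr u \<in> borel_measurable M"
  by (rule W0_D(2)[OF u_W])

text \<open>For \<open>\<epsilon>\<close> and \<open>t > 0\<close>, \<open>fib \<phi> \<epsilon> t\<close> is the energy of \<open>t (u + \<epsilon> \<phi>)\<close>; its derivatives \<open>fib1\<close> and \<open>fib2\<close> in \<open>t\<close>
  decide whether this function lies on the Nehari manifold.\<close>
definition A :: "(real^'n \<Rightarrow> real) \<Rightarrow> real \<Rightarrow> real" where
  "A \<phi> \<epsilon> = (LINT x|M. H (gr u x + \<epsilon> *\<^sub>R cgrad \<phi> x) powr p)"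

definition B :: "(real^'n \<Rightarrow> real) \<Rightarrow> real \<Rightarrow> real" where
  "B \<phi> \<epsilon> = (LINT x|M. \<mu> x * H (gr u x + \<epsilon> *\<^sub>R cgrad \<phi> x) powr q)"

definition S :: "(real^'n \<Rightarrow> real) \<Rightarrow> real \<Rightarrow> real" where
  "S \<phi> \<epsilon> = (LINT x|M. a x * \<bar>u x + \<epsilon> * \<phi> x\<bar> powr (1 - \<delta>))"

definition T :: "(real^'n \<Rightarrow> real) \<Rightarrow> real \<Rightarrow> real" where
  "T \<phi> \<epsilon> = (LINT x|M. b x * \<bar>u x + \<epsilon> * \<phi> x\<bar> powr r)"

definition fib :: "(real^'n \<Rightarrow> real) \<Rightarrow> real \<Rightarrow> real \<Rightarrow> real" where
  "fib \<phi> \<epsilon> t = t powr p * A \<phi> \<epsilon> / p + t powr q * B \<phi> \<epsilon> / q - t powr (1 - \<delta>) * S \<phi> \<epsilon> / (1 - \<delta>) - lam * (t powr r * T \<phi> \<epsilon>) / r"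

definition fib1 :: "(real^'n \<Rightarrow> real) \<Rightarrow> real \<Rightarrow> real \<Rightarrow> real" where
  "fib1 \<phi> \<epsilon> t = t powr (p - 1) * A \<phi> \<epsilon> + t powr (q - 1) * B \<phi> \<epsilon> - t powr (- \<delta>) * S \<phi> \<epsilon> - lam * (t powr (r - 1) * T \<phi> \<epsilon>)"

definition fib2 :: "(real^'n \<Rightarrow> real) \<Rightarrow> real \<Rightarrow> real \<Rightarrow> real" where
  "fib2 \<phi> \<epsilon> t = (p - 1) * t powr (p - 2) * A \<phi> \<epsilon> + (q - 1) * t powr (q - 2) * B \<phi> \<epsilon>
    + \<delta> * t powr (- \<delta> - 1) * S \<phi> \<epsilon> - lam * ((r - 1) * t powr (r - 2) * T \<phi> \<epsilon>)"

text \<open>The function t (u + epsilon phi), written in the form c u + d phi of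
  \<open>W0_perturb\<close>.\<close>

abbreviation pert :: "(real^'n \<Rightarrow> real) \<Rightarrow> real \<Rightarrow> real \<Rightarrow> real^'n \<Rightarrow> real" where
  "pert \<phi> \<epsilon> t \<equiv> (\<lambda>x. t * u x + (t * \<epsilon>) * \<phi> x)"

section \<open>The energy along the rays through u + epsilon phi\<close>

lemma pert_integrals:
  assumes \<phi>: "\<phi> \<in> Cc_inf \<Omega>" and t: "0 < t"
  shows "(LINT x|M. H (gr (pert \<phi> \<epsilon> t) x) powr p) = t powr p * A \<phi> \<epsilon>"
    "(LINT x|M. \<mu> x * H (gr (pert \<phi> \<epsilon> t) x) powr q) = t powr q * B \<phi> \<epsilon>"
    "(LINT x|M. a x * \<bar>pert \<phi> \<epsilon> t x\<bar> powr (1 - \<delta>)) = t powr (1 - \<delta>) * S \<phi> \<epsilon>"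
    "(LINT x|M. b x * \<bar>pert \<phi> \<epsilon> t x\<bar> powr r) = t powr r * T \<phi> \<epsilon>"
proof -
  note m = continuous_imp_measurable_lebesgue_on[OF Cc_1_D(1)[OF Cc_inf_subset_Cc_1[OF \<phi>]]]
    continuous_imp_measurable_lebesgue_on[OF Cc_1_continuous_cgrad[OF Cc_inf_subset_Cc_1[OF \<phi>]]]
  have gm: "(\<lambda>x. H (gr u x + \<epsilon> *\<^sub>R cgrad \<phi> x)) \<in> borel_measurable M"
    using m by (intro finsler_compose_measurable) measurable
  have gm': "(\<lambda>x. H (gr (pert \<phi> \<epsilon> t) x)) \<in> borel_measurable M"
    by (intro finsler_compose_measurable W0_D(2) W0_perturb(1) u_W \<phi> t)
  have eq: "AE x in M. H (gr (pert \<phi> \<epsilon> t) x) = t * H (gr u x + \<epsilon> *\<^sub>R cgrad \<phi> x)"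
    using W0_perturb(2)[OF u_W \<phi> t, of "t * \<epsilon>"]
  proof eventually_elim
    case (elim x)
    have "gr (pert \<phi> \<epsilon> t) x = t *\<^sub>R (gr u x + \<epsilon> *\<^sub>R cgrad \<phi> x)" by (simp add: elim scaleR_right_distrib)
    then show ?case using t by (simp add: finsler_scaleR[OF H])
  qed
  have "(LINT x|M. H (gr (pert \<phi> \<epsilon> t) x) powr p) = (LINT x|M. t powr p * H (gr u x + \<epsilon> *\<^sub>R cgrad \<phi> x) powr p)"
    using gm gm' by (intro integral_cong_AE) (use eq t finsler_nonneg[OF H] in \<open>auto simp: powr_mult elim!: eventually_mono\<close>)
  then show "(LINT x|M. H (gr (pert \<phi> \<epsilon> t) x) powr p) = t powr p * A \<phi> \<epsilon>" by (simp add: A_def)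
  have "(LINT x|M. \<mu> x * H (gr (pert \<phi> \<epsilon> t) x) powr q) = (LINT x|M. t powr q * (\<mu> x * H (gr u x + \<epsilon> *\<^sub>R cgrad \<phi> x) powr q))"
    using gm gm' by (intro integral_cong_AE) (use eq t finsler_nonneg[OF H] in \<open>auto simp: powr_mult elim!: eventually_mono\<close>)
  then show "(LINT x|M. \<mu> x * H (gr (pert \<phi> \<epsilon> t) x) powr q) = t powr q * B \<phi> \<epsilon>" by (simp add: B_def)
  have ab: "\<bar>pert \<phi> \<epsilon> t x\<bar> powr k = t powr k * \<bar>u x + \<epsilon> * \<phi> x\<bar> powr k" for x k
  proof -
    have "pert \<phi> \<epsilon> t x = t * (u x + \<epsilon> * \<phi> x)" by (simp add: algebra_simps)
    then show ?thesis using t by (simp only: abs_mult abs_of_pos powr_mult less_imp_le abs_ge_zero)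
  qed
  show "(LINT x|M. a x * \<bar>pert \<phi> \<epsilon> t x\<bar> powr (1 - \<delta>)) = t powr (1 - \<delta>) * S \<phi> \<epsilon>"
    unfolding S_def ab mult.left_commute[of "a _"] by (rule integral_mult_right_zero)
  show "(LINT x|M. b x * \<bar>pert \<phi> \<epsilon> t x\<bar> powr r) = t powr r * T \<phi> \<epsilon>"
    unfolding T_def ab mult.left_commute[of "b _"] by (rule integral_mult_right_zero)
qed

lemma I_pert:
  assumes "\<phi> \<in> Cc_inf \<Omega>" "0 < t" shows "I (pert \<phi> \<epsilon> t) = fib \<phi> \<epsilon> t"
  unfolding fib_def Ifun_split[OF W0_perturb(1)[OF u_W assms]] pert_integrals[OF assms] by simp

text \<open>By homogeneity the two Nehari expressions at t (u + epsilon phi) are t and t^2 times the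
  first and second derivative of the fibre map at t.\<close>

lemma pert_in_Mplus:
  assumes \<phi>: "\<phi> \<in> Cc_inf \<Omega>" and t: "0 < t" and f: "fib1 \<phi> \<epsilon> t = 0" "0 < fib2 \<phi> \<epsilon> t"
  shows "pert \<phi> \<epsilon> t \<in> MP"
proof -
  let ?w = "pert \<phi> \<epsilon> t"
  have w: "?w \<in> W" by (rule W0_perturb(1)[OF u_W \<phi> t])
  have pw: "t powr k = t * t powr (k - 1)" "t powr k = t * (t * t powr (k - 2))" for k
    using t by (auto simp: powr_diff power2_eq_square powr_numeral)
  have d1: "dphi1 H p q \<mu> \<Omega> a b \<delta> lam ?w = t * fib1 \<phi> \<epsilon> t"
    unfolding dphi1_split[OF w] pert_integrals[OF \<phi> t] fib1_def
    by (simp add: pw(1)[of p] pw(1)[of q] pw(1)[of r] pw(1)[of "1 - \<delta>"] algebra_simps)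
  have d2: "dphi2 H p q \<mu> \<Omega> a b \<delta> lam ?w = t * (t * fib2 \<phi> \<epsilon> t)"
  proof -
    \<comment> \<open>The exponent that the scaling rule produces from 1 - \<delta> has to be
      matched with the one in \<open>fib2\<close>.\<close>
    have "1 - \<delta> - 2 = - \<delta> - 1" by simp
    then obtain z where z: "t powr (- \<delta> - 1) = z" "t powr (1 - \<delta>) = t * (t * z)"
      using pw(2)[of "1 - \<delta>"] by metis
    show ?thesis
      unfolding dphi2_split[OF w] pert_integrals[OF \<phi> t] fib2_def z
      by (simp add: pw(2)[of p] pw(2)[of q] pw(2)[of r] algebra_simps)
  qed
  have pos: "0 < dphi2 H p q \<mu> \<Omega> a b \<delta> lam ?w" unfolding d2 using t f(2) by simp
  \<comment> \<open>A function vanishing almost everywhere has gradient 0 almost everywhere, so all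
    four integrals vanish and the second derivative would be 0 instead of positive.\<close>
  have "\<not> (AE x in M. ?w x = 0)"
  proof
    assume z: "AE x in M. ?w x = 0"
    have "weak_grad \<Omega> ?w (\<lambda>x. 0)"
    proof -
      have cong: "set_integrable lebesgue K ?w \<longleftrightarrow> set_integrable lebesgue K (\<lambda>x. 0)" if "K \<subseteq> \<Omega>" "compact K" for K
        using W0_D(1)[OF w] that by (auto simp: weak_grad_def set_integrable_def)
      have "(LINT x:\<Omega>|lebesgue. ?w x * cgrad \<psi> x $ i) = 0" for \<psi> i
      proof -
        have "AE x in M. ?w x * cgrad \<psi> x $ i = 0" using z by eventually_elim simp
        then show ?thesis
          unfolding LINT_eq_lebesgue_on[OF domain_lebesgue] by (rule integral_eq_zero_AE)
      qed
      then show ?thesis using cong by (auto simp: weak_grad_def set_integrable_def)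
    qed
    from wgrad_AE_eq[OF open_domain this] have g0: "AE x in M. gr ?w x = 0" .
    have "(LINT x|M. H (gr ?w x) powr p) = 0" "(LINT x|M. \<mu> x * H (gr ?w x) powr q) = 0"
      "(LINT x|M. a x * \<bar>?w x\<bar> powr (1 - \<delta>)) = 0" "(LINT x|M. b x * \<bar>?w x\<bar> powr r) = 0"
      using g0 z by (intro integral_eq_zero_AE; eventually_elim; simp add: finsler_zero[OF H])+
    then have "dphi2 H p q \<mu> \<Omega> a b \<delta> lam ?w = 0" unfolding dphi2_split[OF w] by simp
    then show False using pos by simp
  qed
  then show ?thesis using w pos d1 f(1) by (simp add: Mplus_def)
qed

section \<open>Dependence of the four integrals on epsilon\<close>

lemma derivative_A:
  assumes \<phi>: "\<phi> \<in> Cc_inf \<Omega>"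
  shows "integrable M (\<lambda>x. H (gr u x) powr (p - 1) * (fgrad H (gr u x) \<bullet> cgrad \<phi> x))"
    "(A \<phi> has_real_derivative p * (LINT x|M. H (gr u x) powr (p - 1) * (fgrad H (gr u x) \<bullet> cgrad \<phi> x))) (at 0)"
    "integrable M (\<lambda>x. \<mu> x * (H (gr u x) powr (q - 1) * (fgrad H (gr u x) \<bullet> cgrad \<phi> x)))"
    "(B \<phi> has_real_derivative q * (LINT x|M. \<mu> x * (H (gr u x) powr (q - 1) * (fgrad H (gr u x) \<bullet> cgrad \<phi> x)))) (at 0)"
proof -
  note \<phi>1 = Cc_inf_subset_Cc_1[OF \<phi>]
  obtain D where D: "0 < D" "\<And>x. \<bar>\<phi> x\<bar> \<le> D" "\<And>x. norm (cgrad \<phi> x) \<le> D" using Cc_1_bounds[OF \<phi>1] by blast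
  have \<phi>m: "cgrad \<phi> \<in> borel_measurable M"
    by (intro continuous_imp_measurable_lebesgue_on Cc_1_continuous_cgrad[OF \<phi>1])
  have gm: "(\<lambda>x. H (gr u x + h *\<^sub>R cgrad \<phi> x)) \<in> borel_measurable M" for h
    using \<phi>m by (intro finsler_compose_measurable) measurable
  have fm: "(\<lambda>x. fgrad H (gr u x)) \<in> borel_measurable M"
    by (rule measurable_compose[OF gr_u_measurable finsler_fgrad_measurable[OF H]])
  have Hm: "(\<lambda>x. H (gr u x)) \<in> borel_measurable M" by (rule finsler_compose_measurable[OF gr_u_measurable])
  have der: "((\<lambda>h. H (\<xi> + h *\<^sub>R \<eta>) powr s) has_real_derivative s * (H \<xi> powr (s - 1) * (fgrad H \<xi> \<bullet> \<eta>))) (at 0)"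
    if s: "1 < s" for s \<xi> \<eta>
    using has_real_derivative_along_line[of "\<lambda>\<xi>. H \<xi> powr s" _ \<xi> 0 \<eta>] finsler_powr_has_derivative[OF H s, of \<xi>]
    by simp
  obtain K where K: "0 < K"
    "\<And>\<xi> \<eta> t. norm \<eta> \<le> D \<Longrightarrow> \<bar>t\<bar> \<le> 1 \<Longrightarrow> \<bar>H (\<xi> + t *\<^sub>R \<eta>) powr p - H \<xi> powr p\<bar> \<le> \<bar>t\<bar> * (K * (1 + H \<xi> powr p))"
    using finsler_powr_diff_bound[OF H pq(1) less_imp_le[OF D(1)]] by metis
  have q1: "1 < q" using pq by simp
  obtain L where L: "0 < L"
    "\<And>\<xi> \<eta> t. norm \<eta> \<le> D \<Longrightarrow> \<bar>t\<bar> \<le> 1 \<Longrightarrow> \<bar>H (\<xi> + t *\<^sub>R \<eta>) powr q - H \<xi> powr q\<bar> \<le> \<bar>t\<bar> * (L * (1 + H \<xi> powr q))"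
    using finsler_powr_diff_bound[OF H q1 less_imp_le[OF D(1)]] by metis
  note IG = W0_integrable_gradient[OF u_W]
  have P: "integrable M (\<lambda>x. p * (H (gr u x) powr (p - 1) * (fgrad H (gr u x) \<bullet> cgrad \<phi> x)))"
    "((\<lambda>h. LINT x|M. H (gr u x + h *\<^sub>R cgrad \<phi> x) powr p) has_real_derivative
      (LINT x|M. p * (H (gr u x) powr (p - 1) * (fgrad H (gr u x) \<bullet> cgrad \<phi> x)))) (at 0)"
  proof -
    have i0: "integrable M (\<lambda>x. H (gr u x + 0 *\<^sub>R cgrad \<phi> x) powr p)" using IG(1) by simp
    have iw: "integrable M (\<lambda>x. K * (1 + H (gr u x) powr p))" using IG(1) integrable_const_domain[of 1] by simp
    have m: "(\<lambda>x. H (gr u x + h *\<^sub>R cgrad \<phi> x) powr p) \<in> borel_measurable M" for h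
      using gm by measurable
    have md: "(\<lambda>x. p * (H (gr u x) powr (p - 1) * (fgrad H (gr u x) \<bullet> cgrad \<phi> x))) \<in> borel_measurable M"
      using fm Hm \<phi>m by measurable
    have bd: "AE x in M. \<forall>h. \<bar>h\<bar> \<le> 1 \<longrightarrow>
      \<bar>H (gr u x + h *\<^sub>R cgrad \<phi> x) powr p - H (gr u x + 0 *\<^sub>R cgrad \<phi> x) powr p\<bar> \<le> \<bar>h\<bar> * (K * (1 + H (gr u x) powr p))"
      using K(2)[OF D(3)] by (intro AE_I2 allI impI) simp
    note R = has_real_derivative_integral[OF i0 iw m md AE_I2[OF der[OF pq(1)]] bd]
    show "integrable M (\<lambda>x. p * (H (gr u x) powr (p - 1) * (fgrad H (gr u x) \<bullet> cgrad \<phi> x)))"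
      by (rule R(1))
    show "((\<lambda>h. LINT x|M. H (gr u x + h *\<^sub>R cgrad \<phi> x) powr p) has_real_derivative
      (LINT x|M. p * (H (gr u x) powr (p - 1) * (fgrad H (gr u x) \<bullet> cgrad \<phi> x)))) (at 0)"
      by (rule R(3))
  qed
  have Q: "integrable M (\<lambda>x. \<mu> x * (q * (H (gr u x) powr (q - 1) * (fgrad H (gr u x) \<bullet> cgrad \<phi> x))))"
    "((\<lambda>h. LINT x|M. \<mu> x * H (gr u x + h *\<^sub>R cgrad \<phi> x) powr q) has_real_derivative
      (LINT x|M. \<mu> x * (q * (H (gr u x) powr (q - 1) * (fgrad H (gr u x) \<bullet> cgrad \<phi> x))))) (at 0)"
  proof -
    \<comment> \<open>The weight stays inside the majorant: only \<mu> and \<mu> H^q are known to be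
      integrable, not H^q.\<close>
    have bd: "AE x in M. \<forall>h. \<bar>h\<bar> \<le> 1 \<longrightarrow>
      \<bar>\<mu> x * H (gr u x + h *\<^sub>R cgrad \<phi> x) powr q - \<mu> x * H (gr u x + 0 *\<^sub>R cgrad \<phi> x) powr q\<bar> \<le> \<bar>h\<bar> * (L * (\<mu> x + \<mu> x * H (gr u x) powr q))"
    proof (intro AE_I2 allI impI)
      fix x and h :: real assume x: "x \<in> space M" and h: "\<bar>h\<bar> \<le> 1"
      have "\<mu> x * \<bar>H (gr u x + h *\<^sub>R cgrad \<phi> x) powr q - H (gr u x) powr q\<bar> \<le> \<mu> x * (\<bar>h\<bar> * (L * (1 + H (gr u x) powr q)))"
        using x \<mu>_nonneg by (intro mult_left_mono L(2) D(3) h) auto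
      moreover have "\<bar>\<mu> x * H (gr u x + h *\<^sub>R cgrad \<phi> x) powr q - \<mu> x * H (gr u x + 0 *\<^sub>R cgrad \<phi> x) powr q\<bar>
          = \<mu> x * \<bar>H (gr u x + h *\<^sub>R cgrad \<phi> x) powr q - H (gr u x) powr q\<bar>"
        using x \<mu>_nonneg[of x] by (simp add: abs_mult flip: right_diff_distrib)
      ultimately show "\<bar>\<mu> x * H (gr u x + h *\<^sub>R cgrad \<phi> x) powr q - \<mu> x * H (gr u x + 0 *\<^sub>R cgrad \<phi> x) powr q\<bar> \<le> \<bar>h\<bar> * (L * (\<mu> x + \<mu> x * H (gr u x) powr q))"
        by (simp add: algebra_simps)
    qed
    have i0: "integrable M (\<lambda>x. \<mu> x * H (gr u x + 0 *\<^sub>R cgrad \<phi> x) powr q)" using IG(2) by simp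
    have iw: "integrable M (\<lambda>x. L * (\<mu> x + \<mu> x * H (gr u x) powr q))" using IG(2) integrable_\<mu> by simp
    have m: "(\<lambda>x. \<mu> x * H (gr u x + h *\<^sub>R cgrad \<phi> x) powr q) \<in> borel_measurable M" for h
      using gm by measurable
    have md: "(\<lambda>x. \<mu> x * (q * (H (gr u x) powr (q - 1) * (fgrad H (gr u x) \<bullet> cgrad \<phi> x)))) \<in> borel_measurable M"
      using fm Hm \<phi>m by measurable
    note R = has_real_derivative_integral[OF i0 iw m md AE_I2[OF DERIV_cmult[OF der[OF q1]]] bd]
    show "integrable M (\<lambda>x. \<mu> x * (q * (H (gr u x) powr (q - 1) * (fgrad H (gr u x) \<bullet> cgrad \<phi> x))))"
      by (rule R(1))
    show "((\<lambda>h. LINT x|M. \<mu> x * H (gr u x + h *\<^sub>R cgrad \<phi> x) powr q) has_real_derivative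
      (LINT x|M. \<mu> x * (q * (H (gr u x) powr (q - 1) * (fgrad H (gr u x) \<bullet> cgrad \<phi> x))))) (at 0)"
      by (rule R(3))
  qed
  show "integrable M (\<lambda>x. H (gr u x) powr (p - 1) * (fgrad H (gr u x) \<bullet> cgrad \<phi> x))"
    using P(1) pq by simp
  show "(A \<phi> has_real_derivative p * (LINT x|M. H (gr u x) powr (p - 1) * (fgrad H (gr u x) \<bullet> cgrad \<phi> x))) (at 0)"
    using P(2) by (simp add: A_def[abs_def])
  show "integrable M (\<lambda>x. \<mu> x * (H (gr u x) powr (q - 1) * (fgrad H (gr u x) \<bullet> cgrad \<phi> x)))"
    using Q(1) q1 by (simp add: mult.left_commute[of _ q])
  show "(B \<phi> has_real_derivative q * (LINT x|M. \<mu> x * (H (gr u x) powr (q - 1) * (fgrad H (gr u x) \<bullet> cgrad \<phi> x)))) (at 0)"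
    using Q(2) by (simp add: B_def[abs_def] mult.left_commute[of _ q])
qed

lemma derivative_T:
  assumes \<phi>: "\<phi> \<in> Cc_inf \<Omega>"
  shows "integrable M (\<lambda>x. b x * u x powr (r - 1) * \<phi> x)"
    "(T \<phi> has_real_derivative r * (LINT x|M. b x * u x powr (r - 1) * \<phi> x)) (at 0)"
proof -
  note \<phi>1 = Cc_inf_subset_Cc_1[OF \<phi>]
  obtain D where D: "0 < D" "\<And>x. \<bar>\<phi> x\<bar> \<le> D" using Cc_1_bounds[OF \<phi>1] by metis
  have \<phi>m [measurable]: "\<phi> \<in> borel_measurable M" by (intro continuous_imp_measurable_lebesgue_on Cc_1_D(1)[OF \<phi>1])
  obtain C where C: "AE x in M. \<bar>b x\<bar> \<le> C" using b_bounded by blast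
  obtain K where K: "0 < K"
    "\<And>x y h. \<bar>y\<bar> \<le> D \<Longrightarrow> \<bar>h\<bar> \<le> 1 \<Longrightarrow> \<bar>\<bar>x + h * y\<bar> powr r - \<bar>x\<bar> powr r\<bar> \<le> \<bar>h\<bar> * (K * (1 + \<bar>x\<bar> powr r))"
    using abs_powr_diff_bound[OF r_gt(2) less_imp_le[OF D(1)]] by metis
  have iu: "integrable M (\<lambda>x. \<bar>u x\<bar> powr r)" by (rule W0_integrable_critical[OF u_W])
  have bd: "AE x in M. \<forall>h. \<bar>h\<bar> \<le> 1 \<longrightarrow> \<bar>b x * \<bar>u x + h * \<phi> x\<bar> powr r - b x * \<bar>u x + 0 * \<phi> x\<bar> powr r\<bar>
      \<le> \<bar>h\<bar> * (C * (K * (1 + \<bar>u x\<bar> powr r)))"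
    using C
  proof eventually_elim
    case (elim x)
    show ?case
    proof (intro allI impI)
      fix h :: real assume h: "\<bar>h\<bar> \<le> 1"
      have "\<bar>b x\<bar> * \<bar>\<bar>u x + h * \<phi> x\<bar> powr r - \<bar>u x\<bar> powr r\<bar> \<le> C * (\<bar>h\<bar> * (K * (1 + \<bar>u x\<bar> powr r)))"
        using elim by (intro mult_mono K(2) D(2) h) auto
      then show "\<bar>b x * \<bar>u x + h * \<phi> x\<bar> powr r - b x * \<bar>u x + 0 * \<phi> x\<bar> powr r\<bar>
          \<le> \<bar>h\<bar> * (C * (K * (1 + \<bar>u x\<bar> powr r)))"
        by (simp add: abs_mult mult.left_commute flip: right_diff_distrib)
    qed
  qed
  have der: "AE x in M. ((\<lambda>h. b x * \<bar>u x + h * \<phi> x\<bar> powr r) has_real_derivative r * (b x * u x powr (r - 1) * \<phi> x)) (at 0)"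
    using u_nonneg
  proof eventually_elim
    case (elim x)
    have "((\<lambda>h. \<bar>u x + h * \<phi> x\<bar> powr r) has_real_derivative
        r * (sgn (u x + 0 * \<phi> x) * \<bar>u x + 0 * \<phi> x\<bar> powr (r - 1)) * \<phi> x) (at 0)"
      by (rule DERIV_chain2[OF has_real_derivative_abs_powr[OF r_gt(2)]]) (auto intro!: derivative_eq_intros)
    from DERIV_cmult[OF this, of "b x"]
    show ?case
    proof (rule DERIV_cong)
      \<comment> \<open>As u >= 0, the sign disappears where u > 0; where u = 0 both sides are 0,
        since \<open>0 powr (r - 1)\<close> is 0.\<close>
      show "b x * (r * (sgn (u x + 0 * \<phi> x) * \<bar>u x + 0 * \<phi> x\<bar> powr (r - 1)) * \<phi> x) = r * (b x * u x powr (r - 1) * \<phi> x)"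
        using elim by (cases "u x = 0") (auto simp: mult_ac)
    qed
  qed
  have i0: "integrable M (\<lambda>x. b x * \<bar>u x + 0 * \<phi> x\<bar> powr r)" using integrable_b_mult[OF iu] by simp
  have iw: "integrable M (\<lambda>x. C * (K * (1 + \<bar>u x\<bar> powr r)))" using iu integrable_const_domain[of 1] by simp
  note R = has_real_derivative_integral[OF i0 iw _ _ der bd]
  have "integrable M (\<lambda>x. r * (b x * u x powr (r - 1) * \<phi> x))" by (rule R(1)) measurable
  then show "integrable M (\<lambda>x. b x * u x powr (r - 1) * \<phi> x)" using r_gt by simp
  have "((\<lambda>h. LINT x|M. b x * \<bar>u x + h * \<phi> x\<bar> powr r) has_real_derivative (LINT x|M. r * (b x * u x powr (r - 1) * \<phi> x))) (at 0)"
    by (rule R(3)) measurable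
  then show "(T \<phi> has_real_derivative r * (LINT x|M. b x * u x powr (r - 1) * \<phi> x)) (at 0)"
    by (simp add: T_def[abs_def])
qed

lemma Cc_inf_integrable_powr:
  assumes \<phi>: "\<phi> \<in> Cc_inf \<Omega>" shows "integrable M (\<lambda>x. \<bar>\<phi> x\<bar> powr r)"
proof -
  note \<phi>1 = Cc_inf_subset_Cc_1[OF \<phi>]
  obtain D where D: "0 < D" "\<And>x. \<bar>\<phi> x\<bar> \<le> D" using Cc_1_bounds[OF \<phi>1] by metis
  have [measurable]: "\<phi> \<in> borel_measurable M" by (intro continuous_imp_measurable_lebesgue_on Cc_1_D(1)[OF \<phi>1])
  show ?thesis
    by (rule Bochner_Integration.integrable_bound[OF integrable_const_domain[of "D powr r"]])
      (use D r_gt in \<open>auto intro!: AE_I2 powr_mono2\<close>)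
qed

text \<open>At this stage u may vanish on a set of positive measure and differentiability of
  \<open>S\<close> is out of reach. Hoelder continuity of |x|^(1 - \<delta>) still gives a modulus
  of order |epsilon|^(1 - \<delta>), enough for \<open>nearby_fibre_minimum\<close>.\<close>

lemma continuous_S:
  assumes \<phi>: "\<phi> \<in> Cc_inf \<Omega>"
  shows "(S \<phi> \<longlongrightarrow> S \<phi> 0) (at 0)"
proof -
  have \<phi>m [measurable]: "\<phi> \<in> borel_measurable M"
    by (intro continuous_imp_measurable_lebesgue_on Cc_1_D(1)[OF Cc_inf_subset_Cc_1[OF \<phi>]])
  define Z where "Z = (LINT x|M. a x * \<bar>\<phi> x\<bar> powr (1 - \<delta>))"
  have iZ: "integrable M (\<lambda>x. a x * \<bar>\<phi> x\<bar> powr (1 - \<delta>))"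
    by (rule integrable_a_powr[OF \<phi>m Cc_inf_integrable_powr[OF \<phi>]])
  have iS: "integrable M (\<lambda>x. a x * \<bar>u x + \<epsilon> * \<phi> x\<bar> powr (1 - \<delta>))" for \<epsilon>
    using W0_integrable_a[OF W0_perturb(1)[OF u_W \<phi>, of 1 \<epsilon>]] by simp
  have bd: "norm (S \<phi> \<epsilon> - S \<phi> 0) \<le> \<bar>\<epsilon>\<bar> powr (1 - \<delta>) * Z" for \<epsilon>
  proof -
    have e: "S \<phi> \<epsilon> - S \<phi> 0 = (LINT x|M. a x * \<bar>u x + \<epsilon> * \<phi> x\<bar> powr (1 - \<delta>) - a x * \<bar>u x + 0 * \<phi> x\<bar> powr (1 - \<delta>))"
      unfolding S_def using iS[of \<epsilon>] iS[of 0] by simp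
    have "norm (S \<phi> \<epsilon> - S \<phi> 0) \<le> (LINT x|M. norm (a x * \<bar>u x + \<epsilon> * \<phi> x\<bar> powr (1 - \<delta>) - a x * \<bar>u x + 0 * \<phi> x\<bar> powr (1 - \<delta>)))"
      unfolding e by (rule integral_norm_bound)
    also have "\<dots> \<le> (LINT x|M. \<bar>\<epsilon>\<bar> powr (1 - \<delta>) * (a x * \<bar>\<phi> x\<bar> powr (1 - \<delta>)))"
    proof (rule integral_mono_AE)
      show "AE x in M. norm (a x * \<bar>u x + \<epsilon> * \<phi> x\<bar> powr (1 - \<delta>) - a x * \<bar>u x + 0 * \<phi> x\<bar> powr (1 - \<delta>))
          \<le> \<bar>\<epsilon>\<bar> powr (1 - \<delta>) * (a x * \<bar>\<phi> x\<bar> powr (1 - \<delta>))"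
        using a_pos
      proof eventually_elim
        case (elim x)
        have "a x * \<bar>\<bar>u x + \<epsilon> * \<phi> x\<bar> powr (1 - \<delta>) - \<bar>u x\<bar> powr (1 - \<delta>)\<bar> \<le> a x * \<bar>\<epsilon> * \<phi> x\<bar> powr (1 - \<delta>)"
          using elim \<delta> by (intro mult_left_mono abs_powr_diff_le) auto
        then show ?case using elim by (simp add: abs_mult powr_mult mult.left_commute flip: right_diff_distrib)
      qed
    qed (use iS[of \<epsilon>] iS[of 0] iZ in auto)
    also have "\<dots> = \<bar>\<epsilon>\<bar> powr (1 - \<delta>) * Z" by (simp add: Z_def)
    finally show ?thesis .
  qed
  have "((\<lambda>\<epsilon>::real. \<bar>\<epsilon>\<bar> powr (1 - \<delta>)) \<longlongrightarrow> 0) (at 0)" using \<delta> by (simp add: tendsto_abs_powr_0)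
  then have "((\<lambda>\<epsilon>::real. \<bar>\<epsilon>\<bar> powr (1 - \<delta>) * Z) \<longlongrightarrow> 0) (at 0)" by (rule tendsto_mult_left_zero)
  then have "((\<lambda>\<epsilon>. S \<phi> \<epsilon> - S \<phi> 0) \<longlongrightarrow> 0) (at 0)"
    by (rule Lim_null_comparison[rotated]) (use bd in simp)
  then show ?thesis by (simp add: LIM_zero_iff)
qed

lemma local_minimum:
  assumes \<phi>: "\<phi> \<in> Cc_inf \<Omega>"
  shows "\<forall>\<^sub>F \<epsilon> in nhds 0. fib \<phi> 0 1 \<le> fib \<phi> \<epsilon> 1"
proof -
  have cA: "(A \<phi> \<longlongrightarrow> A \<phi> 0) (nhds 0)" "(B \<phi> \<longlongrightarrow> B \<phi> 0) (nhds 0)" "(T \<phi> \<longlongrightarrow> T \<phi> 0) (nhds 0)"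
    using DERIV_isCont[OF derivative_A(2)[OF \<phi>]] DERIV_isCont[OF derivative_A(4)[OF \<phi>]] DERIV_isCont[OF derivative_T(2)[OF \<phi>]]
    by (auto simp: isCont_def tendsto_at_iff_tendsto_nhds)
  have cS: "(S \<phi> \<longlongrightarrow> S \<phi> 0) (nhds 0)"
    using continuous_S[OF \<phi>] by (simp add: tendsto_at_iff_tendsto_nhds)
  have f0: "u = pert \<phi> 0 1" by simp
  have crit: "fib1 \<phi> 0 1 = 0" "0 < fib2 \<phi> 0 1"
  proof -
    have "dphi1 H p q \<mu> \<Omega> a b \<delta> lam u = 0" "0 < dphi2 H p q \<mu> \<Omega> a b \<delta> lam u"
      using u_Mplus by (auto simp: Mplus_def)
    then show "fib1 \<phi> 0 1 = 0" "0 < fib2 \<phi> 0 1"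
      unfolding dphi1_split[OF u_W] dphi2_split[OF u_W] fib1_def fib2_def A_def B_def S_def T_def
      by (simp_all add: mult.assoc)
  qed
  have "\<forall>\<^sub>F \<epsilon> in nhds 0. \<exists>t>0. fib1 \<phi> \<epsilon> t = 0 \<and> 0 < fib2 \<phi> \<epsilon> t \<and> fib \<phi> \<epsilon> t \<le> fib \<phi> \<epsilon> 1"
  proof (rule nearby_fibre_minimum)
    fix \<epsilon> t :: real assume t: "0 < t"
    show "(fib \<phi> \<epsilon> has_real_derivative fib1 \<phi> \<epsilon> t) (at t)"
      unfolding fib_def[abs_def] fib1_def using t pq r_gt \<delta>
      by (auto intro!: derivative_eq_intros simp: divide_simps) (simp add: algebra_simps)
    show "(fib1 \<phi> \<epsilon> has_real_derivative fib2 \<phi> \<epsilon> t) (at t)"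
      unfolding fib1_def[abs_def] fib2_def using t
      by (auto intro!: derivative_eq_intros)
  next
    fix t :: real assume "0 < t"
    show "((\<lambda>\<epsilon>. fib1 \<phi> \<epsilon> t) \<longlongrightarrow> fib1 \<phi> 0 t) (nhds 0)"
      unfolding fib1_def by (intro tendsto_intros cA cS)
  next
    have c1: "((\<lambda>z. g (fst z)) \<longlongrightarrow> g 0) (nhds 0 \<times>\<^sub>F nhds 1)" if "(g \<longlongrightarrow> g 0) (nhds 0)" for g :: "real \<Rightarrow> real"
      by (rule filterlim_compose[OF that filterlim_fst])
    have c2: "((\<lambda>z. snd z powr k) \<longlongrightarrow> 1 powr k) (nhds (0::real) \<times>\<^sub>F nhds (1::real))" for k
      by (intro tendsto_powr tendsto_const filterlim_snd) simp
    show "((\<lambda>z. fib2 \<phi> (fst z) (snd z)) \<longlongrightarrow> fib2 \<phi> 0 1) (nhds 0 \<times>\<^sub>F nhds 1)"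
      unfolding fib2_def by (intro tendsto_add tendsto_diff tendsto_mult tendsto_const c1 c2 cA cS)
  qed (use crit in auto)
  then show ?thesis
  proof eventually_elim
    case (elim \<epsilon>)
    then obtain t where t: "0 < t" "fib1 \<phi> \<epsilon> t = 0" "0 < fib2 \<phi> \<epsilon> t" "fib \<phi> \<epsilon> t \<le> fib \<phi> \<epsilon> 1" by blast
    have "fib \<phi> 0 1 = I u" using I_pert[OF \<phi> zero_less_one, of 0] by simp
    also have "\<dots> \<le> I (pert \<phi> \<epsilon> t)" by (rule u_minimal[OF pert_in_Mplus[OF \<phi> t(1,2,3)]])
    also have "\<dots> = fib \<phi> \<epsilon> t" by (rule I_pert[OF \<phi> t(1)])
    finally show ?case using t(4) by simp
  qed
qed

end

section \<open>The Euler--Lagrange equation\<close>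

lemma Cc_inf_zero: "(\<lambda>x. 0) \<in> Cc_inf \<Omega>"
  by (auto simp: Cc_inf_def smooth_on_def Ck_const compact_supp_in_def intro: exI[of _ "{}"])

lemma Cc_inf_sum:
  assumes "\<And>i. i \<in> I \<Longrightarrow> f i \<in> Cc_inf \<Omega>"
  shows "(\<lambda>x. \<Sum>i\<in>I. f i x) \<in> Cc_inf \<Omega>"
  using assms
proof (induction I rule: infinite_finite_induct)
  case (insert i I)
  then show ?case using Cc_inf_lincomb[of "f i" \<Omega> "\<lambda>x. \<Sum>i\<in>I. f i x" 1 1] by simp
qed (auto intro: Cc_inf_zero)

text \<open>A finite sum of bumps over boxes covering K is positive on K, and dividing by its
  minimum there lifts it above 1. Nonnegative smooth functions of this kind transfer test-function
  statements to arbitrary compact subsets.\<close>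

lemma Cc_inf_dominating:
  fixes \<Omega> :: "(real^'n) set"
  assumes \<Omega>: "open \<Omega>" and K: "compact K" "K \<subseteq> \<Omega>"
  obtains \<phi> where "\<phi> \<in> Cc_inf \<Omega>" "\<And>x. 0 \<le> \<phi> x" "\<And>x. x \<in> K \<Longrightarrow> 1 \<le> \<phi> x"
proof -
  define C where "C = {(a, b). cbox a b \<subseteq> \<Omega>}"
  have "K \<subseteq> (\<Union>c\<in>C. box (fst c) (snd c))"
  proof
    fix x assume "x \<in> K"
    then obtain a b where "cbox a b \<subseteq> \<Omega>" "x \<in> box a b"
      using open_contains_cbox[OF \<Omega>, of x] K(2) by (metis subsetD)
    then have "(a, b) \<in> C" "x \<in> box (fst (a, b)) (snd (a, b))" by (auto simp: C_def)
    then show "x \<in> (\<Union>c\<in>C. box (fst c) (snd c))" by blast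
  qed
  then obtain C' where C': "C' \<subseteq> C" "finite C'" "K \<subseteq> (\<Union>c\<in>C'. box (fst c) (snd c))"
    by (rule compactE_image[OF K(1) open_box])
  define \<phi> where "\<phi> x = (\<Sum>c\<in>C'. box_bump 1 (fst c) (snd c) x)" for x
  have \<phi>: "\<phi> \<in> Cc_inf \<Omega>"
  proof -
    have "cbox (fst c) (snd c) \<subseteq> \<Omega>" if "c \<in> C'" for c
      using subsetD[OF C'(1) that] by (auto simp: C_def)
    then show ?thesis unfolding \<phi>_def by (intro Cc_inf_sum box_bump_in_Cc_inf) auto
  qed
  have nn: "0 \<le> \<phi> x" for x unfolding \<phi>_def by (intro sum_nonneg box_bump_nonneg)
  have pos: "0 < \<phi> x" if x: "x \<in> K" for x
  proof -
    obtain c where c: "c \<in> C'" "x \<in> box (fst c) (snd c)" using C'(3) x by blast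
    show ?thesis unfolding \<phi>_def
      using C'(2) c by (intro sum_pos2[of _ c] box_bump_pos box_bump_nonneg) auto
  qed
  show ?thesis
  proof (cases "K = {}")
    case True
    then show ?thesis using that[OF \<phi> nn] by simp
  next
    case False
    have "continuous_on K \<phi>"
      using Cc_1_D(1)[OF Cc_inf_subset_Cc_1[OF \<phi>]] continuous_on_subset by blast
    then obtain m where m: "m \<in> K" "\<And>x. x \<in> K \<Longrightarrow> \<phi> m \<le> \<phi> x"
      using continuous_attains_inf[OF K(1) False] by blast
    have "(\<lambda>x. (1 / \<phi> m) * \<phi> x + 0 * 0) \<in> Cc_inf \<Omega>" by (rule Cc_inf_lincomb[OF \<phi> Cc_inf_zero])
    then have "(\<lambda>x. \<phi> x / \<phi> m) \<in> Cc_inf \<Omega>" by simp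
    then show ?thesis
      using m pos[OF m(1)] nn by (intro that[of "\<lambda>x. \<phi> x / \<phi> m"]) (auto simp: le_divide_eq)
  qed
qed

lemma liminf_ennreal_top:
  assumes "filterlim f at_top sequentially"
  shows "liminf (\<lambda>n. ennreal (f n)) = top"
proof (rule ccontr)
  assume "liminf (\<lambda>n. ennreal (f n)) \<noteq> top"
  then obtain k where k: "0 \<le> k" "liminf (\<lambda>n. ennreal (f n)) = ennreal k" by (cases "liminf (\<lambda>n. ennreal (f n))") auto
  have "\<forall>\<^sub>F n in sequentially. k + 1 \<le> f n" using assms by (simp add: filterlim_at_top)
  then have "\<forall>\<^sub>F n in sequentially. ennreal (k + 1) \<le> ennreal (f n)" by eventually_elim (rule ennreal_leI)
  then have "ennreal (k + 1) \<le> liminf (\<lambda>n. ennreal (f n))" by (rule Liminf_bounded)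
  then show False using k by (simp add: ennreal_le_iff)
qed

section \<open>Positivity of the minimiser and the equation it satisfies\<close>

context critical_minimiser
begin

lemma singular_term_nonneg_test:
  assumes \<phi>: "\<phi> \<in> Cc_inf \<Omega>" and \<phi>0: "\<And>x. 0 \<le> \<phi> x"
  shows "AE x in M. 0 < \<phi> x \<longrightarrow> 0 < u x" "integrable M (\<lambda>x. a x * u x powr (- \<delta>) * \<phi> x)"
proof -
  have \<phi>m [measurable]: "\<phi> \<in> borel_measurable M"
    by (intro continuous_imp_measurable_lebesgue_on Cc_1_D(1)[OF Cc_inf_subset_Cc_1[OF \<phi>]])
  \<comment> \<open>J collects the part of the energy already known to be differentiable at 0. Local
    minimality bounds the difference quotients of S / (1 - \<delta>) by those of J, which
    converge.\<close>
  define J where "J \<epsilon> = A \<phi> \<epsilon> / p + B \<phi> \<epsilon> / q - lam * T \<phi> \<epsilon> / r" for \<epsilon>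
  define \<epsilon> where "\<epsilon> n = 1 / real (Suc n)" for n
  have \<epsilon>: "0 < \<epsilon> n" for n by (simp add: \<epsilon>_def)
  have \<epsilon>0: "\<epsilon> \<longlonglongrightarrow> 0" using LIMSEQ_inverse_real_of_nat by (simp add: \<epsilon>_def[abs_def] inverse_eq_divide)
  obtain J' where "(J has_real_derivative J') (at 0)"
    unfolding J_def[abs_def]
    using DERIV_diff[OF DERIV_add[OF DERIV_cdivide[OF derivative_A(2)[OF \<phi>], of p] DERIV_cdivide[OF derivative_A(4)[OF \<phi>], of q]]
      DERIV_cdivide[OF DERIV_cmult[OF derivative_T(2)[OF \<phi>], of lam], of r]] by blast
  then have "((\<lambda>h. (J (0 + h) - J 0) / h) \<longlongrightarrow> J') (at 0)" by (simp add: DERIV_def)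
  moreover have "filterlim \<epsilon> (at 0) sequentially" using \<epsilon>0 \<epsilon> by (auto simp: filterlim_at less_imp_neq[symmetric])
  ultimately have "(\<lambda>n. (J (0 + \<epsilon> n) - J 0) / \<epsilon> n) \<longlonglongrightarrow> J'" by (rule filterlim_compose)
  then have "\<forall>\<^sub>F n in sequentially. (J (0 + \<epsilon> n) - J 0) / \<epsilon> n < J' + 1" by (rule order_tendstoD(2)) simp
  then have "\<forall>\<^sub>F n in sequentially. (J (\<epsilon> n) - J 0) / \<epsilon> n < J' + 1" by simp
  moreover have "\<forall>\<^sub>F n in sequentially. fib \<phi> 0 1 \<le> fib \<phi> (\<epsilon> n) 1"
    using local_minimum[OF \<phi>] \<epsilon>0 by (rule eventually_compose_filterlim)
  ultimately have Sle: "\<forall>\<^sub>F n in sequentially. (S \<phi> (\<epsilon> n) - S \<phi> 0) / \<epsilon> n \<le> (1 - \<delta>) * (J' + 1)"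
  proof eventually_elim
    case (elim n)
    have "S \<phi> (\<epsilon> n) / (1 - \<delta>) - S \<phi> 0 / (1 - \<delta>) \<le> J (\<epsilon> n) - J 0"
      using elim(2) by (simp add: fib_def J_def)
    then have "(S \<phi> (\<epsilon> n) - S \<phi> 0) \<le> (1 - \<delta>) * (J (\<epsilon> n) - J 0)"
      using \<delta> by (simp add: diff_divide_distrib[symmetric] divide_le_eq mult.commute)
    then have "(S \<phi> (\<epsilon> n) - S \<phi> 0) / \<epsilon> n \<le> (1 - \<delta>) * ((J (\<epsilon> n) - J 0) / \<epsilon> n)"
      using \<epsilon>[of n] by (simp add: divide_right_mono)
    also have "\<dots> \<le> (1 - \<delta>) * (J' + 1)" using elim(1) \<delta> by (intro mult_left_mono) auto
    finally show ?case .
  qed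
  \<comment> \<open>These pointwise quotients are nonnegative because phi, u and a are, which is
    what Fatou's lemma requires.\<close>
  define g where "g n x = a x * ((\<bar>u x + \<epsilon> n * \<phi> x\<bar> powr (1 - \<delta>) - \<bar>u x\<bar> powr (1 - \<delta>)) / \<epsilon> n)" for n x
  have gm [measurable]: "g n \<in> borel_measurable M" for n unfolding g_def by measurable
  have g0: "AE x in M. 0 \<le> g n x" for n
    using a_pos u_nonneg
  proof eventually_elim
    case (elim x)
    have "\<bar>u x\<bar> powr (1 - \<delta>) \<le> \<bar>u x + \<epsilon> n * \<phi> x\<bar> powr (1 - \<delta>)"
      using elim \<epsilon>[of n] \<phi>0[of x] \<delta> by (intro powr_mono2) (auto intro: order_trans[OF _ abs_ge_self])
    then show ?case using elim \<epsilon>[of n] by (simp add: g_def)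
  qed
  have iS: "integrable M (\<lambda>x. a x * \<bar>u x + h * \<phi> x\<bar> powr (1 - \<delta>))" for h
    using W0_integrable_a[OF W0_perturb(1)[OF u_W \<phi>, of 1 h]] by simp
  have g_eq: "g n x = (a x * \<bar>u x + \<epsilon> n * \<phi> x\<bar> powr (1 - \<delta>) - a x * \<bar>u x + 0 * \<phi> x\<bar> powr (1 - \<delta>)) / \<epsilon> n" for n x
    by (simp add: g_def right_diff_distrib)
  have gi: "integrable M (g n)" for n
    unfolding g_eq[abs_def] using iS by (intro integrable_divide Bochner_Integration.integrable_diff)
  have gint: "(\<integral>\<^sup>+x. ennreal (g n x) \<partial>M) = ennreal ((S \<phi> (\<epsilon> n) - S \<phi> 0) / \<epsilon> n)" for n
  proof -
    have "(LINT x|M. g n x) = (S \<phi> (\<epsilon> n) - S \<phi> 0) / \<epsilon> n"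
      unfolding g_eq S_def using iS[of "\<epsilon> n"] iS[of 0] by simp
    then show ?thesis using nn_integral_eq_integral[OF gi g0] by simp
  qed
  have "(\<integral>\<^sup>+x. liminf (\<lambda>n. ennreal (g n x)) \<partial>M) \<le> liminf (\<lambda>n. \<integral>\<^sup>+x. ennreal (g n x) \<partial>M)"
    by (rule nn_integral_liminf) measurable
  also have "\<dots> \<le> liminf (\<lambda>n::nat. ennreal ((1 - \<delta>) * (J' + 1)))"
    unfolding gint using Sle by (intro Liminf_mono) (auto elim!: eventually_mono intro: ennreal_leI)
  also have "\<dots> = ennreal ((1 - \<delta>) * (J' + 1))" by (simp add: Liminf_const)
  finally have fin: "(\<integral>\<^sup>+x. liminf (\<lambda>n. ennreal (g n x)) \<partial>M) < \<infinity>" by (rule le_less_trans) simp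
  then have "AE x in M. liminf (\<lambda>n. ennreal (g n x)) \<noteq> \<infinity>"
    by (intro nn_integral_PInf_AE) auto
  then show pos: "AE x in M. 0 < \<phi> x \<longrightarrow> 0 < u x"
    using a_pos u_nonneg
  proof eventually_elim
    case (elim x)
    show ?case
    proof (intro impI, rule ccontr)
      assume ph: "0 < \<phi> x" and "\<not> 0 < u x"
      then have u0: "u x = 0" using elim by simp
      \<comment> \<open>Where u vanishes but phi does not, the quotient grows like (n + 1)^\<delta>.
        The lower limit is infinite there, so such points form a null set.\<close>
      have "g n x = a x * \<phi> x powr (1 - \<delta>) * real (Suc n) powr \<delta>" for n
      proof -
        have "\<epsilon> n powr (1 - \<delta>) / \<epsilon> n = \<epsilon> n powr (- \<delta>)"
          using \<epsilon>[of n] by (simp add: powr_diff powr_minus field_simps)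
        also have "\<dots> = real (Suc n) powr \<delta>" by (simp add: \<epsilon>_def powr_divide powr_minus)
        finally have "\<epsilon> n powr (1 - \<delta>) / \<epsilon> n = real (Suc n) powr \<delta>" .
        moreover have "g n x = a x * \<phi> x powr (1 - \<delta>) * (\<epsilon> n powr (1 - \<delta>) / \<epsilon> n)"
          using \<epsilon>[of n] ph \<delta> by (simp add: g_def u0 abs_mult powr_mult)
        ultimately show ?thesis by simp
      qed
      moreover have "filterlim (\<lambda>n. a x * \<phi> x powr (1 - \<delta>) * real (Suc n) powr \<delta>) at_top sequentially"
      proof (rule filterlim_tendsto_pos_mult_at_top[OF tendsto_const])
        show "0 < a x * \<phi> x powr (1 - \<delta>)" using elim ph by simp
        have "filterlim (\<lambda>n. real (Suc n)) at_top sequentially"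
          by (rule filterlim_compose[OF filterlim_real_sequentially filterlim_Suc])
        from filterlim_compose[OF ln_at_top this]
        have "filterlim (\<lambda>n. \<delta> * ln (real (Suc n))) at_top sequentially"
          using \<delta> by (intro filterlim_tendsto_pos_mult_at_top[OF tendsto_const]) auto
        from filterlim_compose[OF exp_at_top this]
        show "filterlim (\<lambda>n. real (Suc n) powr \<delta>) at_top sequentially"
          by (simp add: powr_def)
      qed
      ultimately have "filterlim (\<lambda>n. g n x) at_top sequentially" by simp
      from liminf_ennreal_top[OF this] show False using elim by simp
    qed
  qed
  have "AE x in M. liminf (\<lambda>n. ennreal (g n x)) = ennreal ((1 - \<delta>) * (a x * u x powr (- \<delta>) * \<phi> x))"
    using pos a_pos u_nonneg
  proof eventually_elim
    case (elim x)
    have "(\<lambda>n. g n x) \<longlonglongrightarrow> (1 - \<delta>) * (a x * u x powr (- \<delta>) * \<phi> x)"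
    proof (cases "\<phi> x = 0")
      case True
      then show ?thesis by (simp add: g_def)
    next
      case False
      then have ux: "0 < u x" using elim \<phi>0[of x] by simp
      have "((\<lambda>h. (u x + h * \<phi> x) powr (1 - \<delta>)) has_real_derivative (1 - \<delta>) * u x powr (- \<delta>) * \<phi> x) (at 0)"
        using ux by (auto intro!: derivative_eq_intros)
      then have "((\<lambda>h. ((u x + (0 + h) * \<phi> x) powr (1 - \<delta>) - (u x + 0 * \<phi> x) powr (1 - \<delta>)) / h) \<longlongrightarrow> (1 - \<delta>) * u x powr (- \<delta>) * \<phi> x) (at 0)"
        by (simp add: DERIV_def)
      moreover have "filterlim \<epsilon> (at 0) sequentially" using \<epsilon>0 \<epsilon> by (auto simp: filterlim_at less_imp_neq[symmetric])
      ultimately have "(\<lambda>n. ((u x + (0 + \<epsilon> n) * \<phi> x) powr (1 - \<delta>) - (u x + 0 * \<phi> x) powr (1 - \<delta>)) / \<epsilon> n) \<longlonglongrightarrow> (1 - \<delta>) * u x powr (- \<delta>) * \<phi> x"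
        by (rule filterlim_compose)
      from tendsto_mult_left[OF this, of "a x"]
      show ?thesis using ux \<epsilon> \<phi>0[of x] by (simp add: g_def mult_ac less_imp_le add_nonneg_nonneg)
    qed
    from tendsto_ennrealI[OF this] show ?case by (rule lim_imp_Liminf[OF sequentially_bot])
  qed
  then have "(\<integral>\<^sup>+x. ennreal ((1 - \<delta>) * (a x * u x powr (- \<delta>) * \<phi> x)) \<partial>M) < \<infinity>"
    using fin by (subst nn_integral_cong_AE[of _ "\<lambda>x. liminf (\<lambda>n. ennreal (g n x))"]) (auto elim: eventually_mono)
  then have "integrable M (\<lambda>x. (1 - \<delta>) * (a x * u x powr (- \<delta>) * \<phi> x))"
    using a_pos \<delta> \<phi>0 by (intro integrableI_nonneg) (auto elim!: eventually_mono)
  then show "integrable M (\<lambda>x. a x * u x powr (- \<delta>) * \<phi> x)" using \<delta> by simp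
qed

text \<open>Countably many compact boxes exhaust the domain, and on each of them some nonnegative
  test function is positive.\<close>

lemma u_pos: "AE x in M. 0 < u x"
proof -
  obtain \<D> where D: "countable \<D>" "\<D> \<subseteq> Pow \<Omega>" "\<And>X. X \<in> \<D> \<Longrightarrow> \<exists>a b. X = cbox a b" "\<Union>\<D> = \<Omega>"
    using open_countable_Union_open_cbox[OF open_domain] by metis
  have "AE x in M. x \<in> X \<longrightarrow> 0 < u x" if X: "X \<in> \<D>" for X
  proof -
    have "compact X" "X \<subseteq> \<Omega>" using D(2,3) X compact_cbox by blast+
    then obtain \<phi> where \<phi>: "\<phi> \<in> Cc_inf \<Omega>" "\<And>x. 0 \<le> \<phi> x" "\<And>x. x \<in> X \<Longrightarrow> 1 \<le> \<phi> x"
      using Cc_inf_dominating[OF open_domain] by metis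
    show ?thesis
      using singular_term_nonneg_test(1)[OF \<phi>(1,2)] by eventually_elim (use \<phi>(3) in force)
  qed
  then have "AE x in M. \<forall>X\<in>\<D>. x \<in> X \<longrightarrow> 0 < u x" unfolding AE_ball_countable[OF D(1)] by blast
  moreover have "AE x in M. x \<in> space M" by (rule AE_space)
  ultimately show ?thesis by eventually_elim (use D(4) in auto)
qed

text \<open>A nonnegative test function that is at least 1 on K majorises the indicator of K, and
  against it the singular term is already integrable.\<close>

lemma singular_term_locally_integrable:
  assumes K: "compact K" "K \<subseteq> \<Omega>"
  shows "integrable M (\<lambda>x. indicator K x * (a x * u x powr (- \<delta>)))"
proof -
  obtain \<phi> where \<phi>: "\<phi> \<in> Cc_inf \<Omega>" "\<And>x. 0 \<le> \<phi> x" "\<And>x. x \<in> K \<Longrightarrow> 1 \<le> \<phi> x"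
    using Cc_inf_dominating[OF open_domain K] by metis
  have Km: "indicator K \<in> borel_measurable M"
    using K by (intro borel_measurable_indicator) (auto simp: sets_restrict_space intro!: image_eqI[of _ _ K] borel_compact)
  show ?thesis
  proof (rule Bochner_Integration.integrable_bound[OF singular_term_nonneg_test(2)[OF \<phi>(1,2)]])
    show "AE x in M. norm (indicator K x * (a x * u x powr (- \<delta>))) \<le> norm (a x * u x powr (- \<delta>) * \<phi> x)"
    proof (rule AE_I2)
      fix x
      have "\<bar>a x * u x powr (- \<delta>)\<bar> * 1 \<le> \<bar>a x * u x powr (- \<delta>)\<bar> * \<phi> x" if "x \<in> K"
        using \<phi>(3)[OF that] by (intro mult_left_mono) auto
      then show "norm (indicator K x * (a x * u x powr (- \<delta>))) \<le> norm (a x * u x powr (- \<delta>) * \<phi> x)"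
        using \<phi>(2)[of x] by (cases "x \<in> K") (auto simp: abs_mult)
    qed
  qed (use Km in measurable)
qed

lemma derivative_S:
  assumes \<psi>: "\<psi> \<in> Cc_inf \<Omega>"
  shows "integrable M (\<lambda>x. a x * u x powr (- \<delta>) * \<psi> x)"
    "(S \<psi> has_real_derivative (1 - \<delta>) * (LINT x|M. a x * u x powr (- \<delta>) * \<psi> x)) (at 0)"
proof -
  note \<psi>1 = Cc_inf_subset_Cc_1[OF \<psi>]
  obtain K where K: "compact K" "K \<subseteq> \<Omega>" "\<And>x. x \<notin> K \<Longrightarrow> \<psi> x = 0" using Cc_1_D(4)[OF \<psi>1] by blast
  obtain D where D: "0 < D" "\<And>x. \<bar>\<psi> x\<bar> \<le> D" using Cc_1_bounds[OF \<psi>1] by metis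
  have \<psi>m [measurable]: "\<psi> \<in> borel_measurable M" by (intro continuous_imp_measurable_lebesgue_on Cc_1_D(1)[OF \<psi>1])
  have i0: "integrable M (\<lambda>x. a x * \<bar>u x + 0 * \<psi> x\<bar> powr (1 - \<delta>))"
    using W0_integrable_a[OF u_W] by simp
  \<comment> \<open>The majorant is confined to the support of the test function, since the singular
    factor is integrable only locally.\<close>
  have iw: "integrable M (\<lambda>x. (2 powr \<delta> * D) * (indicator K x * (a x * u x powr (- \<delta>))))"
    using singular_term_locally_integrable[OF K(1,2)] by simp
  have bd: "AE x in M. \<forall>h. \<bar>h\<bar> \<le> 1 \<longrightarrow> \<bar>a x * \<bar>u x + h * \<psi> x\<bar> powr (1 - \<delta>) - a x * \<bar>u x + 0 * \<psi> x\<bar> powr (1 - \<delta>)\<bar>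
      \<le> \<bar>h\<bar> * ((2 powr \<delta> * D) * (indicator K x * (a x * u x powr (- \<delta>))))"
    using u_pos a_pos
  proof eventually_elim
    case (elim x)
    show ?case
    proof (intro allI impI)
      fix h :: real
      have "a x * \<bar>\<bar>u x + h * \<psi> x\<bar> powr (1 - \<delta>) - u x powr (1 - \<delta>)\<bar> \<le> a x * (2 powr \<delta> * \<bar>h * \<psi> x\<bar> * u x powr (- \<delta>))"
        using elim by (intro mult_left_mono singular_powr_diff_bound \<delta>) auto
      also have "\<dots> = \<bar>h\<bar> * (2 powr \<delta> * \<bar>\<psi> x\<bar> * (a x * u x powr (- \<delta>)))" by (simp add: abs_mult mult_ac)
      also have "\<dots> \<le> \<bar>h\<bar> * ((2 powr \<delta> * (D * indicator K x)) * (a x * u x powr (- \<delta>)))"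
        using elim D(2)[of x] K(3)[of x] by (intro mult_left_mono mult_right_mono) (auto simp: indicator_def)
      finally show "\<bar>a x * \<bar>u x + h * \<psi> x\<bar> powr (1 - \<delta>) - a x * \<bar>u x + 0 * \<psi> x\<bar> powr (1 - \<delta>)\<bar>
          \<le> \<bar>h\<bar> * ((2 powr \<delta> * D) * (indicator K x * (a x * u x powr (- \<delta>))))"
        using elim by (simp add: abs_mult mult_ac flip: right_diff_distrib)
    qed
  qed
  have der: "AE x in M. ((\<lambda>h. a x * \<bar>u x + h * \<psi> x\<bar> powr (1 - \<delta>)) has_real_derivative (1 - \<delta>) * (a x * u x powr (- \<delta>) * \<psi> x)) (at 0)"
    using u_pos
  proof eventually_elim
    case (elim x)
    have "((\<lambda>y. y powr (1 - \<delta>)) has_real_derivative (1 - \<delta>) * u x powr (- \<delta>)) (at (u x))"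
      using elim by (auto intro!: derivative_eq_intros)
    then have "((\<lambda>y. \<bar>y\<bar> powr (1 - \<delta>)) has_real_derivative (1 - \<delta>) * u x powr (- \<delta>)) (at (u x))"
      by (rule has_field_derivative_transform_within_open[of _ _ _ "{0<..}"]) (use elim in auto)
    then have "((\<lambda>y. \<bar>y\<bar> powr (1 - \<delta>)) has_real_derivative (1 - \<delta>) * u x powr (- \<delta>)) (at (u x + 0 * \<psi> x))" by simp
    then have "((\<lambda>h. \<bar>u x + h * \<psi> x\<bar> powr (1 - \<delta>)) has_real_derivative (1 - \<delta>) * u x powr (- \<delta>) * \<psi> x) (at 0)"
      by (rule DERIV_chain2) (auto intro!: derivative_eq_intros)
    from DERIV_cmult[OF this, of "a x"] show ?case by (rule DERIV_cong) (simp add: mult_ac)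
  qed
  note R = has_real_derivative_integral[OF i0 iw _ _ der bd]
  have "integrable M (\<lambda>x. (1 - \<delta>) * (a x * u x powr (- \<delta>) * \<psi> x))" by (rule R(1)) measurable
  then show "integrable M (\<lambda>x. a x * u x powr (- \<delta>) * \<psi> x)" using \<delta> by simp
  have "((\<lambda>h. LINT x|M. a x * \<bar>u x + h * \<psi> x\<bar> powr (1 - \<delta>)) has_real_derivative (LINT x|M. (1 - \<delta>) * (a x * u x powr (- \<delta>) * \<psi> x))) (at 0)"
    by (rule R(3)) measurable
  then show "(S \<psi> has_real_derivative (1 - \<delta>) * (LINT x|M. a x * u x powr (- \<delta>) * \<psi> x)) (at 0)"
    by (simp add: S_def[abs_def])
qed

definition flux :: "(real^'n \<Rightarrow> real) \<Rightarrow> real^'n \<Rightarrow> real" where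
  "flux \<phi> x = (H (gr u x) powr (p - 1) + \<mu> x * H (gr u x) powr (q - 1)) * (fgrad H (gr u x) \<bullet> cgrad \<phi> x)"

definition source :: "real^'n \<Rightarrow> real" where
  "source x = a x * u x powr (- \<delta>) + lam * b x * u x powr (r - 1)"

lemma Euler_Lagrange_Cc_inf:
  assumes \<psi>: "\<psi> \<in> Cc_inf \<Omega>"
  shows "(LINT x|M. flux \<psi> x) = (LINT x|M. source x * \<psi> x)"
proof -
  define FA where "FA = (LINT x|M. H (gr u x) powr (p - 1) * (fgrad H (gr u x) \<bullet> cgrad \<psi> x))"
  define FB where "FB = (LINT x|M. \<mu> x * (H (gr u x) powr (q - 1) * (fgrad H (gr u x) \<bullet> cgrad \<psi> x)))"
  define FS where "FS = (LINT x|M. a x * u x powr (- \<delta>) * \<psi> x)"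
  define FT where "FT = (LINT x|M. b x * u x powr (r - 1) * \<psi> x)"
  \<comment> \<open>The divisors in the energy are chosen to cancel the factors p, q, 1 - \<delta>
    and r produced by differentiation.\<close>
  have "((\<lambda>\<epsilon>. A \<psi> \<epsilon> / p + B \<psi> \<epsilon> / q - S \<psi> \<epsilon> / (1 - \<delta>) - lam * T \<psi> \<epsilon> / r) has_real_derivative
      p * FA / p + q * FB / q - (1 - \<delta>) * FS / (1 - \<delta>) - lam * (r * FT) / r) (at 0)"
    unfolding FA_def FB_def FS_def FT_def
    by (intro DERIV_diff DERIV_add DERIV_cdivide DERIV_cmult derivative_A derivative_S derivative_T \<psi>)
  then have "((\<lambda>\<epsilon>. fib \<psi> \<epsilon> 1) has_real_derivative FA + FB - FS - lam * FT) (at 0)"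
    using pq r_gt \<delta> by (simp add: fib_def)
  moreover obtain d where "0 < d" "\<And>\<epsilon>. dist \<epsilon> 0 < d \<Longrightarrow> fib \<psi> 0 1 \<le> fib \<psi> \<epsilon> 1"
    using local_minimum[OF \<psi>] by (auto simp: eventually_nhds_metric)
  ultimately have "FA + FB - FS - lam * FT = 0"
    by (intro DERIV_local_min[of "\<lambda>\<epsilon>. fib \<psi> \<epsilon> 1" _ 0 d]) (auto simp: dist_real_def)
  moreover have "(LINT x|M. flux \<psi> x) = FA + FB"
    unfolding FA_def FB_def flux_def distrib_right mult.assoc
    by (rule Bochner_Integration.integral_add[OF derivative_A(1,3)[OF \<psi>]])
  moreover have "(LINT x|M. source x * \<psi> x) = FS + lam * FT"
  proof -
    have "(LINT x|M. source x * \<psi> x) = (LINT x|M. a x * u x powr (- \<delta>) * \<psi> x + lam * (b x * u x powr (r - 1) * \<psi> x))"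
      by (simp add: source_def distrib_right mult.assoc)
    also have "\<dots> = FS + lam * FT"
      unfolding FS_def FT_def using derivative_S(1)[OF \<psi>] derivative_T(1)[OF \<psi>] by simp
    finally show ?thesis .
  qed
  ultimately show ?thesis by simp
qed

text \<open>The limit is taken in the finished equation. Pointwise convergence of the mollifications
  and their gradients, their uniform bounds and their common compact support suffice for dominated
  convergence on both sides.\<close>

lemma Euler_Lagrange:
  assumes \<phi>: "\<phi> \<in> Cc_1 \<Omega>"
  shows "integrable M (flux \<phi>)" "integrable M (\<lambda>x. source x * \<phi> x)"
    "(LINT x|M. flux \<phi> x) = (LINT x|M. source x * \<phi> x)"
proof -
  obtain \<psi> K D where \<psi>: "\<And>n::nat. \<psi> n \<in> Cc_inf \<Omega>" and K: "compact K" "K \<subseteq> \<Omega>"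
    and \<psi>0: "\<And>n x. x \<notin> K \<Longrightarrow> \<psi> n x = 0"
    and D: "\<And>n x. \<bar>\<psi> n x\<bar> \<le> D" "\<And>n x. norm (cgrad (\<psi> n) x) \<le> D"
    and lim: "\<And>x. (\<lambda>n. \<psi> n x) \<longlonglongrightarrow> \<phi> x" "\<And>x. (\<lambda>n. cgrad (\<psi> n) x) \<longlonglongrightarrow> cgrad \<phi> x"
  proof (rule Cc_1_approximation[OF open_domain \<phi>], goal_cases)
    case (1 \<psi> K D)
    show ?case by (rule 1(1)[OF 1(2-)])
  qed
  have m [measurable]: "\<phi> \<in> borel_measurable M" "cgrad \<phi> \<in> borel_measurable M" if "\<phi> \<in> Cc_1 \<Omega>" for \<phi>
    by (intro continuous_imp_measurable_lebesgue_on Cc_1_D(1)[OF that] Cc_1_continuous_cgrad[OF that])+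
  have D0: "0 \<le> D" using abs_ge_zero D(1) order_trans by blast
  obtain P where P: "0 < P"
    "\<And>\<xi> \<eta>. norm \<eta> \<le> D \<Longrightarrow> \<bar>H \<xi> powr (p - 1) * (fgrad H \<xi> \<bullet> \<eta>)\<bar> \<le> P * (1 + H \<xi> powr p)"
    using finsler_powr_diff_bound[OF H pq(1) D0] by metis
  have q1: "1 < q" using pq by simp
  obtain Q where Q: "0 < Q"
    "\<And>\<xi> \<eta>. norm \<eta> \<le> D \<Longrightarrow> \<bar>H \<xi> powr (q - 1) * (fgrad H \<xi> \<bullet> \<eta>)\<bar> \<le> Q * (1 + H \<xi> powr q)"
    using finsler_powr_diff_bound[OF H q1 D0] by metis
  note IG = W0_integrable_gradient[OF u_W]
  have Hm: "(\<lambda>x. H (gr u x)) \<in> borel_measurable M" by (rule finsler_compose_measurable[OF gr_u_measurable])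
  have fm: "(\<lambda>x. fgrad H (gr u x)) \<in> borel_measurable M"
    by (rule measurable_compose[OF gr_u_measurable finsler_fgrad_measurable[OF H]])
  have flm: "flux \<phi> \<in> borel_measurable M" if "\<phi> \<in> Cc_1 \<Omega>" for \<phi>
    unfolding flux_def[abs_def] using Hm fm m(2)[OF that] by measurable
  have fl1: "integrable M (\<lambda>x. P * (1 + H (gr u x) powr p) + Q * (\<mu> x + \<mu> x * H (gr u x) powr q))"
    using IG integrable_\<mu> integrable_const_domain[of 1] by simp
  have fl2: "AE x in M. norm (flux (\<psi> n) x) \<le> P * (1 + H (gr u x) powr p) + Q * (\<mu> x + \<mu> x * H (gr u x) powr q)" for n
  proof (rule AE_I2)
    fix x assume x: "x \<in> space M"
    have "\<bar>flux (\<psi> n) x\<bar> \<le> \<bar>H (gr u x) powr (p - 1) * (fgrad H (gr u x) \<bullet> cgrad (\<psi> n) x)\<bar>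
        + \<bar>\<mu> x * (H (gr u x) powr (q - 1) * (fgrad H (gr u x) \<bullet> cgrad (\<psi> n) x))\<bar>"
      unfolding flux_def distrib_right mult.assoc by (rule abs_triangle_ineq)
    also have "\<bar>\<mu> x * (H (gr u x) powr (q - 1) * (fgrad H (gr u x) \<bullet> cgrad (\<psi> n) x))\<bar>
        \<le> \<mu> x * (Q * (1 + H (gr u x) powr q))"
      unfolding abs_mult[of "\<mu> x"] using x \<mu>_nonneg[of x] Q(2)[OF D(2)] by (auto intro!: mult_left_mono)
    also have "\<bar>H (gr u x) powr (p - 1) * (fgrad H (gr u x) \<bullet> cgrad (\<psi> n) x)\<bar> \<le> P * (1 + H (gr u x) powr p)"
      by (rule P(2)[OF D(2)])
    finally show "norm (flux (\<psi> n) x) \<le> P * (1 + H (gr u x) powr p) + Q * (\<mu> x + \<mu> x * H (gr u x) powr q)"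
      by (simp add: algebra_simps)
  qed
  have fl3: "AE x in M. (\<lambda>n. flux (\<psi> n) x) \<longlonglongrightarrow> flux \<phi> x"
    unfolding flux_def by (intro AE_I2 tendsto_intros lim)
  show "integrable M (flux \<phi>)"
    by (rule integrable_dominated_convergence[OF flm[OF \<phi>] flm[OF Cc_inf_subset_Cc_1[OF \<psi>]] fl1 fl3 fl2])
  have L1: "(\<lambda>n. LINT x|M. flux (\<psi> n) x) \<longlonglongrightarrow> (LINT x|M. flux \<phi> x)"
    by (rule integral_dominated_convergence[OF flm[OF \<phi>] flm[OF Cc_inf_subset_Cc_1[OF \<psi>]] fl1 fl3 fl2])
  have sm: "(\<lambda>x. source x * \<phi> x) \<in> borel_measurable M" if "\<phi> \<in> Cc_1 \<Omega>" for \<phi>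
    unfolding source_def using m(1)[OF that] by measurable
  have iu: "integrable M (\<lambda>x. \<bar>u x\<bar> powr r)" by (rule W0_integrable_critical[OF u_W])
  have ib: "integrable M (\<lambda>x. b x * u x powr (r - 1))"
  proof (rule integrable_b_mult, rule Bochner_Integration.integrable_bound)
    show "integrable M (\<lambda>x. 1 + \<bar>u x\<bar> powr r)" using iu integrable_const_domain[of 1] by simp
    show "AE x in M. norm (u x powr (r - 1)) \<le> norm (1 + \<bar>u x\<bar> powr r)"
      using u_pos
    proof eventually_elim
      case (elim x)
      \<comment> \<open>Comparing u with 1 bounds the lower power by the integrable function 1 +
        u^r.\<close>
      have "u x powr (r - 1) \<le> 1 + u x powr r"
      proof (cases "u x \<le> 1")
        case True
        then have "u x powr (r - 1) \<le> 1" using elim r_gt by (intro powr_le1) auto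
        then show ?thesis using powr_ge_zero[of "u x" r] by linarith
      next
        case False
        then have "u x powr (r - 1) \<le> u x powr r" by (intro powr_mono) auto
        then show ?thesis by simp
      qed
      then show ?case using elim by simp
    qed
  qed measurable
  have s1: "integrable M (\<lambda>x. D * (indicator K x * (a x * u x powr (- \<delta>))) + D * \<bar>lam * (b x * u x powr (r - 1))\<bar>)"
    using singular_term_locally_integrable[OF K] ib by simp
  \<comment> \<open>Only the singular part is cut off to K, the common support; the term with b is
    integrable on the whole domain.\<close>
  have s2: "AE x in M. norm (source x * \<psi> n x) \<le> D * (indicator K x * (a x * u x powr (- \<delta>))) + D * \<bar>lam * (b x * u x powr (r - 1))\<bar>" for n
    using a_pos
  proof eventually_elim
    case (elim x)
    have "\<bar>source x\<bar> \<le> a x * u x powr (- \<delta>) + \<bar>lam * (b x * u x powr (r - 1))\<bar>"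
      unfolding source_def using elim abs_triangle_ineq[of "a x * u x powr (- \<delta>)" "lam * (b x * u x powr (r - 1))"]
      by (simp add: mult.assoc abs_mult)
    then have "\<bar>source x\<bar> * \<bar>\<psi> n x\<bar> \<le> (a x * u x powr (- \<delta>) + \<bar>lam * (b x * u x powr (r - 1))\<bar>) * (D * indicator K x)"
      using D(1)[of n x] \<psi>0[of x n] elim by (intro mult_mono) (auto simp: indicator_def)
    also have "\<dots> \<le> D * (indicator K x * (a x * u x powr (- \<delta>))) + D * \<bar>lam * (b x * u x powr (r - 1))\<bar>"
      using D0 by (auto simp: indicator_def algebra_simps)
    finally show ?case by (simp add: abs_mult)
  qed
  have s3: "AE x in M. (\<lambda>n. source x * \<psi> n x) \<longlonglongrightarrow> source x * \<phi> x"
    by (intro AE_I2 tendsto_intros lim)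
  show "integrable M (\<lambda>x. source x * \<phi> x)"
    by (rule integrable_dominated_convergence[OF sm[OF \<phi>] sm[OF Cc_inf_subset_Cc_1[OF \<psi>]] s1 s3 s2])
  have "(\<lambda>n. LINT x|M. source x * \<psi> n x) \<longlonglongrightarrow> (LINT x|M. source x * \<phi> x)"
    by (rule integral_dominated_convergence[OF sm[OF \<phi>] sm[OF Cc_inf_subset_Cc_1[OF \<psi>]] s1 s3 s2])
  then show "(LINT x|M. flux \<phi> x) = (LINT x|M. source x * \<phi> x)"
    using L1 unfolding Euler_Lagrange_Cc_inf[OF \<psi>] by (rule LIMSEQ_unique[rotated])
qed

end

context finsler_double_phase
begin

text \<open>Letting \<open>k \<rightarrow> \<infinity>\<close> in the Ekeland inequality shows that the infimum of the energy is a genuine lower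
  bound, without knowing beforehand that the energy is bounded below on the Nehari manifold.\<close>
lemma min_seq_lower_bound:
  assumes useq: "min_seq H p q \<mu> \<Omega> a b \<delta> lam u" and r: "strict_mono r"
    and conv: "(\<lambda>j. wnorm H p q \<mu> \<Omega> (\<lambda>x. u (r j) x - u0 x)) \<longlonglongrightarrow> 0" and u0: "u0 \<in> W"
    and v: "v \<in> Mplus H p q \<mu> \<Omega> a b \<delta> lam"
  shows "mplus H p q \<mu> \<Omega> a b \<delta> lam \<le> Ifun H p q \<mu> \<Omega> a b \<delta> lam v"
proof -
  have vW: "v \<in> W" using v by (simp add: Mplus_def)
  obtain Q where Q: "0 < Q" "\<And>u v w s. u \<in> W \<Longrightarrow> v \<in> W \<Longrightarrow> w \<in> W \<Longrightarrow>
    wnorm H p q \<mu> \<Omega> (\<lambda>x. u x - w x) < s \<Longrightarrow> wnorm H p q \<mu> \<Omega> (\<lambda>x. v x - w x) < s \<Longrightarrow>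
    wnorm H p q \<mu> \<Omega> (\<lambda>x. u x - v x) \<le> Q * s"
  proof (rule wnorm_quasi_triangle, goal_cases)
    case (1 Q)
    show ?case by (rule 1(1)[OF 1(2-)])
  qed
  \<comment> \<open>One strict bound serves for both distances to u0: the sequence is eventually
    closer than 1, and v is closer than its own distance plus 1. Hence Q s bounds the distance from
    v to the sequence independently of j.\<close>
  define s where "s = max 1 (wnorm H p q \<mu> \<Omega> (\<lambda>x. v x - u0 x) + 1)"
  have s: "1 \<le> s" "wnorm H p q \<mu> \<Omega> (\<lambda>x. v x - u0 x) < s" by (auto simp: s_def)
  have "\<forall>\<^sub>F j in sequentially. wnorm H p q \<mu> \<Omega> (\<lambda>x. u (r j) x - u0 x) < 1"
    using order_tendstoD(2)[OF conv] by simp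
  then have "\<forall>\<^sub>F j in sequentially. mplus H p q \<mu> \<Omega> a b \<delta> lam - Q * s / real j \<le> Ifun H p q \<mu> \<Omega> a b \<delta> lam v"
    using eventually_ge_at_top[of 1]
  proof eventually_elim
    case (elim j)
    have rj: "j \<le> r j" by (rule seq_suble[OF r])
    then have k: "1 \<le> r j" using elim(2) by simp
    have uk: "u (r j) \<in> W" and
      m: "mplus H p q \<mu> \<Omega> a b \<delta> lam \<le> Ifun H p q \<mu> \<Omega> a b \<delta> lam (u (r j))" and
      e: "Ifun H p q \<mu> \<Omega> a b \<delta> lam (u (r j)) - wnorm H p q \<mu> \<Omega> (\<lambda>x. v x - u (r j) x) / real (r j)
        \<le> Ifun H p q \<mu> \<Omega> a b \<delta> lam v"
      using useq k v by (auto simp: min_seq_def Mplus_def)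
    have "wnorm H p q \<mu> \<Omega> (\<lambda>x. v x - u (r j) x) \<le> Q * s"
      using elim(1) s by (intro Q(2)[OF vW uk u0]) auto
    then have "wnorm H p q \<mu> \<Omega> (\<lambda>x. v x - u (r j) x) / real (r j) \<le> Q * s / real (r j)"
      by (rule divide_right_mono) simp
    also have "\<dots> \<le> Q * s / real j" using rj elim(2) Q(1) s(1) by (intro divide_left_mono) auto
    finally show ?case using m e by linarith
  qed
  moreover have "(\<lambda>j. mplus H p q \<mu> \<Omega> a b \<delta> lam - Q * s / real j) \<longlonglongrightarrow> mplus H p q \<mu> \<Omega> a b \<delta> lam - 0"
    by (intro tendsto_diff tendsto_const lim_const_over_n)
  ultimately show ?thesis by (intro tendsto_upperbound) auto
qed

end

theorem mainTheorem18:
  fixes \<Omega> :: "(real^'n) set"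
    and H \<mu> a b :: "real^'n \<Rightarrow> real"
    and p q \<delta> lam \<alpha> \<Lambda> :: real
    and u :: "nat \<Rightarrow> real^'n \<Rightarrow> real"
    and u0 :: "real^'n \<Rightarrow> real"
    and r :: "nat \<Rightarrow> nat"
  assumes N2: "CARD('n) \<ge> 2"
    and dom: "lipschitz_domain \<Omega>"
    and Hnorm: "finsler_minkowski H"
    and alpha: "\<alpha> = pstar (real CARD('n)) p - 1"
    and H1_lam: "lam > 0"
    and H1_delta: "0 < \<delta>" "\<delta> < 1"
    and H1_pq: "2 \<le> p" "p < q" "q < real CARD('n)"
    and H1_alpha: "q < \<alpha> + 1" "\<alpha> + 1 \<le> pstar (real CARD('n)) p"
    and H1_ratio: "q / p < 1 + 1 / real CARD('n)"
    and H1_mu: "\<forall>x\<in>closure \<Omega>. 0 \<le> \<mu> x" "\<exists>L. L-lipschitz_on (closure \<Omega>) \<mu>"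
    and H3_pos: "AE x in lebesgue_on \<Omega>. a x > 0"
    and H3_int: "a \<in> borel_measurable (lebesgue_on \<Omega>)"
      "(\<integral>\<^sup>+ x. ennreal (\<bar>a x\<bar> powr (pstar (real CARD('n)) p / (pstar (real CARD('n)) p - 1 + \<delta>)))
          \<partial>lebesgue_on \<Omega>) < \<infinity>"
    and H4_inf: "b \<in> borel_measurable (lebesgue_on \<Omega>)" "\<exists>C. AE x in lebesgue_on \<Omega>. \<bar>b x\<bar> \<le> C"
    and H4_pos: "\<not> (AE x in lebesgue_on \<Omega>. max (b x) 0 = 0)"
    and Lam: "\<Lambda> > 0" "lam < \<Lambda>"
    and strongcon: "strong_con H p q \<mu> \<Omega> a b \<delta> lam"
    and useq: "min_seq H p q \<mu> \<Omega> a b \<delta> lam u"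
    and r: "strict_mono r"
    and conv: "(\<lambda>j. wnorm H p q \<mu> \<Omega> (\<lambda>x. u (r j) x - u0 x)) \<longlonglongrightarrow> 0"
    and u0W: "u0 \<in> W0 H p q \<mu> \<Omega>"
    and u0nonneg: "AE x in lebesgue_on \<Omega>. 0 \<le> u0 x"
    and u0M: "u0 \<in> Mplus H p q \<mu> \<Omega> a b \<delta> lam"
    and u0min: "Ifun H p q \<mu> \<Omega> a b \<delta> lam u0 = mplus H p q \<mu> \<Omega> a b \<delta> lam"
  shows "(AE x in lebesgue_on \<Omega>. 0 < u0 x) \<and> weak_solution H p q \<mu> \<Omega> a b \<delta> lam \<alpha> u0"
proof -
  have \<Omega>: "open \<Omega>" "bounded \<Omega>" using dom by (auto simp: lipschitz_domain_def)
  have p1: "1 < p" and pN: "p < real CARD('n)" using H1_pq by auto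
  obtain L where "L-lipschitz_on (closure \<Omega>) \<mu>" using H1_mu(2) by blast
  then have \<mu>c: "continuous_on (closure \<Omega>) \<mu>" by (rule lipschitz_on_continuous_on)
  \<comment> \<open>The closure of the bounded domain is compact, so the continuous weight is
    bounded; this makes constants belong to the double phase space.\<close>
  have "bounded (\<mu> ` closure \<Omega>)"
    using compact_continuous_image[OF \<mu>c] \<Omega>(2) by (simp add: compact_imp_bounded)
  then obtain m where m: "\<And>x. x \<in> closure \<Omega> \<Longrightarrow> \<bar>\<mu> x\<bar> \<le> m" by (auto simp: bounded_iff)
  interpret finsler_double_phase p q \<mu> \<Omega> H
  proof
    show "\<mu> \<in> borel_measurable (lebesgue_on \<Omega>)"
      using continuous_on_subset[OF \<mu>c closure_subset] \<Omega>(1)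
      by (intro continuous_imp_measurable_on_sets_lebesgue) auto
    show "\<exists>m. \<forall>x\<in>\<Omega>. \<mu> x \<le> m"
      using m closure_subset[of \<Omega>] by (metis abs_le_D1 subsetD)
    show "0 \<le> \<mu> x" if "x \<in> \<Omega>" for x using H1_mu(1) that closure_subset by blast
  qed (use \<Omega> p1 H1_pq Hnorm in auto)
  interpret critical_minimiser p q \<mu> \<Omega> H a b \<delta> lam "pstar (real CARD('n)) p" u0
  proof
    show "Ifun H p q \<mu> \<Omega> a b \<delta> lam u0 \<le> Ifun H p q \<mu> \<Omega> a b \<delta> lam v"
      if "v \<in> Mplus H p q \<mu> \<Omega> a b \<delta> lam" for v
      unfolding u0min by (rule min_seq_lower_bound[OF useq r conv u0W that])
  qed (use N2 pN H1_delta H3_pos H3_int H4_inf u0M u0nonneg in auto)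
  have "weak_solution H p q \<mu> \<Omega> a b \<delta> lam \<alpha> u0"
    unfolding weak_solution_def Let_def set_integrable_eq_lebesgue_on[OF domain_lebesgue]
      LINT_eq_lebesgue_on[OF domain_lebesgue] alpha
    using u0W u_pos Euler_Lagrange[unfolded flux_def[abs_def] source_def] by blast
  then show ?thesis using u_pos by blast
qed

end
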